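(* Let $\mathbb F$ be an algebraically closed field and let $q\in\mathbb F$ be nonzero and not a root of unity. Let $V$ denote an evaluation module for $\boxtimes_q$, with diameter $d$ and evaluation parameter $t$. The matrices in ${\rm Mat}_{d+1}(\mathbb F)$ that represent the standard generators with respect to the $[i,j,k,\ell]$-bases for $V$ ($i,j,k,\ell$ mutually distinct in $\mathbb Z_4$) are as follows. Pick $r\in\mathbb Z_4$, and first assume that $r$ is even. Then the generators are represented by: $$\begin{array}{c|cccc}\text{basis}&x_{r,r+1}&x_{r+1,r+2}&x_{r+2,r+3}&x_{r+3,r}\\ \hline [r,r+1,r+2,r+3]&ZS_{q^{-1}}(t^{-1})Z&E_q&K_q&ZG_{q^{-1}}(t)Z\\ [r+1,r,r+2,r+3]&S_q(t^{-1})&G_q(t)&K_q&ZE_{q^{-1}}Z\\ [r,r+1,r+3,r+2]&S_{q^{-1}}(t^{-1})&ZE_qZ&K_{q^{-1}}&G_{q^{-1}}(t)\\ [r+1,r,r+3,r+2]&ZS_q(t^{-1})Z&ZG_q(t)Z&K_{q^{-1}}&E_{q^{-1}}\\ [r,r+2,r+1,r+3]&F_q(t^{-1})&E_{q^{-1}}&ZE_qZ&ZF_{q^{-1}}(t)Z\\ [r+2,r,r+1,r+3]&E_q&F_{q^{-1}}(t)&ZF_q(t^{-1})Z&ZE_{q^{-1}}Z\end{array}$$ $$\begin{array}{c|cccc}\text{basis}&x_{r,r+2}&x_{r+1,r+3}&x_{r+2,r}&x_{r+3,r+1}\\ \hline [r,r+1,r+2,r+3]&L_q(t)&(ZE_{q^{-1}}Z)^{-1}&(L_q(t))^{-1}&ZE_{q^{-1}}Z\\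 [r+1,r,r+2,r+3]&E_q&(ZL_{q^{-1}}(t)Z)^{-1}&(E_q)^{-1}&ZL_{q^{-1}}(t)Z\\ [r,r+1,r+3,r+2]&ZL_q(t)Z&(E_{q^{-1}})^{-1}&(ZL_q(t)Z)^{-1}&E_{q^{-1}}\\ [r+1,r,r+3,r+2]&ZE_qZ&(L_{q^{-1}}(t))^{-1}&(ZE_qZ)^{-1}&L_{q^{-1}}(t)\\ [r,r+2,r+1,r+3]&ZM_{q^{-1}}(t^{-1})Z&K_q&M_q(t)&K_{q^{-1}}\\ [r+2,r,r+1,r+3]&ZM_q(t)Z&K_q&M_{q^{-1}}(t^{-1})&K_{q^{-1}}\end{array}$$ Next assume that $r$ is odd. Then the same tables hold with $t$ replaced by $t^{-1}$.
   Context: Algebras are associative with 1. $[n]_q=(q^n-q^{-n})/(q-q^{-1})$, $\mathbb Z_4=\mathbb Z/4\mathbb Z$, and $(a;q)_n=(1-a)(1-aq)\cdots(1-aq^{n-1})$. The $q$-tetrahedron algebra $\boxtimes_q$ is the $\mathbb F$-algebra with generators (called the standard generators) $\{x_{ij}\mid i,j\in\mathbb Z_4,\ j-i=1\text{ or }j-i=2\}$ and relations: (i) $x_{ij}x_{ji}=1$ if $j-i=2$; (ii) $\frac{qx_{ij}x_{jk}-q^{-1}x_{jk}x_{ij}}{q-q^{-1}}=1$ if $(j-i,k-j)$ is one of $(1,1),(1,2),(2,1)$; (iii) $x_{ij}^3x_{k\ell}-[3]_qx_{ij}^2x_{k\ell}x_{ij}+[3]_qx_{ij}x_{k\ell}x_{ij}^2-x_{k\ell}x_{ij}^3=0$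 if $j-i=k-j=\ell-k=1$. Known fact: on a finite-dimensional irreducible $\boxtimes_q$-module $V$ there are $d\in\mathbb N$ (the diameter) and $\varepsilon\in\{1,-1\}$ (the type) such that each standard generator is diagonalizable with set of distinct eigenvalues $\{\varepsilon q^{d-2n}\mid 0\le n\le d\}$. Let $V$ have type 1. For distinct $i,j\in\mathbb Z_4$ the decomposition $[i,j]$ of $V$ is the sequence of subspaces $\{V_n\}_{n=0}^d$ (with $V=\bigoplus_n V_n$) such that: if $j-i\in\{1,2\}$, $V_n$ is the eigenspace of $x_{ij}$ with eigenvalue $q^{d-2n}$; if $j-i=3$, $[i,j]$ is the inversion (reversed sequence) of $[j,i]$. The shape $(\dim V_n)_{n=0}^d$ does not depend on $i,j$. For $i\in\mathbb Z_4$ the flag $[i]$ on $V$ has $n$th component $V_0+\cdots+V_n$, where $\{V_n\}$ is the decomposition $[i,j]$; this is known not to depend on $j\ne i$. The trivial $\boxtimes_q$-module is the one-dimensional module on which every standard generator acts as the identity. An evaluation module for $\boxtimes_q$ is a nontrivial finite-dimensional irreducible $\boxtimes_q$-module of type 1 and shape $(1,1,\dots,1)$ (so $d\ge1$, $\dim V=d+1$). For mutually distinct $i,j,k,\ell\in\mathbb Z_4$, a basis $\{v_n\}_{n=0}^d$ of an evaluation module $V$ is an $[i,j,k,\ell]$-basis when (i) for $0\le n\le d$, $v_n$ is in component $n$ of the decomposition $[k,\ell]$; (ii) $\sum_{n=0}^dv_n$ is in component $0$ of the flag $[j]$. Such a basis exists and is unique up to multiplying all its vectors by a common nonzero scalar.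 Matrices in ${\rm Mat}_{d+1}(\mathbb F)$ have rows and columns indexed by $0,\dots,d$; $M$ represents $A$ with respect to a basis $\{v_n\}_{n=0}^d$ when $Av_n=\sum_i M_{in}v_i$. Entries not mentioned below are $0$. A subscript $q^{-1}$ means that $q$ is replaced by $q^{-1}$ in the definition (and similarly $t^{-1}$ as argument). - $Z$: $(i,j)$-entry $\delta_{i+j,d}$. - $K_q$: diagonal, $(i,i)$-entry $q^{d-2i}$. - $E_q$: $(i,i)$-entry $q^{2i-d}$; $(i-1,i)$-entry $q^d-q^{2i-2-d}$. - $F_q(t)$: $(i,i)$-entry $q^{2i-d}$; $(i-1,i)$-entry $(q^d-q^{2i-2-d})q^{1-d}t$. - $G_q(t)$: $(i,i)$-entry $q^{2i-d}$; $(i-1,i)$-entry $(q^d-q^{2i-2-d})(1-tq^{d-2i+1})$. - $L_q(t)$: $(i,i)$-entry $q^{2i-d}$; $(i-1,i)$-entry $(q^d-q^{2i-2-d})(1-tq^{d-2i+1})^{-1}$. - $S_q(t)$: $(i-1,i)$-entry $(q^d-q^{2i-d-2})(1-tq^{2i-d-1})$; $(i,i-1)$-entry $(q^{2i-d}-q^{-d})q^{2i-d-1}t$; $(i,i)$-entry $q^d-(q^{2i-d}-q^{-d})q^{2i-d-1}t-(q^d-q^{2i-d})(1-tq^{2i-d+1})$. - $M_q(t)$, $(i,j)$-entry: $0$ if $i-j>1$; $\frac{q^{-1}-q^{2i-1}}{t^{-1}-q^{2i-d-1}}$ if $i-j=1$; if $j\ge i$, $i\ne0$, $j\ne d$: $\frac{1-tq^{d+1}}{1-tq^{2j-d+1}}\,\frac{1-tq^{-d-1}}{1-tq^{2i-d-1}}\,\frac{(q^{2i-2d};q^2)_{j-i}}{(tq^{2i-d+1};q^2)_{j-i}}\,\frac1{q^{d-2j}}$;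 if $i=0$, $j\ne d$: $\frac{1-tq^{d+1}}{1-tq^{2j-d+1}}\,\frac{(q^{-2d};q^2)_j}{(tq^{1-d};q^2)_j}\,\frac1{q^{d-2j}}$; if $i\ne0$, $j=d$: $\frac{1-tq^{-d-1}}{1-tq^{2i-d-1}}\,\frac{(q^{2i-2d};q^2)_{d-i}}{(tq^{2i-d+1};q^2)_{d-i}}\,q^d$ (when $i-j\neq 1$, i.e. $j\ge i$); if $i=0$, $j=d$: $\frac{(q^{-2d};q^2)_d}{(tq^{1-d};q^2)_d}\,q^d$. For an integer $d\ge1$ and a nonzero $t\in\mathbb F$ not among $\{q^{d-2n+1}\}_{n=1}^d$, $\mathbf V_d(t)$ is the evaluation module for $\boxtimes_q$ having a basis with respect to which the standard generators are represented by: $x_{01}: ZS_{q^{-1}}(t^{-1})Z$, $x_{12}: E_q$, $x_{23}: K_q$, $x_{30}: ZG_{q^{-1}}(t)Z$, $x_{02}: L_q(t)$, $x_{13}: (ZE_{q^{-1}}Z)^{-1}$, $x_{20}: (L_q(t))^{-1}$, $x_{31}: ZE_{q^{-1}}Z$. Every evaluation module $V$ of diameter $d$ is isomorphic to $\mathbf V_d(t)$ for a unique such $t$, called the evaluation parameter of $V$. "$r\in\mathbb Z_4$ even" means $r\in\{0,2\}$. *)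

theory Defs
  imports
    "HOL-Library.Numeral_Type"
    "HOL-Computational_Algebra.Polynomial"
    "Jordan_Normal_Form.Gauss_Jordan_Elimination"
begin

section \<open>Modules for the q-tetrahedron algebra\<close>

text \<open>
  The group of integers modulo 4 is the numeral type 4. A vector space is a type with a
  scalar multiplication \<^term>\<open>scale\<close> satisfying \<^const>\<open>vector_space\<close>. The q-tetrahedron algebra is
  given by a presentation, so a module for it is a vector space together with an operator
  \<^term>\<open>x i j\<close> for each standard generator (that is, for \<open>j - i \<in> {1, 2}\<close>) such that these
  operators satisfy the defining relations. The values \<^term>\<open>x i j\<close> for other pairs
  \<open>(i, j)\<close> carry no meaning and are never referred to.
\<close>

definition qint :: "'a::field \<Rightarrow> nat \<Rightarrow> 'a" where
  "qint q n = (q ^ n - inverse q ^ n) / (q - inverse q)"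

definition std_gen :: "4 \<Rightarrow> 4 \<Rightarrow> bool" where
  "std_gen i j \<longleftrightarrow> j - i = 1 \<or> j - i = 2"

definition boxq_module ::
  "'a::field \<Rightarrow> ('a \<Rightarrow> 'v::ab_group_add \<Rightarrow> 'v) \<Rightarrow> (4 \<Rightarrow> 4 \<Rightarrow> 'v \<Rightarrow> 'v) \<Rightarrow> bool" where
  "boxq_module q scale x \<longleftrightarrow>
     vector_space scale \<and>
     (\<forall>i j. std_gen i j \<longrightarrow> Vector_Spaces.linear scale scale (x i j)) \<and>
     (\<forall>i j v. j - i = 2 \<longrightarrow> x i j (x j i v) = v) \<and>
     (\<forall>i j k v. (j - i, k - j) \<in> {(1, 1), (1, 2), (2, 1)} \<longrightarrow>
        scale (1 / (q - inverse q))
          (scale q (x i j (x j k v)) - scale (inverse q) (x j k (x i j v))) = v) \<and>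
     (\<forall>i j k l v. j - i = 1 \<and> k - j = 1 \<and> l - k = 1 \<longrightarrow>
        x i j (x i j (x i j (x k l v)))
        - scale (qint q 3) (x i j (x i j (x k l (x i j v))))
        + scale (qint q 3) (x i j (x k l (x i j (x i j v))))
        - x k l (x i j (x i j (x i j v))) = 0)"

definition finite_dimensional :: "('a::field \<Rightarrow> 'v::ab_group_add \<Rightarrow> 'v) \<Rightarrow> bool" where
  "finite_dimensional scale \<longleftrightarrow> (\<exists>B. finite B \<and> Modules.module.span scale B = UNIV)"

definition irreducible_module ::
  "('a::field \<Rightarrow> 'v::ab_group_add \<Rightarrow> 'v) \<Rightarrow> (4 \<Rightarrow> 4 \<Rightarrow> 'v \<Rightarrow> 'v) \<Rightarrow> bool" where
  "irreducible_module scale x \<longleftrightarrow>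
     (UNIV :: 'v set) \<noteq> {0} \<and>
     (\<forall>W. Modules.module.subspace scale W \<and> (\<forall>i j. std_gen i j \<longrightarrow> x i j ` W \<subseteq> W)
        \<longrightarrow> W = {0} \<or> W = UNIV)"

definition trivial_module ::
  "('a::field \<Rightarrow> 'v::ab_group_add \<Rightarrow> 'v) \<Rightarrow> (4 \<Rightarrow> 4 \<Rightarrow> 'v \<Rightarrow> 'v) \<Rightarrow> bool" where
  "trivial_module scale x \<longleftrightarrow>
     vector_space.dim scale (UNIV :: 'v set) = 1 \<and> (\<forall>i j. std_gen i j \<longrightarrow> x i j = id)"

definition eigenspace ::
  "('a::field \<Rightarrow> 'v::ab_group_add \<Rightarrow> 'v) \<Rightarrow> ('v \<Rightarrow> 'v) \<Rightarrow> 'a \<Rightarrow> 'v set" where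
  "eigenspace scale A c = {v. A v = scale c v}"

definition eigenvalues ::
  "('a::field \<Rightarrow> 'v::ab_group_add \<Rightarrow> 'v) \<Rightarrow> ('v \<Rightarrow> 'v) \<Rightarrow> 'a set" where
  "eigenvalues scale A = {c. \<exists>v. v \<noteq> 0 \<and> A v = scale c v}"

definition diagonalizable ::
  "('a::field \<Rightarrow> 'v::ab_group_add \<Rightarrow> 'v) \<Rightarrow> ('v \<Rightarrow> 'v) \<Rightarrow> bool" where
  "diagonalizable scale A \<longleftrightarrow>
     (\<exists>B. \<not> Modules.module.dependent scale B \<and> Modules.module.span scale B = UNIV \<and>
          (\<forall>b\<in>B. \<exists>c. A b = scale c b))"

definition has_diameter_type ::
  "'a::field \<Rightarrow> ('a \<Rightarrow> 'v::ab_group_add \<Rightarrow> 'v) \<Rightarrow> (4 \<Rightarrow> 4 \<Rightarrow> 'v \<Rightarrow> 'v) \<Rightarrow> nat \<Rightarrow> 'a \<Rightarrow> bool" where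
  "has_diameter_type q scale x d \<epsilon> \<longleftrightarrow>
     \<epsilon> \<in> {1, - 1} \<and>
     (\<forall>i j. std_gen i j \<longrightarrow>
        diagonalizable scale (x i j) \<and>
        eigenvalues scale (x i j) = {\<epsilon> * q powi (int d - 2 * int n) | n. n \<le> d})"

text \<open>Component \<open>n\<close> of the decomposition \<open>[i, j]\<close>, for \<open>i \<noteq> j\<close> and \<open>n \<le> d\<close>.\<close>

definition decomposition ::
  "'a::field \<Rightarrow> ('a \<Rightarrow> 'v::ab_group_add \<Rightarrow> 'v) \<Rightarrow> (4 \<Rightarrow> 4 \<Rightarrow> 'v \<Rightarrow> 'v) \<Rightarrow> nat
    \<Rightarrow> 4 \<Rightarrow> 4 \<Rightarrow> nat \<Rightarrow> 'v set" where
  "decomposition q scale x d i j n =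
     (if std_gen i j
      then eigenspace scale (x i j) (q powi (int d - 2 * int n))
      else eigenspace scale (x j i) (q powi (int d - 2 * int (d - n))))"

text \<open>
  The flag \<open>[i]\<close> does not depend on which decomposition \<open>[i, j]\<close> is used to build it; we take
  \<open>j = i + 1\<close>.
\<close>

definition flag ::
  "'a::field \<Rightarrow> ('a \<Rightarrow> 'v::ab_group_add \<Rightarrow> 'v) \<Rightarrow> (4 \<Rightarrow> 4 \<Rightarrow> 'v \<Rightarrow> 'v) \<Rightarrow> nat
    \<Rightarrow> 4 \<Rightarrow> nat \<Rightarrow> 'v set" where
  "flag q scale x d i n =
     Modules.module.span scale (\<Union>m\<le>n. decomposition q scale x d i (i + 1) m)"

definition has_shape ::
  "'a::field \<Rightarrow> ('a \<Rightarrow> 'v::ab_group_add \<Rightarrow> 'v) \<Rightarrow> (4 \<Rightarrow> 4 \<Rightarrow> 'v \<Rightarrow> 'v) \<Rightarrow> nat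
    \<Rightarrow> (nat \<Rightarrow> nat) \<Rightarrow> bool" where
  "has_shape q scale x d s \<longleftrightarrow>
     (\<forall>i j. i \<noteq> j \<longrightarrow> (\<forall>n\<le>d. vector_space.dim scale (decomposition q scale x d i j n) = s n))"

definition evaluation_module ::
  "'a::field \<Rightarrow> ('a \<Rightarrow> 'v::ab_group_add \<Rightarrow> 'v) \<Rightarrow> (4 \<Rightarrow> 4 \<Rightarrow> 'v \<Rightarrow> 'v) \<Rightarrow> nat \<Rightarrow> bool" where
  "evaluation_module q scale x d \<longleftrightarrow>
     boxq_module q scale x \<and>
     finite_dimensional scale \<and>
     irreducible_module scale x \<and>
     \<not> trivial_module scale x \<and>
     has_diameter_type q scale x d 1 \<and>
     has_shape q scale x d (\<lambda>_. 1)"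

section \<open>Bases and representing matrices\<close>

definition indexed_basis ::
  "('a::field \<Rightarrow> 'v::ab_group_add \<Rightarrow> 'v) \<Rightarrow> nat \<Rightarrow> (nat \<Rightarrow> 'v) \<Rightarrow> bool" where
  "indexed_basis scale d v \<longleftrightarrow>
     inj_on v {..d} \<and> \<not> Modules.module.dependent scale (v ` {..d}) \<and>
     Modules.module.span scale (v ` {..d}) = UNIV"

definition ijkl_basis ::
  "'a::field \<Rightarrow> ('a \<Rightarrow> 'v::ab_group_add \<Rightarrow> 'v) \<Rightarrow> (4 \<Rightarrow> 4 \<Rightarrow> 'v \<Rightarrow> 'v) \<Rightarrow> nat
    \<Rightarrow> 4 \<times> 4 \<times> 4 \<times> 4 \<Rightarrow> (nat \<Rightarrow> 'v) \<Rightarrow> bool" where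
  "ijkl_basis q scale x d = (\<lambda>(i, j, k, l) v.
     distinct [i, j, k, l] \<and>
     indexed_basis scale d v \<and>
     (\<forall>n\<le>d. v n \<in> decomposition q scale x d k l n) \<and>
     (\<Sum>n\<le>d. v n) \<in> flag q scale x d j 0)"

definition represents ::
  "('a::field \<Rightarrow> 'v::ab_group_add \<Rightarrow> 'v) \<Rightarrow> nat \<Rightarrow> (nat \<Rightarrow> 'v) \<Rightarrow> ('v \<Rightarrow> 'v) \<Rightarrow> 'a mat \<Rightarrow> bool" where
  "represents scale d v A M \<longleftrightarrow>
     M \<in> carrier_mat (d + 1) (d + 1) \<and>
     (\<forall>n\<le>d. A (v n) = (\<Sum>i\<le>d. scale (M $$ (i, n)) (v i)))"

text \<open>
  One row of a table: with respect to every \<open>[i, j, k, l]\<close>-basis, the listed generators are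
  represented by the respective matrices in the second list.
\<close>

definition table_row ::
  "'a::field \<Rightarrow> ('a \<Rightarrow> 'v::ab_group_add \<Rightarrow> 'v) \<Rightarrow> (4 \<Rightarrow> 4 \<Rightarrow> 'v \<Rightarrow> 'v) \<Rightarrow> nat
    \<Rightarrow> (4 \<times> 4) list \<Rightarrow> 4 \<times> 4 \<times> 4 \<times> 4 \<Rightarrow> 'a mat list \<Rightarrow> bool" where
  "table_row q scale x d gens b Ms \<longleftrightarrow>
     (\<forall>v. ijkl_basis q scale x d b v \<longrightarrow>
        list_all2 (\<lambda>(i, j) M. represents scale d v (x i j) M) gens Ms)"

section \<open>The matrices\<close>

text \<open>
  All matrices below are square of size \<open>d + 1\<close> with indices \<open>0, \<dots>, d\<close>. An entry in
  position \<open>(i - 1, i)\<close> is written in terms of the column index, an entry in position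
  \<open>(i, i - 1)\<close> in terms of the row index.
\<close>

definition qpoch :: "'a::field \<Rightarrow> 'a \<Rightarrow> nat \<Rightarrow> 'a" where
  "qpoch a q n = (\<Prod>k<n. 1 - a * q ^ k)"

definition matinv :: "'a::field mat \<Rightarrow> 'a mat" where
  "matinv A = the (mat_inverse A)"

definition Zmat :: "nat \<Rightarrow> 'a::field mat" where
  "Zmat d = mat (d + 1) (d + 1) (\<lambda>(i, j). if i + j = d then 1 else 0)"

definition Kmat :: "nat \<Rightarrow> 'a::field \<Rightarrow> 'a mat" where
  "Kmat d q = mat (d + 1) (d + 1)
     (\<lambda>(i, j). if i = j then q powi (int d - 2 * int i) else 0)"

definition Emat :: "nat \<Rightarrow> 'a::field \<Rightarrow> 'a mat" where
  "Emat d q = mat (d + 1) (d + 1) (\<lambda>(r, i).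
     if r = i then q powi (2 * int i - int d)
     else if r + 1 = i then q powi int d - q powi (2 * int i - 2 - int d)
     else 0)"

definition Fmat :: "nat \<Rightarrow> 'a::field \<Rightarrow> 'a \<Rightarrow> 'a mat" where
  "Fmat d q t = mat (d + 1) (d + 1) (\<lambda>(r, i).
     if r = i then q powi (2 * int i - int d)
     else if r + 1 = i
       then (q powi int d - q powi (2 * int i - 2 - int d)) * q powi (1 - int d) * t
     else 0)"

definition Gmat :: "nat \<Rightarrow> 'a::field \<Rightarrow> 'a \<Rightarrow> 'a mat" where
  "Gmat d q t = mat (d + 1) (d + 1) (\<lambda>(r, i).
     if r = i then q powi (2 * int i - int d)
     else if r + 1 = i
       then (q powi int d - q powi (2 * int i - 2 - int d))
            * (1 - t * q powi (int d - 2 * int i + 1))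
     else 0)"

definition Lmat :: "nat \<Rightarrow> 'a::field \<Rightarrow> 'a \<Rightarrow> 'a mat" where
  "Lmat d q t = mat (d + 1) (d + 1) (\<lambda>(r, i).
     if r = i then q powi (2 * int i - int d)
     else if r + 1 = i
       then (q powi int d - q powi (2 * int i - 2 - int d))
            * inverse (1 - t * q powi (int d - 2 * int i + 1))
     else 0)"

definition Smat :: "nat \<Rightarrow> 'a::field \<Rightarrow> 'a \<Rightarrow> 'a mat" where
  "Smat d q t = mat (d + 1) (d + 1) (\<lambda>(r, c).
     if r + 1 = c
       then (q powi int d - q powi (2 * int c - int d - 2))
            * (1 - t * q powi (2 * int c - int d - 1))
     else if r = c + 1
       then (q powi (2 * int r - int d) - q powi (- int d)) * q powi (2 * int r - int d - 1) * t
     else if r = c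
       then q powi int d
            - (q powi (2 * int r - int d) - q powi (- int d)) * q powi (2 * int r - int d - 1) * t
            - (q powi int d - q powi (2 * int r - int d))
              * (1 - t * q powi (2 * int r - int d + 1))
     else 0)"

definition Mmat :: "nat \<Rightarrow> 'a::field \<Rightarrow> 'a \<Rightarrow> 'a mat" where
  "Mmat d q t = mat (d + 1) (d + 1) (\<lambda>(i, j).
     if i > j + 1 then 0
     else if i = j + 1
       then (inverse q - q powi (2 * int i - 1)) / (inverse t - q powi (2 * int i - int d - 1))
     else if i \<noteq> 0 \<and> j \<noteq> d
       then (1 - t * q powi (int d + 1)) / (1 - t * q powi (2 * int j - int d + 1))
            * ((1 - t * q powi (- int d - 1)) / (1 - t * q powi (2 * int i - int d - 1)))
            * (qpoch (q powi (2 * int i - 2 * int d)) (q ^ 2) (j - i)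
               / qpoch (t * q powi (2 * int i - int d + 1)) (q ^ 2) (j - i))
            * (1 / q powi (int d - 2 * int j))
     else if i = 0 \<and> j \<noteq> d
       then (1 - t * q powi (int d + 1)) / (1 - t * q powi (2 * int j - int d + 1))
            * (qpoch (q powi (- 2 * int d)) (q ^ 2) j
               / qpoch (t * q powi (1 - int d)) (q ^ 2) j)
            * (1 / q powi (int d - 2 * int j))
     else if i \<noteq> 0 \<and> j = d
       then (1 - t * q powi (- int d - 1)) / (1 - t * q powi (2 * int i - int d - 1))
            * (qpoch (q powi (2 * int i - 2 * int d)) (q ^ 2) (d - i)
               / qpoch (t * q powi (2 * int i - int d + 1)) (q ^ 2) (d - i))
            * q powi int d
     else qpoch (q powi (- 2 * int d)) (q ^ 2) d
          / qpoch (t * q powi (1 - int d)) (q ^ 2) d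
          * q powi int d)"

section \<open>The evaluation parameter\<close>

text \<open>
  The module \<open>V\<^sub>d(t)\<close> is realized on column vectors of length \<open>d + 1\<close>; the list gives the
  matrices by which the standard generators act.
\<close>

definition Vdt_action :: "'a::field \<Rightarrow> nat \<Rightarrow> 'a \<Rightarrow> ((4 \<times> 4) \<times> 'a mat) list" where
  "Vdt_action q d t =
     [((0, 1), Zmat d * Smat d (inverse q) (inverse t) * Zmat d),
      ((1, 2), Emat d q),
      ((2, 3), Kmat d q),
      ((3, 0), Zmat d * Gmat d (inverse q) t * Zmat d),
      ((0, 2), Lmat d q t),
      ((1, 3), matinv (Zmat d * Emat d (inverse q) * Zmat d)),
      ((2, 0), matinv (Lmat d q t)),
      ((3, 1), Zmat d * Emat d (inverse q) * Zmat d)]"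

definition isomorphic_to_Vdt ::
  "'a::field \<Rightarrow> ('a \<Rightarrow> 'v::ab_group_add \<Rightarrow> 'v) \<Rightarrow> (4 \<Rightarrow> 4 \<Rightarrow> 'v \<Rightarrow> 'v) \<Rightarrow> nat \<Rightarrow> 'a \<Rightarrow> bool" where
  "isomorphic_to_Vdt q scale x d t \<longleftrightarrow>
     (\<exists>\<phi> :: 'v \<Rightarrow> 'a vec.
        bij_betw \<phi> UNIV (carrier_vec (d + 1)) \<and>
        (\<forall>u v. \<phi> (u + v) = \<phi> u + \<phi> v) \<and>
        (\<forall>c v. \<phi> (scale c v) = c \<cdot>\<^sub>v \<phi> v) \<and>
        (\<forall>((i, j), M) \<in> set (Vdt_action q d t). \<forall>v. \<phi> (x i j v) = M *\<^sub>v \<phi> v))"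

definition evaluation_parameter ::
  "'a::field \<Rightarrow> ('a \<Rightarrow> 'v::ab_group_add \<Rightarrow> 'v) \<Rightarrow> (4 \<Rightarrow> 4 \<Rightarrow> 'v \<Rightarrow> 'v) \<Rightarrow> nat \<Rightarrow> 'a \<Rightarrow> bool" where
  "evaluation_parameter q scale x d t \<longleftrightarrow>
     t \<noteq> 0 \<and> t \<notin> {q powi (int d - 2 * int n + 1) | n. 1 \<le> n \<and> n \<le> d} \<and>
     isomorphic_to_Vdt q scale x d t"

end

theory Submission
  imports Defs "Jordan_Normal_Form.Determinant"
begin

text \<open>
  The proof replaces the module by linear relations among its generators. Besides the defining
  relations, the generators of an evaluation module with parameter \<open>t\<close> satisfy the evaluation
  relations
  \<open>x\<^bsub>r+3,r\<^esub> - x\<^bsub>r+3,r+1\<^esub> = \<tau> q (1 - x\<^bsub>r+2,r+3\<^esub> x\<^bsub>r+3,r+1\<^esub>)\<close>,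
  where \<open>\<tau>\<close> is \<open>t\<close> for even \<open>r\<close> and \<open>t\<^sup>-\<^sup>1\<close> for odd \<open>r\<close>. The locale \<open>boxq_evaluation\<close> takes
  these as axioms, and \<open>evaluation_parameter_imp_boxq_evaluation\<close> derives them from the matrices that
  define \<open>V\<^sub>d(t)\<close>. From then on the argument depends on the relations alone.
  
  The relations have an obvious symmetry. Rotating the indices replaces \<open>t\<close> by \<open>t\<^sup>-\<^sup>1\<close>
  (\<open>boxq_evaluation_rotate\<close>), and replacing \<open>x\<^sub>i\<^sub>j\<close> by \<open>x\<^bsub>1-j,1-i\<^esub>\<close> replaces \<open>q\<close> by \<open>q\<^sup>-\<^sup>1\<close>
  (\<open>boxq_evaluation_reflect\<close>). Reversing an \<open>[i,j,k,l]\<close>-basis gives an \<open>[i,j,l,k]\<close>-basis and conjugates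
  all matrices by \<open>Z\<close>. Up to these operations there are two kinds of bases, \<open>[0,1,2,3]\<close> and
  \<open>[0,2,1,3]\<close>, and all rows follow from those two.
  
  In an \<open>[i,j,k,l]\<close>-basis, \<open>x\<^sub>k\<^sub>l\<close> or its reverse is diagonal. If two generators satisfy the q-Weyl
  relation and one of them is diagonal, then the other is bidiagonal with the inverse diagonal
  (\<open>weyl_bidiagonal_right\<close>, \<open>weyl_bidiagonal_left\<close>). For the generators that start or end at \<open>j\<close>, the
  sum of the basis is an eigenvector, because it lies in the flag \<open>[j]\<close>; this fixes the row sums, and
  so the whole bidiagonal matrix (\<open>bidiagonal_by_row_sums\<close>). The remaining generators are read off
  from the evaluation relations. Only one of them takes real work: the matrix \<open>M\<close> of \<open>x\<^sub>2\<^sub>0\<close> in a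
  \<open>[0,2,1,3]\<close>-basis is not banded. There the evaluation relation becomes a recursion from each row to
  the one above it, which the entries of \<open>M\<close> solve (\<open>Mmat_row_recursion\<close>, \<open>represents_0213_x20\<close>).
\<close>

section \<open>Conjugation by the exchange matrix\<close>

lemma represents_carrier: "represents scale d v A M \<Longrightarrow> M \<in> carrier_mat (d + 1) (d + 1)"
  by (simp add: represents_def)

lemma matrix_carriers [simp]:
  "Zmat d \<in> carrier_mat (d + 1) (d + 1)" "Kmat d q \<in> carrier_mat (d + 1) (d + 1)"
  "Emat d q \<in> carrier_mat (d + 1) (d + 1)" "Fmat d q t \<in> carrier_mat (d + 1) (d + 1)"
  "Gmat d q t \<in> carrier_mat (d + 1) (d + 1)" "Lmat d q t \<in> carrier_mat (d + 1) (d + 1)"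
  "Smat d q t \<in> carrier_mat (d + 1) (d + 1)" "Mmat d q t \<in> carrier_mat (d + 1) (d + 1)"
  by (simp_all add: Zmat_def Kmat_def Emat_def Fmat_def Gmat_def Lmat_def Smat_def Mmat_def)

lemma Zmat_conj:
  assumes "M \<in> carrier_mat (d + 1) (d + 1)"
  shows "Zmat d * M * Zmat d = mat (d + 1) (d + 1) (\<lambda>(i, j). M $$ (d - i, d - j))"
proof (rule eq_matI)
  fix i j
  assume "i < dim_row (mat (d + 1) (d + 1) (\<lambda>(i, j). M $$ (d - i, d - j)))"
    and "j < dim_col (mat (d + 1) (d + 1) (\<lambda>(i, j). M $$ (d - i, d - j)))"
  then have ij: "i < d + 1" "j < d + 1" by auto
  have left: "(Zmat d * M) $$ (i, k) = M $$ (d - i, k)" if "k < d + 1" for k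
  proof -
    have "(Zmat d * M) $$ (i, k) = (\<Sum>l = 0..<d + 1. (if l = d - i then M $$ (l, k) else 0))"
    proof -
      have "(Zmat d * M) $$ (i, k) = (\<Sum>l = 0..<d + 1. Zmat d $$ (i, l) * M $$ (l, k))"
        using assms ij that by (simp add: scalar_prod_def Zmat_def)
      also have "\<dots> = (\<Sum>l = 0..<d + 1. (if l = d - i then M $$ (l, k) else 0))"
        by (rule sum.cong[OF refl]) (use ij in \<open>auto simp: Zmat_def\<close>)
      finally show ?thesis .
    qed
    also have "\<dots> = M $$ (d - i, k)" by (subst sum.delta) auto
    finally show ?thesis .
  qed
  have "(Zmat d * M * Zmat d) $$ (i, j)
      = (\<Sum>k = 0..<d + 1. (Zmat d * M) $$ (i, k) * Zmat d $$ (k, j))"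
    using assms ij by (simp add: scalar_prod_def Zmat_def)
  also have "\<dots> = (\<Sum>k = 0..<d + 1. (if k = d - j then M $$ (d - i, k) else 0))"
    by (rule sum.cong[OF refl], subst left) (use ij in \<open>auto simp: Zmat_def\<close>)
  also have "\<dots> = M $$ (d - i, d - j)" by (subst sum.delta) auto
  finally show "(Zmat d * M * Zmat d) $$ (i, j)
      = mat (d + 1) (d + 1) (\<lambda>(i, j). M $$ (d - i, d - j)) $$ (i, j)"
    using ij by simp
qed (use assms in \<open>auto simp: Zmat_def\<close>)

lemma Zmat_conj_conj:
  assumes "M \<in> carrier_mat (d + 1) (d + 1)"
  shows "Zmat d * (Zmat d * M * Zmat d) * Zmat d = M"
proof -
  have "Zmat d * M * Zmat d \<in> carrier_mat (d + 1) (d + 1)"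
    by (simp add: Zmat_conj[OF assms])
  then have "Zmat d * (Zmat d * M * Zmat d) * Zmat d
      = mat (d + 1) (d + 1) (\<lambda>(i, j). (Zmat d * M * Zmat d) $$ (d - i, d - j))"
    by (rule Zmat_conj)
  also have "\<dots> = M" using assms by (auto simp: Zmat_conj)
  finally show ?thesis .
qed

lemma Zmat_conj_carrier:
  "M \<in> carrier_mat (d + 1) (d + 1) \<Longrightarrow> Zmat d * M * Zmat d \<in> carrier_mat (d + 1) (d + 1)"
  by (simp add: Zmat_conj)

lemma Zmat_conj_entry:
  "M \<in> carrier_mat (d + 1) (d + 1) \<Longrightarrow> i \<le> d \<Longrightarrow> j \<le> d
    \<Longrightarrow> (Zmat d * M * Zmat d) $$ (i, j) = M $$ (d - i, d - j)"
  by (simp add: Zmat_conj)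

lemma powi_inverse: "inverse q powi m = (q :: 'a::field) powi (- m)" "inverse q ^ n = q powi (- int n)"
  by (simp_all add: power_int_inverse power_int_minus power_inverse)

lemma Zmat_conj_Kmat:
  "Zmat d * Kmat d q * Zmat d = Kmat d (inverse q)" for q :: "'a::field"
  unfolding Zmat_conj[OF matrix_carriers(2)]
  by (rule eq_matI) (auto simp: Kmat_def powi_inverse of_nat_diff algebra_simps)

section \<open>Coordinates with respect to an indexed basis\<close>

text \<open>
  Extending a family \<open>v\<^sub>0, \<dots>, v\<^sub>d\<close> by zero to all integer indices lets bidiagonal and tridiagonal
  actions be written by one formula without boundary cases.
\<close>

definition extend_zero :: "nat \<Rightarrow> (nat \<Rightarrow> 'v::zero) \<Rightarrow> int \<Rightarrow> 'v" where
  "extend_zero d v n = (if 0 \<le> n \<and> n \<le> int d then v (nat n) else 0)"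

lemma extend_zero_of_nat: "n \<le> d \<Longrightarrow> extend_zero d v (int n) = v n"
  by (simp add: extend_zero_def)

lemma extend_zero_outside: "n < 0 \<or> n > int d \<Longrightarrow> extend_zero d v n = 0"
  by (auto simp: extend_zero_def)

context vector_space
begin

lemma indexed_basisI:
  assumes zero: "\<And>c i. (\<Sum>i\<le>d. c i *s v i) = 0 \<Longrightarrow> i \<le> d \<Longrightarrow> c i = 0"
    and ex: "\<And>u. \<exists>c. u = (\<Sum>i\<le>d. c i *s v i)"
  shows "indexed_basis scale d v"
proof -
  have inj: "inj_on v {..d}"
  proof (rule inj_onI)
    fix i j assume ij: "i \<in> {..d}" "j \<in> {..d}" "v i = v j"
    show "i = j"
    proof (rule ccontr)
      assume "i \<noteq> j"
      have "(\<Sum>k\<le>d. ((if k = i then 1 else 0) - (if k = j then 1 else 0)) *s v k)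
          = (\<Sum>k\<le>d. if k = i then v k else 0) - (\<Sum>k\<le>d. if k = j then v k else 0)"
        unfolding sum_subtractf[symmetric] by (rule sum.cong) auto
      also have "\<dots> = 0" using ij by simp
      finally show False using zero[of "\<lambda>k. (if k = i then 1 else 0) - (if k = j then 1 else 0)" i] ij \<open>i \<noteq> j\<close>
        by simp
    qed
  qed
  moreover have "independent (v ` {..d})"
  proof (rule independent_if_scalars_zero)
    fix f u assume "(\<Sum>u\<in>v ` {..d}. f u *s u) = 0" "u \<in> v ` {..d}"
    then show "f u = 0" using zero[of "\<lambda>i. f (v i)"] by (auto simp: sum.reindex[OF inj])
  qed simp
  moreover have "u \<in> span (v ` {..d})" for u
  proof -
    obtain c where u: "u = (\<Sum>i\<le>d. c i *s v i)" using ex by blast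
    show ?thesis unfolding u by (intro span_sum span_scale span_base imageI)
  qed
  ultimately show ?thesis by (auto simp: indexed_basis_def)
qed

lemma indexed_basis_coords:
  assumes "indexed_basis scale d v"
  obtains c where "u = (\<Sum>i\<le>d. c i *s v i)"
proof -
  have inj: "inj_on v {..d}" and sp: "u \<in> span (v ` {..d})"
    using assms by (auto simp: indexed_basis_def)
  obtain c where "u = (\<Sum>w\<in>v ` {..d}. c w *s w)"
    using sp by (subst (asm) span_finite) auto
  then have "u = (\<Sum>i\<le>d. c (v i) *s v i)"
    by (simp add: sum.reindex[OF inj])
  then show ?thesis by (rule that)
qed

lemma indexed_basis_zero:
  assumes "indexed_basis scale d v" and "(\<Sum>i\<le>d. c i *s v i) = 0" and "i \<le> d"
  shows "c i = 0"
proof -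
  have inj: "inj_on v {..d}" and ind: "independent (v ` {..d})"
    using assms by (auto simp: indexed_basis_def)
  have "(\<Sum>w\<in>v ` {..d}. c (inv_into {..d} v w) *s w) = (\<Sum>i\<le>d. c i *s v i)"
    unfolding sum.reindex[OF inj] using inj by (auto intro!: sum.cong)
  then have "(\<Sum>w\<in>v ` {..d}. c (inv_into {..d} v w) *s w) = 0" using assms(2) by simp
  from independentD[OF ind _ _ this, of "v i"]
  have "c (inv_into {..d} v (v i)) = 0" using assms(3) by simp
  then show ?thesis using inj assms(3) by simp
qed

lemma indexed_basis_unique:
  assumes "indexed_basis scale d v" and "(\<Sum>i\<le>d. a i *s v i) = (\<Sum>i\<le>d. b i *s v i)" and "i \<le> d"
  shows "a i = b i"
proof -
  have "(\<Sum>i\<le>d. (a i - b i) *s v i) = 0"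
    using assms(2) by (simp add: scale_left_diff_distrib sum_subtractf)
  from indexed_basis_zero[OF assms(1) this assms(3)] show ?thesis by simp
qed

lemma indexed_basis_nonzero: "indexed_basis scale d v \<Longrightarrow> n \<le> d \<Longrightarrow> v n \<noteq> 0"
  unfolding indexed_basis_def by (metis atMost_iff dependent_zero imageI)

lemma indexed_basis_scaled:
  assumes b: "indexed_basis scale d v" and a: "\<And>n. n \<le> d \<Longrightarrow> a n \<noteq> 0"
  shows "indexed_basis scale d (\<lambda>n. a n *s v n)"
proof (rule indexed_basisI)
  fix c i assume "(\<Sum>i\<le>d. c i *s a i *s v i) = 0" "i \<le> d"
  then show "c i = 0" using indexed_basis_zero[OF b, of "\<lambda>i. c i * a i" i] a by simp
next
  fix u
  obtain c where "u = (\<Sum>i\<le>d. c i *s v i)" using indexed_basis_coords[OF b] .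
  also have "\<dots> = (\<Sum>i\<le>d. (c i / a i) *s a i *s v i)" by (rule sum.cong) (use a in auto)
  finally show "\<exists>c. u = (\<Sum>i\<le>d. c i *s a i *s v i)"
    by (rule exI[of _ "\<lambda>i. c i / a i"])
qed

lemma sum_reverse: "(\<Sum>i\<le>d. f (d - i)) = (\<Sum>i\<le>(d::nat). f i)"
  by (rule sum.reindex_bij_witness[of _ "\<lambda>i. d - i" "\<lambda>i. d - i"]) auto

lemma indexed_basis_reverse:
  assumes "indexed_basis scale d v"
  shows "indexed_basis scale d (\<lambda>n. v (d - n))"
proof -
  have "(\<lambda>n. v (d - n)) ` {..d} = v ` {..d}"
  proof
    show "v ` {..d} \<subseteq> (\<lambda>n. v (d - n)) ` {..d}"
    proof
      fix u assume "u \<in> v ` {..d}"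
      then obtain n where "n \<le> d" "u = v n" by auto
      then show "u \<in> (\<lambda>n. v (d - n)) ` {..d}" by (intro image_eqI[of _ _ "d - n"]) auto
    qed
  qed auto
  moreover have "inj_on (\<lambda>n. v (d - n)) {..d}"
  proof (rule inj_onI)
    fix m n assume mn: "m \<in> {..d}" "n \<in> {..d}" "v (d - m) = v (d - n)"
    then have "d - m = d - n" using assms by (auto simp: indexed_basis_def dest: inj_onD)
    then show "m = n" using mn by auto
  qed
  ultimately show ?thesis using assms by (simp add: indexed_basis_def)
qed

lemma linear_indexed_sum:
  assumes "Vector_Spaces.linear scale scale A"
  shows "A (\<Sum>i\<in>I. c i *s v i) = (\<Sum>i\<in>I. c i *s A (v i))"
proof -
  interpret A: Vector_Spaces.linear scale scale A by fact
  show ?thesis by (simp add: A.sum A.scale)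
qed

lemma linear_eq_on_indexed_basis:
  assumes "indexed_basis scale d v"
    and "Vector_Spaces.linear scale scale A" "Vector_Spaces.linear scale scale B"
    and "\<And>n. n \<le> d \<Longrightarrow> A (v n) = B (v n)"
  shows "A u = B u"
proof -
  obtain c where u: "u = (\<Sum>i\<le>d. c i *s v i)" using indexed_basis_coords[OF assms(1)] .
  show ?thesis unfolding u linear_indexed_sum[OF assms(2)] linear_indexed_sum[OF assms(3)]
    using assms(4) by (auto intro!: sum.cong)
qed

text \<open>
  If \<open>A\<close> is diagonal in the basis, an eigenvector of \<open>A\<close> involves only basis vectors with the same
  eigenvalue.
\<close>

lemma eigenvector_coords:
  assumes b: "indexed_basis scale d v" and A: "Vector_Spaces.linear scale scale A"
    and ev: "\<And>n. n \<le> d \<Longrightarrow> A (v n) = \<theta> n *s v n"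
    and u: "A u = \<mu> *s u" "u = (\<Sum>i\<le>d. c i *s v i)" and n: "n \<le> d" "\<theta> n \<noteq> \<mu>"
  shows "c n = 0"
proof -
  have "(\<Sum>i\<le>d. (c i * \<theta> i) *s v i) = A u"
    unfolding u(2) linear_indexed_sum[OF A] by (rule sum.cong) (simp_all add: ev)
  also have "\<dots> = (\<Sum>i\<le>d. (\<mu> * c i) *s v i)" unfolding u(1)
    unfolding u(2) scale_sum_right by simp
  finally have "(\<Sum>i\<le>d. (c i * \<theta> i) *s v i) = (\<Sum>i\<le>d. (\<mu> * c i) *s v i)" .
  from indexed_basis_unique[OF b this n(1)] have "c n * \<theta> n = \<mu> * c n" .
  then show ?thesis using n(2) by (simp add: mult.commute)
qed

lemma eigenvector_zero:
  assumes "indexed_basis scale d v" "Vector_Spaces.linear scale scale A"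
    and "\<And>n. n \<le> d \<Longrightarrow> A (v n) = \<theta> n *s v n"
    and "A u = \<mu> *s u" and "\<And>n. n \<le> d \<Longrightarrow> \<theta> n \<noteq> \<mu>"
  shows "u = 0"
proof -
  obtain c where u: "u = (\<Sum>i\<le>d. c i *s v i)" using indexed_basis_coords[OF assms(1)] .
  show ?thesis using eigenvector_coords[OF assms(1-4) u _ assms(5)] by (subst u) simp
qed

lemma eigenvector_multiple:
  assumes "indexed_basis scale d v" "Vector_Spaces.linear scale scale A"
    and "\<And>n. n \<le> d \<Longrightarrow> A (v n) = \<theta> n *s v n"
    and "A u = \<mu> *s u" and "m \<le> d" and "\<And>n. n \<le> d \<Longrightarrow> n \<noteq> m \<Longrightarrow> \<theta> n \<noteq> \<mu>"
  obtains a where "u = a *s v m"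
proof -
  obtain c where u: "u = (\<Sum>i\<le>d. c i *s v i)" using indexed_basis_coords[OF assms(1)] .
  have "u = (\<Sum>i\<le>d. if i = m then c i *s v i else 0)"
    by (subst u, rule sum.cong)
      (use eigenvector_coords[OF assms(1-4) u _ assms(6)] in auto)
  also have "\<dots> = c m *s v m" using assms(5) by (subst sum.delta) auto
  finally show ?thesis by (rule that)
qed

section \<open>Representing matrices\<close>

lemma represents_exists:
  assumes "indexed_basis scale d v"
  obtains M where "represents scale d v A M"
proof -
  have "\<exists>c. A (v n) = (\<Sum>i\<le>d. c i *s v i)" for n
  proof -
    obtain c where "A (v n) = (\<Sum>i\<le>d. c i *s v i)"
      using indexed_basis_coords[OF assms] .
    then show ?thesis by blast
  qed
  then obtain c where c: "\<And>n. A (v n) = (\<Sum>i\<le>d. c n i *s v i)" by metis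
  have "represents scale d v A (mat (d + 1) (d + 1) (\<lambda>(i, n). c n i))"
    unfolding represents_def by (auto simp: c intro!: sum.cong)
  then show ?thesis by (rule that)
qed

lemma represents_unique:
  assumes "indexed_basis scale d u" "represents scale d u A M" "represents scale d u B M"
    and "Vector_Spaces.linear scale scale A" "Vector_Spaces.linear scale scale B"
  shows "A w = B w"
  by (rule linear_eq_on_indexed_basis[OF assms(1,4,5)]) (use assms(2,3) in \<open>simp add: represents_def\<close>)

text \<open>
  The operator \<open>B\<close> has some representing matrix \<open>N\<close>. As \<open>M N = 1\<close> for square matrices over a field,
  \<open>N\<close> is the two-sided inverse that Gauss-Jordan elimination returns.
\<close>

lemma represents_inverse:
  assumes b: "indexed_basis scale d v" and A: "represents scale d v A M"
    and lin: "Vector_Spaces.linear scale scale A" and inv: "\<And>w. A (B w) = w"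
  shows "represents scale d v B (matinv M)"
proof -
  obtain N where N: "represents scale d v B N" using represents_exists[OF b] .
  have M: "M \<in> carrier_mat (d + 1) (d + 1)" and N': "N \<in> carrier_mat (d + 1) (d + 1)"
    using A N by (auto simp: represents_def)
  have "M * N = 1\<^sub>m (d + 1)"
  proof (rule eq_matI)
    fix i j assume "i < dim_row (1\<^sub>m (d + 1) :: 'a mat)" "j < dim_col (1\<^sub>m (d + 1) :: 'a mat)"
    then have ij: "i \<le> d" "j \<le> d" by auto
    have "v j = A (B (v j))" by (simp add: inv)
    also have "\<dots> = (\<Sum>k\<le>d. N $$ (k, j) *s A (v k))"
      using N ij linear_indexed_sum[OF lin] by (simp add: represents_def)
    also have "\<dots> = (\<Sum>k\<le>d. \<Sum>i\<le>d. (N $$ (k, j) * M $$ (i, k)) *s v i)"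
      using A by (intro sum.cong refl) (simp add: represents_def scale_sum_right)
    also have "\<dots> = (\<Sum>i\<le>d. (\<Sum>k\<le>d. N $$ (k, j) * M $$ (i, k)) *s v i)"
      by (subst sum.swap) (simp add: scale_sum_left)
    finally have e: "v j = (\<Sum>i\<le>d. (\<Sum>k\<le>d. N $$ (k, j) * M $$ (i, k)) *s v i)" .
    have "v j = (\<Sum>i\<le>d. (if i = j then v i else 0))" using ij by (subst sum.delta) auto
    also have "\<dots> = (\<Sum>i\<le>d. (if i = j then 1 else 0) *s v i)"
      by (rule sum.cong) auto
    finally have "(\<Sum>i\<le>d. (\<Sum>k\<le>d. N $$ (k, j) * M $$ (i, k)) *s v i)
        = (\<Sum>i\<le>d. (if i = j then 1 else 0) *s v i)"
      unfolding e[symmetric] .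
    from indexed_basis_unique[OF b this ij(1)]
    have "(\<Sum>k\<le>d. N $$ (k, j) * M $$ (i, k)) = (if i = j then 1 else 0)" .
    moreover have "(M * N) $$ (i, j) = (\<Sum>k\<le>d. N $$ (k, j) * M $$ (i, k))"
      using M N' ij
      by (auto simp: scalar_prod_def mult.commute atLeast0LessThan lessThan_Suc_atMost
          intro!: sum.cong)
    ultimately show "(M * N) $$ (i, j) = 1\<^sub>m (d + 1) $$ (i, j)" using ij by simp
  qed (use M N' in auto)
  moreover from this have NM: "N * M = 1\<^sub>m (d + 1)"
    using mat_mult_left_right_inverse[OF M N'] by simp
  ultimately have "M \<in> Units (ring_mat TYPE('a) (d + 1) ())"
    using M N' by (auto simp: Units_def ring_mat_def)
  then obtain N2 where N2: "mat_inverse M = Some N2"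
    using mat_inverse(1)[OF M, of "()"] by (cases "mat_inverse M") auto
  from mat_inverse(2)[OF M this] have "M * N2 = 1\<^sub>m (d + 1)" "N2 \<in> carrier_mat (d + 1) (d + 1)"
    by auto
  with NM M N' have "N2 = N"
    using assoc_mult_mat[of N "d + 1" "d + 1" M "d + 1" N2 "d + 1"]
    by (metis left_mult_one_mat right_mult_one_mat)
  then show ?thesis using N N2 by (simp add: matinv_def)
qed

lemma represents_reverse:
  assumes "represents scale d v A M"
  shows "represents scale d (\<lambda>n. v (d - n)) A (Zmat d * M * Zmat d)"
  unfolding represents_def Zmat_conj[OF represents_carrier[OF assms]]
proof (intro conjI allI impI)
  fix n assume n: "n \<le> d"
  have "A (v (d - n)) = (\<Sum>i\<le>d. M $$ (i, d - n) *s v i)"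
    using assms by (simp add: represents_def)
  also have "\<dots> = (\<Sum>i\<le>d. M $$ (d - i, d - n) *s v (d - i))"
    by (rule sum.reindex_bij_witness[of _ "\<lambda>i. d - i" "\<lambda>i. d - i"]) auto
  finally show "A (v (d - n)) = (\<Sum>i\<le>d. mat (d + 1) (d + 1)
       (\<lambda>(i, j). M $$ (d - i, d - j)) $$ (i, n) *s v (d - i))"
    using n by simp
qed simp

lemma represents_scaled:
  assumes "represents scale d (\<lambda>n. a n *s v n) A M" and lin: "Vector_Spaces.linear scale scale A"
    and a: "\<And>n. n \<le> d \<Longrightarrow> a n \<noteq> 0"
    and M': "M' \<in> carrier_mat (d + 1) (d + 1)"
      "\<And>i n. i \<le> d \<Longrightarrow> n \<le> d \<Longrightarrow> a n * M' $$ (i, n) = a i * M $$ (i, n)"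
  shows "represents scale d v A M'"
  unfolding represents_def
proof (intro conjI allI impI)
  interpret A: Vector_Spaces.linear scale scale A by fact
  fix n assume n: "n \<le> d"
  have "a n *s A (v n) = (\<Sum>i\<le>d. M $$ (i, n) *s a i *s v i)"
    using assms(1) n by (simp add: represents_def A.scale)
  also have "\<dots> = (\<Sum>i\<le>d. (a n * M' $$ (i, n)) *s v i)"
    using M'(2) n by (intro sum.cong) (auto simp: mult.commute)
  also have "\<dots> = a n *s (\<Sum>i\<le>d. M' $$ (i, n) *s v i)" by (simp add: scale_sum_right)
  finally show "A (v n) = (\<Sum>i\<le>d. M' $$ (i, n) *s v i)" using a[OF n] by simp
qed (rule M'(1))

lemma sum_tridiagonal:
  assumes n: "n \<le> d" and off: "\<And>i. i \<le> d \<Longrightarrow> i + 1 \<noteq> n \<Longrightarrow> i \<noteq> n \<Longrightarrow> i \<noteq> n + 1 \<Longrightarrow> c i = 0"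
    and c: "n \<ge> 1 \<Longrightarrow> c (n - 1) = a" "c n = b" "n < d \<Longrightarrow> c (n + 1) = e"
  shows "(\<Sum>i\<le>d. c i *s v i) = a *s extend_zero d v (int n - 1) + b *s extend_zero d v (int n)
     + e *s extend_zero d v (int n + 1)"
proof -
  have "(\<Sum>i\<le>d. c i *s v i) = (\<Sum>i\<in>({n - 1, n, n + 1} \<inter> {..d}). c i *s v i)"
  proof (rule sum.mono_neutral_right)
    show "\<forall>i\<in>{..d} - {n - 1, n, n + 1} \<inter> {..d}. c i *s v i = 0"
    proof
      fix i assume "i \<in> {..d} - {n - 1, n, n + 1} \<inter> {..d}"
      then have "i \<le> d" "i + 1 \<noteq> n" "i \<noteq> n" "i \<noteq> n + 1" by auto
      then show "c i *s v i = 0" using off by simp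
    qed
  qed auto
  also have "\<dots> = (if n \<ge> 1 then c (n - 1) *s v (n - 1) else 0) + c n *s v n
     + (if n < d then c (n + 1) *s v (n + 1) else 0)"
  proof (cases "n = 0")
    case True
    then have "{n - 1, n, n + 1} \<inter> {..d} = (if n < d then {0, 1} else {0})" by auto
    then show ?thesis using True by auto
  next
    case False
    then have "{n - 1, n, n + 1} \<inter> {..d} = (if n < d then {n - 1, n, n + 1} else {n - 1, n})"
      using n by auto
    moreover obtain m where "n = Suc m" using False by (cases n) auto
    ultimately show ?thesis by (auto simp: algebra_simps)
  qed
  also have "\<dots> = a *s extend_zero d v (int n - 1) + b *s extend_zero d v (int n)
     + e *s extend_zero d v (int n + 1)"
    using n c by (auto simp: extend_zero_def nat_diff_distrib nat_add_distrib)
  finally show ?thesis .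
qed

lemma sum_extend_zero: "(\<Sum>k\<in>{0..int d}. c k *s extend_zero d v k) = (\<Sum>i\<le>d. c (int i) *s v i)"
  by (rule sum.reindex_bij_witness[of _ int nat]) (auto simp: extend_zero_def)

lemma sum_shift_down:
  "(\<Sum>i\<le>d. c i *s extend_zero d v (int i - 1)) = (\<Sum>i\<le>d. (if i < d then c (Suc i) else 0) *s v i)"
proof (cases d)
  case (Suc e)
  have "(\<Sum>i\<le>e. c (Suc i) *s extend_zero d v (int (Suc i) - 1)) = (\<Sum>i\<le>e. c (Suc i) *s v i)"
    by (rule sum.cong) (auto simp: extend_zero_def Suc)
  then show ?thesis
    unfolding Suc sum.atMost_Suc_shift[of "\<lambda>i. c i *s extend_zero (Suc e) v (int i - 1)"]
    by (simp add: extend_zero_outside)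
qed (simp add: extend_zero_def)

text \<open>
  A bidiagonal operator whose diagonal is known is determined by its eigenvalue on the sum of the
  basis: comparing coefficients, each row sum equals that eigenvalue.
\<close>

lemma bidiagonal_by_row_sums:
  assumes b: "indexed_basis scale d v" and A: "Vector_Spaces.linear scale scale A"
    and e: "\<delta> \<in> {1, - 1 :: int}"
    and ex: "\<And>n. n \<le> d \<Longrightarrow> \<exists>a. A (v n) = \<alpha> (int n) *s v n + a *s extend_zero d v (int n - \<delta>)"
    and sum: "A (\<Sum>n\<le>d. v n) = \<mu> *s (\<Sum>n\<le>d. v n)" and n: "n \<le> d"
  shows "A (v n) = \<alpha> (int n) *s v n + (\<mu> - \<alpha> (int n - \<delta>)) *s extend_zero d v (int n - \<delta>)"
proof -
  define w where "w = extend_zero d v"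
  obtain a where a: "\<And>n. n \<le> d \<Longrightarrow> A (v n) = \<alpha> (int n) *s v n + a n *s w (int n - \<delta>)"
    using ex unfolding w_def by metis
  define a' where "a' k = a (nat k)" for k :: int
  have hom: "A (\<Sum>n\<le>d. v n) = (\<Sum>n\<le>d. A (v n))"
    using linear_indexed_sum[OF A, of "\<lambda>_. 1" v "{..d}"] by simp
  have "(\<Sum>n\<le>d. a n *s w (int n - \<delta>)) = (\<Sum>k\<in>{0..int d}. a' k *s w (k - \<delta>))"
    by (rule sum.reindex_bij_witness[of _ nat int]) (auto simp: a'_def)
  also have "\<dots> = (\<Sum>k\<in>{0..int d}. (if k + \<delta> \<in> {0..int d} then a' (k + \<delta>) else 0) *s w k)"
    by (rule sum.reindex_bij_witness_not_neutral[of "{0..int d} \<inter> {k. k - \<delta> \<notin> {0..int d}}"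
          "{0..int d} \<inter> {k. k + \<delta> \<notin> {0..int d}}" _ "\<lambda>k. k + \<delta>" "\<lambda>k. k - \<delta>"])
      (auto simp: w_def extend_zero_def)
  also have "\<dots> = (\<Sum>i\<le>d. (if int i + \<delta> \<in> {0..int d} then a' (int i + \<delta>) else 0) *s v i)"
    unfolding w_def by (rule sum_extend_zero)
  finally have shifted: "(\<Sum>n\<le>d. a n *s w (int n - \<delta>))
      = (\<Sum>i\<le>d. (if int i + \<delta> \<in> {0..int d} then a' (int i + \<delta>) else 0) *s v i)" .
  have "(\<Sum>i\<le>d. \<mu> *s v i) = (\<Sum>n\<le>d. \<alpha> (int n) *s v n + a n *s w (int n - \<delta>))"
    using sum a by (simp add: hom scale_sum_right)
  also have "\<dots> = (\<Sum>i\<le>d. (\<alpha> (int i)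
      + (if int i + \<delta> \<in> {0..int d} then a' (int i + \<delta>) else 0)) *s v i)"
    by (simp only: sum.distrib shifted scale_left_distrib)
  finally have eq: "(\<Sum>i\<le>d. \<mu> *s v i) = (\<Sum>i\<le>d. (\<alpha> (int i)
      + (if int i + \<delta> \<in> {0..int d} then a' (int i + \<delta>) else 0)) *s v i)" .
  show ?thesis
  proof (cases "0 \<le> int n - \<delta> \<and> int n - \<delta> \<le> int d")
    case True
    then obtain m where m: "int n - \<delta> = int m" "m \<le> d"
      by (metis of_nat_le_iff zero_le_imp_eq_int)
    from indexed_basis_unique[OF b eq m(2)]
    have "\<mu> = \<alpha> (int m) + (if int m + \<delta> \<in> {0..int d} then a' (int m + \<delta>) else 0)" .
    moreover have "int m + \<delta> = int n" using m by simp
    ultimately have "a n = \<mu> - \<alpha> (int m)" using n by (simp add: a'_def)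
    then show ?thesis using a[OF n] m by (simp add: w_def)
  next
    case False
    then have "w (int n - \<delta>) = 0" by (auto simp: w_def extend_zero_def)
    then show ?thesis using a[OF n] by (simp add: w_def)
  qed
qed

text \<open>
  Outside the index range, only the vector one step beyond the end can be moved back inside. If its
  coefficient vanishes, a bidiagonal formula holds for all integer indices.
\<close>

lemma bidiagonal_extend:
  assumes "Vector_Spaces.linear scale scale A" "\<delta> \<in> {1, - 1 :: int}"
    and act: "\<And>n. n \<le> d \<Longrightarrow> A (v n) = \<alpha> (int n) *s v n + \<beta> (int n) *s extend_zero d v (int n - \<delta>)"
    and edge: "\<delta> = 1 \<Longrightarrow> \<beta> (int d + 1) = 0" "\<delta> = - 1 \<Longrightarrow> \<beta> (- 1) = 0"
  shows "A (extend_zero d v k) = \<alpha> k *s extend_zero d v k + \<beta> k *s extend_zero d v (k - \<delta>)"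
proof (cases "0 \<le> k \<and> k \<le> int d")
  case True
  then obtain n where "k = int n" "n \<le> d" by (metis of_nat_le_iff zero_le_imp_eq_int)
  then show ?thesis using act[of n] by (simp add: extend_zero_of_nat)
next
  case False
  interpret A: Vector_Spaces.linear scale scale A by fact
  have "k - \<delta> < 0 \<or> k - \<delta> > int d \<or> \<beta> k = 0"
  proof (cases "\<delta> = 1")
    case True
    then show ?thesis using False edge(1) by (cases "k = int d + 1") auto
  next
    case d: False
    then show ?thesis using False edge(2) assms(2) by (cases "k = - 1") auto
  qed
  moreover have "extend_zero d v k = 0" using False by (auto simp: extend_zero_def)
  ultimately show ?thesis by (auto simp: A.zero extend_zero_outside)
qed

lemma represents_tridiagonal_iff:
  assumes "M \<in> carrier_mat (d + 1) (d + 1)"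
    and "\<And>n. 1 \<le> n \<Longrightarrow> n \<le> d \<Longrightarrow> M $$ (n - 1, n) = a n"
    and "\<And>n. n \<le> d \<Longrightarrow> M $$ (n, n) = b n"
    and "\<And>n. n < d \<Longrightarrow> M $$ (n + 1, n) = c n"
    and "\<And>i n. i \<le> d \<Longrightarrow> n \<le> d \<Longrightarrow> i + 1 \<noteq> n \<Longrightarrow> i \<noteq> n \<Longrightarrow> i \<noteq> n + 1 \<Longrightarrow> M $$ (i, n) = 0"
  shows "represents scale d v A M \<longleftrightarrow>
    (\<forall>n\<le>d. A (v n) = a n *s extend_zero d v (int n - 1) + b n *s extend_zero d v (int n)
       + c n *s extend_zero d v (int n + 1))"
proof -
  have "(\<Sum>i\<le>d. M $$ (i, n) *s v i) = a n *s extend_zero d v (int n - 1) + b n *s extend_zero d v (int n)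
       + c n *s extend_zero d v (int n + 1)" if "n \<le> d" for n
    by (rule sum_tridiagonal) (use assms that in auto)
  then show ?thesis using assms(1) by (auto simp: represents_def)
qed

text \<open>
  The banded matrices of the tables, written as actions on a basis. From left to right such an
  equivalence reads an action off \<open>V\<^sub>d(t)\<close>; from right to left it turns a computed action into an entry
  of a table.
\<close>

lemma represents_Kmat_iff:
  "represents scale d v A (Kmat d q) \<longleftrightarrow>
    (\<forall>n\<le>d. A (v n) = q powi (int d - 2 * int n) *s extend_zero d v (int n))"
  by (subst represents_tridiagonal_iff[where a = "\<lambda>_. 0" and c = "\<lambda>_. 0"
        and b = "\<lambda>n. q powi (int d - 2 * int n)"]) (auto simp: Kmat_def)

lemma represents_Emat_iff:
  "represents scale d v A (Emat d q) \<longleftrightarrow>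
    (\<forall>n\<le>d. A (v n) = q powi (2 * int n - int d) *s extend_zero d v (int n)
      + (q powi int d - q powi (2 * int n - 2 - int d)) *s extend_zero d v (int n - 1))"
  by (subst represents_tridiagonal_iff[where c = "\<lambda>_. 0" and b = "\<lambda>n. q powi (2 * int n - int d)"
        and a = "\<lambda>n. q powi int d - q powi (2 * int n - 2 - int d)"]) (auto simp: Emat_def add.commute)

lemma represents_Lmat_iff:
  "represents scale d v A (Lmat d q t) \<longleftrightarrow>
    (\<forall>n\<le>d. A (v n) = q powi (2 * int n - int d) *s extend_zero d v (int n)
      + ((q powi int d - q powi (2 * int n - 2 - int d))
        * inverse (1 - t * q powi (int d - 2 * int n + 1))) *s extend_zero d v (int n - 1))"
  by (subst represents_tridiagonal_iff[where c = "\<lambda>_. 0" and b = "\<lambda>n. q powi (2 * int n - int d)"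
        and a = "\<lambda>n. (q powi int d - q powi (2 * int n - 2 - int d))
          * inverse (1 - t * q powi (int d - 2 * int n + 1))"]) (auto simp: Lmat_def add.commute)

lemma represents_Fmat_iff:
  "represents scale d v A (Fmat d q t) \<longleftrightarrow>
    (\<forall>n\<le>d. A (v n) = q powi (2 * int n - int d) *s extend_zero d v (int n)
      + ((q powi int d - q powi (2 * int n - 2 - int d)) * q powi (1 - int d) * t)
        *s extend_zero d v (int n - 1))"
  by (subst represents_tridiagonal_iff[where c = "\<lambda>_. 0" and b = "\<lambda>n. q powi (2 * int n - int d)"
        and a = "\<lambda>n. (q powi int d - q powi (2 * int n - 2 - int d)) * q powi (1 - int d) * t"])
    (auto simp: Fmat_def add.commute)

lemma represents_Zmat_Emat_iff:
  "represents scale d v A (Zmat d * Emat d (inverse q) * Zmat d) \<longleftrightarrow>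
    (\<forall>n\<le>d. A (v n) = q powi (2 * int n - int d) *s extend_zero d v (int n)
      + (q powi (- int d) - q powi (2 * int n + 2 - int d)) *s extend_zero d v (int n + 1))"
  by (subst represents_tridiagonal_iff[OF Zmat_conj_carrier[OF matrix_carriers(3)],
        where a = "\<lambda>_. 0" and b = "\<lambda>n. q powi (2 * int n - int d)"
        and c = "\<lambda>n. q powi (- int d) - q powi (2 * int n + 2 - int d)"])
    (auto simp: Zmat_conj_entry Emat_def powi_inverse of_nat_diff algebra_simps)

lemma represents_Zmat_Gmat_iff:
  "represents scale d v A (Zmat d * Gmat d (inverse q) t * Zmat d) \<longleftrightarrow>
    (\<forall>n\<le>d. A (v n) = q powi (2 * int n - int d) *s extend_zero d v (int n)
      + ((q powi (- int d) - q powi (2 * int n + 2 - int d)) * (1 - t * q powi (int d - 2 * int n - 1)))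
        *s extend_zero d v (int n + 1))"
  by (subst represents_tridiagonal_iff[OF Zmat_conj_carrier[OF matrix_carriers(5)],
        where a = "\<lambda>_. 0" and b = "\<lambda>n. q powi (2 * int n - int d)"
        and c = "\<lambda>n. (q powi (- int d) - q powi (2 * int n + 2 - int d))
          * (1 - t * q powi (int d - 2 * int n - 1))"])
    (auto simp: Zmat_conj_entry Gmat_def powi_inverse of_nat_diff algebra_simps)

lemma represents_Zmat_Fmat_iff:
  "represents scale d v A (Zmat d * Fmat d (inverse q) t * Zmat d) \<longleftrightarrow>
    (\<forall>n\<le>d. A (v n) = q powi (2 * int n - int d) *s extend_zero d v (int n)
      + ((q powi (- int d) - q powi (2 * int n + 2 - int d)) * q powi (int d - 1) * t)
        *s extend_zero d v (int n + 1))"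
proof (subst represents_tridiagonal_iff[OF Zmat_conj_carrier[OF matrix_carriers(4)],
      where a = "\<lambda>_. 0" and b = "\<lambda>n. q powi (2 * int n - int d)"
      and c = "\<lambda>n. (q powi (- int d) - q powi (2 * int n + 2 - int d)) * q powi (int d - 1) * t"])
  fix n assume n: "n < d"
  then have "d - Suc n \<noteq> d - n" by simp
  then show "(Zmat d * Fmat d (inverse q) t * Zmat d) $$ (n + 1, n)
      = (q powi (- int d) - q powi (2 * int n + 2 - int d)) * q powi (int d - 1) * t"
    using n by (simp add: Zmat_conj_entry Fmat_def powi_inverse of_nat_diff Suc_diff_Suc algebra_simps)
qed (auto simp: Zmat_conj_entry Fmat_def powi_inverse of_nat_diff algebra_simps)

lemma represents_Zmat_Smat_iff:
  assumes q: "q \<noteq> 0" and t: "t \<noteq> 0"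
  shows "represents scale d v A (Zmat d * Smat d (inverse q) (inverse t) * Zmat d) \<longleftrightarrow>
    (\<forall>n\<le>d. A (v n) = (- inverse (t * q) * q powi (2 * int n - int d)
        * (q powi int d - q powi (2 * int n - 2 - int d))) *s extend_zero d v (int n - 1)
      + (q powi (2 * int n - int d) + inverse (t * q)
        * (1 - q powi (2 * int n - int d) * q powi (2 * int n - int d)
        - (q powi (- int d) - q powi (2 * int n + 2 - int d)) * (q powi int d - q powi (2 * int n - int d))))
        *s extend_zero d v (int n)
      + ((q powi (- int d) - q powi (2 * int n + 2 - int d))
        * (1 - inverse (t * q) * q powi (2 * int n + 2 - int d))) *s extend_zero d v (int n + 1))"
proof -
  note powi_plus = power_int_add[OF disjI1[OF q]]
  show ?thesis
  proof (rule represents_tridiagonal_iff[OF Zmat_conj_carrier[OF matrix_carriers(7)]])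
    fix n assume n: "1 \<le> n" "n \<le> d"
    define D y where "D = q powi int d" and "y = q powi (2 * int n - int d)"
    have p: "q powi (2 * int n - 2 - int d) = inverse q * inverse q * y" 
       "q powi (2 * int n - 1 - int d) = inverse q * y"
      using powi_plus[of "- 2" "2 * int n - int d"] powi_plus[of "- 1" "2 * int n - int d"]
      by (simp_all add: y_def power_int_minus power2_eq_square algebra_simps)
    have "(Zmat d * Smat d (inverse q) (inverse t) * Zmat d) $$ (n - 1, n)
        = (q powi (2 * int n - 2 - int d) - q powi int d) * q powi (2 * int n - 1 - int d) * inverse t"
      using n by (simp add: Zmat_conj_entry Smat_def powi_inverse of_nat_diff Suc_diff_le algebra_simps)
    then show "(Zmat d * Smat d (inverse q) (inverse t) * Zmat d) $$ (n - 1, n)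
        = - inverse (t * q) * q powi (2 * int n - int d)
          * (q powi int d - q powi (2 * int n - 2 - int d))"
      unfolding p D_def[symmetric] y_def[symmetric] using q t by (simp add: field_simps)
  next
    fix n assume n: "n \<le> d"
    define D y where "D = q powi int d" and "y = q powi (2 * int n - int d)"
    have D: "D \<noteq> 0" by (simp add: D_def q)
    have p: "q powi (2 * int n + 2 - int d) = q * q * y" "q powi (2 * int n + 1 - int d) = q * y" 
       "q powi (2 * int n - 1 - int d) = inverse q * y" "q powi (- int d) = inverse D"
      using powi_plus[of 2 "2 * int n - int d"] powi_plus[of 1 "2 * int n - int d"]
        powi_plus[of "- 1" "2 * int n - int d"]
      by (simp_all add: y_def D_def power_int_minus power2_eq_square algebra_simps)
    have "(Zmat d * Smat d (inverse q) (inverse t) * Zmat d) $$ (n, n)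
        = q powi (- int d) - (q powi (2 * int n - int d) - q powi int d) * q powi (2 * int n + 1 - int d) * inverse t
          - (q powi (- int d) - q powi (2 * int n - int d)) * (1 - inverse t * q powi (2 * int n - 1 - int d))"
      using n by (simp add: Zmat_conj_entry Smat_def powi_inverse of_nat_diff) (simp add: algebra_simps)
    also have "\<dots> = q powi (2 * int n - int d) + inverse (t * q)
          * (1 - q powi (2 * int n - int d) * q powi (2 * int n - int d)
          - (q powi (- int d) - q powi (2 * int n + 2 - int d)) * (q powi int d - q powi (2 * int n - int d)))"
      unfolding p D_def[symmetric] y_def[symmetric]
      using q t D by (simp add: field_simps)
    finally show "(Zmat d * Smat d (inverse q) (inverse t) * Zmat d) $$ (n, n)
        = q powi (2 * int n - int d) + inverse (t * q)
          * (1 - q powi (2 * int n - int d) * q powi (2 * int n - int d)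
          - (q powi (- int d) - q powi (2 * int n + 2 - int d)) * (q powi int d - q powi (2 * int n - int d)))" .
  next
    fix n assume n: "n < d"
    define D y where "D = q powi int d" and "y = q powi (2 * int n - int d)"
    have p: "q powi (2 * int n + 2 - int d) = q * q * y" "q powi (2 * int n + 1 - int d) = q * y"
      using powi_plus[of 2 "2 * int n - int d"] powi_plus[of 1 "2 * int n - int d"]
      by (simp_all add: y_def D_def power_int_minus power2_eq_square algebra_simps)
    have "(Zmat d * Smat d (inverse q) (inverse t) * Zmat d) $$ (n + 1, n)
       = (q powi (- int d) - q powi (2 * int n + 2 - int d)) * (1 - inverse t * q powi (2 * int n + 1 - int d))"
      using n by (simp add: Zmat_conj_entry Smat_def powi_inverse of_nat_diff Suc_diff_Suc algebra_simps)
    then show "(Zmat d * Smat d (inverse q) (inverse t) * Zmat d) $$ (n + 1, n)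
       = (q powi (- int d) - q powi (2 * int n + 2 - int d))
          * (1 - inverse (t * q) * q powi (2 * int n + 2 - int d))"
      unfolding p D_def[symmetric] y_def[symmetric] using q t by (simp add: field_simps)
  qed (auto simp: Zmat_conj_entry Smat_def)
qed

text \<open>
  The evaluation relations express \<open>x\<^sub>3\<^sub>0\<close> by \<open>B = x\<^sub>2\<^sub>3\<close> and \<open>C = x\<^sub>3\<^sub>1\<close>, and \<open>x\<^sub>0\<^sub>1\<close> by \<open>A = x\<^sub>1\<^sub>2\<close> and
  \<open>C = x\<^sub>3\<^sub>1\<close>. The next two lemmas compute these expressions from the actions of \<open>A\<close>, \<open>B\<close>, \<open>C\<close> alone, so
  that they apply both to \<open>V\<^sub>d(t)\<close>, where the relations are still to be shown, and to the bases of
  the tables, where the relations are known.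
\<close>

lemma evaluation_lower_action:
  assumes q: "q \<noteq> 0" and B: "Vector_Spaces.linear scale scale B"
    and actB: "\<And>k. B (w k) = q powi (int d - 2 * k) *s w k"
    and actC: "C (w k) = q powi (2 * k - int d) *s w k + (q powi (- int d) - q powi (2 * k + 2 - int d)) *s w (k + 1)"
  shows "C (w k) + (t * q) *s (w k - B (C (w k))) = q powi (2 * k - int d) *s w k
     + ((q powi (- int d) - q powi (2 * k + 2 - int d)) * (1 - t * q powi (int d - 2 * k - 1))) *s w (k + 1)"
proof -
  interpret B: Vector_Spaces.linear scale scale B by fact
  define s where "s = q powi (- int d) - q powi (2 * k + 2 - int d)"
  have p: "q powi (2 * k - int d) * q powi (int d - 2 * k) = 1"
    using q power_int_add[of q "2 * k - int d" "int d - 2 * k"] by simp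
  have p2: "q * q powi (int d - 2 * (k + 1)) = q powi (int d - 2 * k - 1)"
    using q power_int_add[of q 1 "int d - 2 * (k + 1)"] by (simp add: algebra_simps)
  have "C (w k) = q powi (2 * k - int d) *s w k + s *s w (k + 1)"
    using actC by (simp add: s_def)
  moreover have "B (q powi (2 * k - int d) *s w k + s *s w (k + 1))
      = w k + (s * q powi (int d - 2 * (k + 1))) *s w (k + 1)"
    by (simp add: B.add B.scale actB p)
  moreover have "q powi (2 * k - int d) *s w k + s *s w (k + 1) +
      (t * q) *s (w k - (w k + (s * q powi (int d - 2 * (k + 1))) *s w (k + 1)))
    = q powi (2 * k - int d) *s w k + (s * (1 - t * (q * q powi (int d - 2 * (k + 1))))) *s w (k + 1)"
    by (simp add: algebra_simps)
  ultimately show ?thesis by (simp only: p2 s_def)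
qed

lemma evaluation_tridiagonal_action:
  assumes A: "Vector_Spaces.linear scale scale A"
    and actA: "\<And>k. A (w k) = q powi (2 * k - int d) *s w k + (q powi int d - q powi (2 * k - 2 - int d)) *s w (k - 1)"
    and actC: "C (w k) = q powi (2 * k - int d) *s w k + (q powi (- int d) - q powi (2 * k + 2 - int d)) *s w (k + 1)"
  shows "C (w k) + inverse (t * q) *s (w k - A (C (w k)))
    = (- inverse (t * q) * q powi (2 * k - int d)
        * (q powi int d - q powi (2 * k - 2 - int d))) *s w (k - 1)
    + (q powi (2 * k - int d) + inverse (t * q) * (1 - q powi (2 * k - int d) * q powi (2 * k - int d)
        - (q powi (- int d) - q powi (2 * k + 2 - int d)) * (q powi int d - q powi (2 * k - int d)))) *s w k
    + ((q powi (- int d) - q powi (2 * k + 2 - int d))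
        * (1 - inverse (t * q) * q powi (2 * k + 2 - int d))) *s w (k + 1)"
proof -
  interpret A: Vector_Spaces.linear scale scale A by fact
  define s where "s = q powi (- int d) - q powi (2 * k + 2 - int d)"
  define y where "y = q powi (2 * k - int d)"
  have e: "2 * (k + 1) - 2 - int d = 2 * k - int d" "2 * (k + 1) - int d = 2 * k + 2 - int d" by auto
  have C: "C (w k) = y *s w k + s *s w (k + 1)"
    using actC by (simp add: s_def y_def)
  have AC: "A (y *s w k + s *s w (k + 1))
      = y *s (y *s w k + (q powi int d - q powi (2 * k - 2 - int d)) *s w (k - 1))
       + s *s (q powi (2 * k + 2 - int d) *s w (k + 1) + (q powi int d - y) *s w k)"
    using actA[of k] actA[of "k + 1"] by (simp add: A.add A.scale y_def e)
  show ?thesis unfolding C AC s_def[symmetric] y_def[symmetric]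
    by (simp add: algebra_simps)
qed

end

section \<open>Indices modulo 4\<close>

lemma four_cases:
  fixes r :: 4
  obtains "r = 0" | "r = 1" | "r = 2" | "r = 3"
proof (cases r rule: bit0_cases)
  case (of_int z)
  then have "z = 0 \<or> z = 1 \<or> z = 2 \<or> z = 3" by auto
  then show ?thesis using of_int(1) that by auto
qed

lemma four_numerals [simp]: "(4 :: 4) = 0" "(5 :: 4) = 1" "(6 :: 4) = 2"
  by simp_all

lemma four_uminus [simp]: "(- 1 :: 4) = 3" "(- 2 :: 4) = 2" "(- 3 :: 4) = 1"
  by (rule minus_unique; simp)+

lemma four_reflect:
  fixes r :: 4
  shows "1 - (r + 1) = (1 - r) + 3" "1 - (r + 2) = (1 - r) + 2" "1 - (r + 3) = (1 - r) + 1"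
  by (cases r rule: four_cases; simp)+

lemma four_shift:
  fixes r :: 4
  shows "r + 2 + 2 = r" "r + 2 + 3 = r + 1" "r + 3 + 1 = r" "r + 1 + 3 = r" "r + 3 + 2 = r + 1"
    "r + 3 + 3 = r + 2" "r + 1 + 1 = r + 2" "r + 1 + 2 = r + 3" "r + 2 + 1 = r + 3"
  by (cases r rule: four_cases; simp)+

lemma std_gen_reflect: "std_gen (1 - j) (1 - i) = std_gen i j"
  by (simp add: std_gen_def algebra_simps)

lemma std_gen_rotate: "std_gen (i + c) (j + c) = std_gen i j"
  by (simp add: std_gen_def)

text \<open>
  The parameter seen from the index \<open>r\<close>: rotating the module by \<open>r\<close> replaces \<open>t\<close> by \<open>twist t r\<close>.
\<close>

definition twist :: "'a::field \<Rightarrow> 4 \<Rightarrow> 'a" where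
  "twist t r = (if r \<in> {0, 2} then t else inverse t)"

lemma twist_rotate: "twist (inverse t) r = twist t (r + 1)"
  by (cases r rule: four_cases) (simp_all add: twist_def)

lemma twist_reflect: "twist t (1 - r) = inverse (twist t r)"
  by (cases r rule: four_cases) (simp_all add: twist_def)

lemma twist_half_turn: "twist t (r + 2) = twist t r"
  by (cases r rule: four_cases) (simp_all add: twist_def)

section \<open>Evaluation modules by relations\<close>

lemma powi_eq_iff_not_root:
  fixes q :: "'a::field"
  assumes "q \<noteq> 0" and "\<And>n::nat. n \<ge> 1 \<Longrightarrow> q ^ n \<noteq> 1"
  shows "q powi m = q powi n \<longleftrightarrow> m = n"
proof -
  have *: "q powi m \<noteq> q powi n" if mn: "m < n" for m n :: int
  proof
    assume e: "q powi m = q powi n"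
    obtain k where k: "n = m + int k" using mn zle_iff_zadd[of m n] by auto
    have "q powi n = q powi m * q ^ k" unfolding k using assms(1) by (simp add: power_int_add)
    then have "q ^ k = 1" using e assms(1) by simp
    then show False using assms(2)[of k] k mn by auto
  qed
  show ?thesis using *[of m n] *[of n m] by (cases m n rule: linorder_cases) auto
qed

text \<open>
  In this locale the spectrum enters only through a bound on exponents, which is symmetric under
  \<open>q \<mapsto> q\<^sup>-\<^sup>1\<close>. Likewise the set of excluded parameters is closed under inversion, so that every
  assumption survives rotation and reflection of the indices.
\<close>

locale boxq_evaluation = vector_space scale
  for scale :: "'a::field \<Rightarrow> 'v::ab_group_add \<Rightarrow> 'v" (infixr \<open>*s\<close> 75) +
  fixes q t :: 'a and x :: "4 \<Rightarrow> 4 \<Rightarrow> 'v \<Rightarrow> 'v" and d :: nat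
  assumes q_nonzero: "q \<noteq> 0"
    and q_not_root: "n \<ge> 1 \<Longrightarrow> q ^ n \<noteq> 1"
    and linear_gen: "std_gen i j \<Longrightarrow> Vector_Spaces.linear scale scale (x i j)"
    and gen_inverse: "j - i = 2 \<Longrightarrow> x i j (x j i v) = v"
    and gen_weyl: "(j - i, k - j) \<in> {(1, 1), (1, 2), (2, 1)} \<Longrightarrow>
      q *s x i j (x j k v) - inverse q *s x j k (x i j v) = (q - inverse q) *s v"
    and gen_eigenvalue: "std_gen i j \<Longrightarrow> v \<noteq> 0 \<Longrightarrow> x i j v = q powi m *s v \<Longrightarrow> \<bar>m\<bar> \<le> int d"
    and t_nonzero: "t \<noteq> 0"
    and t_generic: "1 \<le> n \<Longrightarrow> n \<le> d \<Longrightarrow> t \<noteq> q powi (int d - 2 * int n + 1)"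
    and gen_evaluation: "x (r + 3) r v - x (r + 3) (r + 1) v
      = (twist t r * q) *s (v - x (r + 2) (r + 3) (x (r + 3) (r + 1) v))"
begin

lemma powi_eq_iff: "q powi m = q powi n \<longleftrightarrow> m = n"
  using powi_eq_iff_not_root[OF q_nonzero q_not_root] .

lemma powi_nonzero [simp]: "q powi m \<noteq> 0"
  using q_nonzero by simp

lemma powi_plus: "q powi (m + n) = q powi m * q powi n"
  using q_nonzero by (simp add: power_int_add)

lemma powi_mult_eq_1: "m + n = 0 \<Longrightarrow> q powi m * q powi n = 1"
  using q_nonzero power_int_add[of q m n] by simp

lemma q_diff_inverse_nonzero: "q - inverse q \<noteq> 0"
  using powi_eq_iff[of 1 "- 1"] by (simp add: power_int_minus)

lemma inverse_nonzero_q: "inverse q \<noteq> 0"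
  using q_nonzero by simp

text \<open>
  These factors are the denominators in the tables; the excluded values of \<open>t\<close> are exactly their zeros.
\<close>

lemma t_factor_nonzero:
  assumes "1 \<le> k" "k \<le> int d"
  shows "1 - t * q powi (2 * k - int d - 1) \<noteq> 0" "1 - t * q powi (int d - 2 * k + 1) \<noteq> 0"
proof -
  have *: "1 - t * q powi (2 * k - int d - 1) \<noteq> 0" if k: "1 \<le> k" "k \<le> int d" for k
  proof
    assume "1 - t * q powi (2 * k - int d - 1) = 0"
    then have "t = q powi (- (2 * k - int d - 1))"
      using powi_mult_eq_1[of "2 * k - int d - 1" "- (2 * k - int d - 1)"]
        powi_nonzero[of "2 * k - int d - 1"]
      by (metis add.right_inverse eq_iff_diff_eq_0 mult_right_cancel mult.commute)
    moreover obtain n where "k = int n" using k zero_le_imp_eq_int by force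
    ultimately show False using t_generic[of n] k by (simp add: algebra_simps)
  qed
  show "1 - t * q powi (2 * k - int d - 1) \<noteq> 0" by (rule *[OF assms])
  show "1 - t * q powi (int d - 2 * k + 1) \<noteq> 0"
    using *[of "int d + 1 - k"] assms by (simp add: algebra_simps)
qed

lemma t_factor_below:
  assumes "i < d"
  shows "1 - t * q powi (2 * int i - int d + 1) \<noteq> 0"
proof -
  have "2 * int i - int d + 1 = 2 * (int i + 1) - int d - 1" by simp
  moreover have "1 - t * q powi (2 * (int i + 1) - int d - 1) \<noteq> 0"
    by (rule t_factor_nonzero(1)) (use assms in auto)
  ultimately show ?thesis by metis
qed

lemma twist_nonzero: "twist t r \<noteq> 0"
  using t_nonzero by (simp add: twist_def)

lemma gen_linear: "std_gen i j \<Longrightarrow> module_hom scale scale (x i j)"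
  using linear_gen by (auto dest: Vector_Spaces.linear.axioms(3))

lemma gen_add: "std_gen i j \<Longrightarrow> x i j (u + v) = x i j u + x i j v"
  using gen_linear by (rule module_hom.add)

lemma gen_diff: "std_gen i j \<Longrightarrow> x i j (u - v) = x i j u - x i j v"
  using gen_linear by (rule module_hom.diff)

lemma gen_scale: "std_gen i j \<Longrightarrow> x i j (c *s v) = c *s x i j v"
  using gen_linear by (rule module_hom.scale)

lemma gen_zero: "std_gen i j \<Longrightarrow> x i j 0 = 0"
  using gen_linear by (rule module_hom.zero)

lemmas gen_hom = gen_add gen_diff gen_scale gen_zero

lemma std_gens [simp]: "std_gen 0 1" "std_gen 1 2" "std_gen 2 3" "std_gen 3 0"
  "std_gen 0 2" "std_gen 1 3" "std_gen 2 0" "std_gen 3 1"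
  by (simp_all add: std_gen_def)

text \<open>
  A rotation by one step exchanges even and odd indices, hence inverts the parameter. The excluded
  parameters are permuted by \<open>n \<mapsto> d + 1 - n\<close>.
\<close>

lemma boxq_evaluation_rotate: "boxq_evaluation scale q (inverse t) (\<lambda>i j. x (i + 1) (j + 1)) d"
proof (intro boxq_evaluation.intro boxq_evaluation_axioms.intro vector_space_axioms, goal_cases)
  case (3 i j) then show ?case using linear_gen[of "i + 1" "j + 1"] by (simp add: std_gen_rotate)
next
  case (4 j i v) then show ?case by (simp add: gen_inverse)
next
  case (5 j i k v) then show ?case using gen_weyl[of "j + 1" "i + 1" "k + 1"] by simp
next
  case (6 i j v m) then show ?case using gen_eigenvalue[of "i + 1" "j + 1" v m] by (simp add: std_gen_rotate)
next
  case (8 n)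
  then have "t \<noteq> q powi (int d - 2 * int (d + 1 - n) + 1)" by (intro t_generic) auto
  also have "int d - 2 * int (d + 1 - n) + 1 = - (int d - 2 * int n + 1)" using 8 by (simp add: of_nat_diff)
  finally have "t \<noteq> inverse (q powi (int d - 2 * int n + 1))" unfolding power_int_minus .
  then show ?case by (metis inverse_inverse_eq)
next
  case (9 r v) show ?case
    using gen_evaluation[of "r + 1" v] by (simp add: twist_rotate four_shift)
qed (use q_nonzero q_not_root t_nonzero in auto)

lemma boxq_evaluation_rotate2:
  "boxq_evaluation scale q t (\<lambda>i j. x (i + 2) (j + 2)) d"
proof -
  interpret r: boxq_evaluation scale q "inverse t" "\<lambda>i j. x (i + 1) (j + 1)" d
    by (rule boxq_evaluation_rotate)
  show ?thesis using r.boxq_evaluation_rotate by (simp add: four_shift)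
qed

text \<open>
  The evaluation relation at \<open>u + 2\<close> contains \<open>x\<^bsub>u+1,u+3\<^esub>\<close>. Multiplying it from the right by the inverse
  \<open>x\<^bsub>u+3,u+1\<^esub>\<close> gives a relation of the shape that reflection requires.
\<close>

lemma gen_evaluation_dual:
  "x u (u + 1) v - x (u + 3) (u + 1) v
    = inverse (twist t u * q) *s (v - x (u + 1) (u + 2) (x (u + 3) (u + 1) v))"
proof -
  have i: "x (u + 1) (u + 3) (x (u + 3) (u + 1) v) = v" by (rule gen_inverse) simp
  have "x (u + 1) (u + 2) (x (u + 3) (u + 1) v) - v
      = (twist t u * q) *s (x (u + 3) (u + 1) v - x u (u + 1) v)"
    using gen_evaluation[of "u + 2" "x (u + 3) (u + 1) v"]
    by (simp only: four_shift i twist_half_turn)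
  then have "inverse (twist t u * q) *s (x (u + 1) (u + 2) (x (u + 3) (u + 1) v) - v)
      = x (u + 3) (u + 1) v - x u (u + 1) v"
    using twist_nonzero[of u] q_nonzero
    by (simp only: scale_scale) (simp add: field_simps)
  then show ?thesis by (metis minus_diff_eq scale_minus_right)
qed

text \<open>
  Reading all pairs of indices backwards reverses the order of the factors in the q-Weyl relations,
  which is the same as inverting \<open>q\<close>; the evaluation relations turn into their dual forms.
\<close>

lemma boxq_evaluation_reflect:
  "boxq_evaluation scale (inverse q) t (\<lambda>i j. x (1 - j) (1 - i)) d"
proof (intro boxq_evaluation.intro boxq_evaluation_axioms.intro vector_space_axioms, goal_cases)
  case (2 n) then show ?case using q_not_root[of n] by (simp add: power_inverse)
next
  case (3 i j) then show ?case using linear_gen[of "1 - j" "1 - i"] by (simp add: std_gen_reflect)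
next
  case (4 j i v) then show ?case by (intro gen_inverse) simp
next
  case (5 j i k v)
  then have "q *s x (1 - k) (1 - j) (x (1 - j) (1 - i) v)
      - inverse q *s x (1 - j) (1 - i) (x (1 - k) (1 - j) v) = (q - inverse q) *s v"
    by (intro gen_weyl) auto
  then show ?case by (simp add: algebra_simps)
next
  case (6 i j v m)
  then have "x (1 - j) (1 - i) v = q powi (- m) *s v"
    by (simp add: power_int_minus power_int_inverse)
  then show ?case using gen_eigenvalue[of "1 - j" "1 - i" v "- m"] 6 by (simp add: std_gen_reflect)
next
  case (8 n)
  then have "t \<noteq> q powi (int d - 2 * int (d + 1 - n) + 1)" by (intro t_generic) auto
  also have "int d - 2 * int (d + 1 - n) + 1 = - (int d - 2 * int n + 1)" using 8 by (simp add: of_nat_diff)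
  finally show ?case unfolding power_int_minus power_int_inverse .
next
  case (9 r v) show ?case
    using gen_evaluation_dual[of "1 - r" v] q_nonzero twist_nonzero[of r]
    by (simp add: four_reflect twist_reflect)
qed (use q_nonzero t_nonzero in auto)

text \<open>
  The reflection \<open>i \<mapsto> 2 - i\<close> is \<open>i \<mapsto> 1 - i\<close> followed by a rotation, so it also inverts \<open>t\<close>.
\<close>

lemma boxq_evaluation_reflect2:
  "boxq_evaluation scale (inverse q) (inverse t) (\<lambda>i j. x (2 - j) (2 - i)) d"
proof -
  interpret r: boxq_evaluation scale q "inverse t" "\<lambda>i j. x (i + 1) (j + 1)" d
    by (rule boxq_evaluation_rotate)
  have "1 - i + 1 = 2 - i" for i :: 4 by simp
  then show ?thesis using r.boxq_evaluation_reflect by simp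
qed

text \<open>
  The instances of the evaluation relations that determine the matrices. The one for \<open>x\<^sub>0\<^sub>2\<close> is applied
  to \<open>x\<^sub>0\<^sub>2 v\<close>, which clears the inverse \<open>x\<^sub>2\<^sub>0\<close>.
\<close>

lemma evaluation_30: "x 3 0 v = x 3 1 v + (t * q) *s (v - x 2 3 (x 3 1 v))"
  using gen_evaluation[of 0 v] by (simp add: twist_def algebra_simps)

lemma evaluation_01: "x 0 1 v = x 3 1 v + inverse (t * q) *s (v - x 1 2 (x 3 1 v))"
  using gen_evaluation_dual[of 0 v] by (simp add: twist_def algebra_simps)

lemma evaluation_02: "x 2 3 (x 0 2 v) - v = (inverse t * q) *s (x 0 2 v - x 1 2 v)"
proof -
  have "x 2 0 (x 0 2 v) = v" by (rule gen_inverse) simp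
  then show ?thesis using gen_evaluation[of 3 "x 0 2 v"] by (simp add: twist_def)
qed

lemma evaluation_12: "x 1 2 v - x 1 3 v = (t * q) *s (v - x 0 1 (x 1 3 v))"
  using gen_evaluation[of 2 v] by (simp add: twist_def)

lemma evaluation_20: "x 2 3 v - x 2 0 v = (inverse t * q) *s (v - x 1 2 (x 2 0 v))"
  using gen_evaluation[of 3 v] by (simp add: twist_def)

text \<open>
  The q-Weyl relation of \<open>x\<^sub>1\<^sub>2\<close> and \<open>x\<^sub>2\<^sub>0\<close> says that \<open>q (1 - x\<^sub>1\<^sub>2 x\<^sub>2\<^sub>0) = q\<^sup>-\<^sup>1 (1 - x\<^sub>2\<^sub>0 x\<^sub>1\<^sub>2)\<close>.
\<close>

lemma evaluation_20_swapped: "x 2 3 v - x 2 0 v = (inverse t * inverse q) *s (v - x 2 0 (x 1 2 v))"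
proof -
  have "q *s x 1 2 (x 2 0 v) - inverse q *s x 2 0 (x 1 2 v) = (q - inverse q) *s v"
    by (rule gen_weyl) simp
  then have "q *s (v - x 1 2 (x 2 0 v)) = inverse q *s (v - x 2 0 (x 1 2 v))"
    by (simp add: algebra_simps)
  then have "inverse t *s q *s (v - x 1 2 (x 2 0 v)) = inverse t *s inverse q *s (v - x 2 0 (x 1 2 v))"
    by (rule arg_cong)
  then show ?thesis using evaluation_20[of v] by simp
qed

section \<open>Weyl pairs and bidiagonal actions\<close>

text \<open>
  If \<open>q A B - q\<^sup>-\<^sup>1 B A = q - q\<^sup>-\<^sup>1\<close> and \<open>B v = \<theta> v\<close>, then the defect \<open>A v - \<theta>\<^sup>-\<^sup>1 v\<close> is an eigenvector of \<open>B\<close>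
  again, with eigenvalue \<open>q\<^sup>2 \<theta>\<close>. This is why such pairs act bidiagonally on each other's
  eigenvectors.
\<close>

lemma weyl_eigen_right:
  assumes "std_gen i j" "std_gen j k" "(j - i, k - j) \<in> {(1, 1), (1, 2), (2, 1)}"
    and B: "x j k v = q powi m *s v"
  shows "x j k (x i j v - q powi (- m) *s v) = q powi (m + 2) *s (x i j v - q powi (- m) *s v)"
proof -
  have "inverse q *s x j k (x i j v) = (q * q powi m) *s x i j v - (q - inverse q) *s v"
    using gen_weyl[OF assms(3), of v] assms(1) by (simp add: B gen_hom algebra_simps)
  then have "q *s inverse q *s x j k (x i j v)
      = q *s ((q * q powi m) *s x i j v - (q - inverse q) *s v)" by simp
  then have "x j k (x i j v) = (q * q * q powi m) *s x i j v - (q * q - 1) *s v"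
    using q_nonzero by (simp add: scale_right_diff_distrib right_diff_distrib mult.assoc)
  then show ?thesis
    using assms(2) q_nonzero
    by (simp add: B gen_hom scale_right_diff_distrib power_int_add power_int_minus
        power2_eq_square algebra_simps)
qed

text \<open>
  The same fact with the roles of the two operators exchanged, obtained by reflection.
\<close>

lemma weyl_eigen_left:
  assumes "std_gen i j" "std_gen j k" "(j - i, k - j) \<in> {(1, 1), (1, 2), (2, 1)}"
    and A: "x i j v = q powi m *s v"
  shows "x i j (x j k v - q powi (- m) *s v) = q powi (m - 2) *s (x j k v - q powi (- m) *s v)"
proof -
  interpret r: boxq_evaluation scale "inverse q" t "\<lambda>i j. x (1 - j) (1 - i)" d
    by (rule boxq_evaluation_reflect)
  have "x i j v = inverse q powi (- m) *s v" using A by (simp add: power_int_minus power_int_inverse)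
  then show ?thesis
    using r.weyl_eigen_right[of "1 - k" "1 - j" "1 - i" v "- m"] assms(1-3)
    by (auto simp: std_gen_def power_int_inverse power_int_minus[symmetric])
qed

lemma gen_no_eigenvector:
  assumes "std_gen i j" "x i j v = q powi m *s v" "\<bar>m\<bar> > int d"
  shows "v = 0"
  using gen_eigenvalue[OF assms(1) _ assms(2)] assms(3) by force

text \<open>
  The sign \<open>e\<close> allows the diagonal operator to have increasing or decreasing exponents; an exponent
  outside the range of the basis forces the eigenvector, and \<open>extend_zero d v k\<close>, to be zero.
\<close>

lemma eigenvector_at:
  assumes b: "indexed_basis scale d v" and A: "Vector_Spaces.linear scale scale A"
    and e: "e \<in> {1, - 1}"
    and ev: "\<And>n. n \<le> d \<Longrightarrow> A (v n) = q powi (e * (int d - 2 * int n)) *s v n"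
    and u: "A u = q powi (e * (int d - 2 * k)) *s u"
  shows "\<exists>a. u = a *s extend_zero d v k"
proof (cases "0 \<le> k \<and> k \<le> int d")
  case True
  then obtain m where m: "k = int m" "m \<le> d" by (metis of_nat_le_iff zero_le_imp_eq_int)
  obtain a where "u = a *s v m"
    by (rule eigenvector_multiple[OF b A ev u m(2)]) (use e m in \<open>auto simp: powi_eq_iff\<close>)
  then show ?thesis using m by (auto simp: extend_zero_of_nat)
next
  case False
  have "u = 0"
    by (rule eigenvector_zero[OF b A ev u]) (use e False in \<open>auto simp: powi_eq_iff\<close>)
  then show ?thesis by (metis scale_zero_left)
qed

lemma weyl_bidiagonal_right:
  assumes b: "indexed_basis scale d v"
    and g: "std_gen i j" "std_gen j k" "(j - i, k - j) \<in> {(1, 1), (1, 2), (2, 1)}"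
    and e: "e \<in> {1, - 1}"
    and ev: "\<And>n. n \<le> d \<Longrightarrow> x j k (v n) = q powi (e * (int d - 2 * int n)) *s v n"
    and n: "n \<le> d"
  shows "\<exists>a. x i j (v n) = q powi (- (e * (int d - 2 * int n))) *s v n
    + a *s extend_zero d v (int n - e)"
proof -
  have k: "e * (int d - 2 * int n) + 2 = e * (int d - 2 * (int n - e))" using e by auto
  show ?thesis
    using eigenvector_at[OF b linear_gen[OF g(2)] e ev weyl_eigen_right[OF g ev[OF n], unfolded k]]
    by (metis add.commute diff_add_cancel)
qed

lemma weyl_bidiagonal_left:
  assumes b: "indexed_basis scale d v"
    and g: "std_gen i j" "std_gen j k" "(j - i, k - j) \<in> {(1, 1), (1, 2), (2, 1)}"
    and e: "e \<in> {1, - 1}"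
    and ev: "\<And>n. n \<le> d \<Longrightarrow> x i j (v n) = q powi (e * (int d - 2 * int n)) *s v n"
    and n: "n \<le> d"
  shows "\<exists>a. x j k (v n) = q powi (- (e * (int d - 2 * int n))) *s v n
    + a *s extend_zero d v (int n + e)"
proof -
  have k: "e * (int d - 2 * int n) - 2 = e * (int d - 2 * (int n + e))" using e by auto
  show ?thesis
    using eigenvector_at[OF b linear_gen[OF g(1)] e ev weyl_eigen_left[OF g ev[OF n], unfolded k]]
    by (metis add.commute diff_add_cancel)
qed

lemma weyl_row_sums_right:
  assumes "indexed_basis scale d v"
    and g: "std_gen i j" "std_gen j k" "(j - i, k - j) \<in> {(1, 1), (1, 2), (2, 1)}"
    and e: "e \<in> {1, - 1}"
    and "\<And>n. n \<le> d \<Longrightarrow> x j k (v n) = q powi (e * (int d - 2 * int n)) *s v n"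
    and "x i j (\<Sum>n\<le>d. v n) = \<mu> *s (\<Sum>n\<le>d. v n)" and "n \<le> d"
  shows "x i j (v n) = q powi (e * (2 * int n - int d)) *s v n
    + (\<mu> - q powi (e * (2 * (int n - e) - int d))) *s extend_zero d v (int n - e)"
proof (rule bidiagonal_by_row_sums[where \<alpha> = "\<lambda>k. q powi (e * (2 * k - int d))"])
  fix n assume "n \<le> d"
  from weyl_bidiagonal_right[OF assms(1-6) this]
  show "\<exists>a. x i j (v n) = q powi (e * (2 * int n - int d)) *s v n + a *s extend_zero d v (int n - e)"
    by (simp add: algebra_simps)
qed (use assms linear_gen in auto)

lemma weyl_row_sums_left:
  assumes "indexed_basis scale d v"
    and g: "std_gen i j" "std_gen j k" "(j - i, k - j) \<in> {(1, 1), (1, 2), (2, 1)}"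
    and e: "e \<in> {1, - 1}"
    and "\<And>n. n \<le> d \<Longrightarrow> x i j (v n) = q powi (e * (int d - 2 * int n)) *s v n"
    and "x j k (\<Sum>n\<le>d. v n) = \<mu> *s (\<Sum>n\<le>d. v n)" and "n \<le> d"
  shows "x j k (v n) = q powi (e * (2 * int n - int d)) *s v n
    + (\<mu> - q powi (e * (2 * (int n + e) - int d))) *s extend_zero d v (int n + e)"
proof -
  have "x j k (v n) = q powi (e * (2 * int n - int d)) *s v n
    + (\<mu> - q powi (e * (2 * (int n - (- e)) - int d))) *s extend_zero d v (int n - (- e))"
  proof (rule bidiagonal_by_row_sums[where \<alpha> = "\<lambda>k. q powi (e * (2 * k - int d))"])
    fix n assume "n \<le> d"
    from weyl_bidiagonal_left[OF assms(1-6) this]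
    show "\<exists>a. x j k (v n) = q powi (e * (2 * int n - int d)) *s v n + a *s extend_zero d v (int n - (- e))"
      by (simp add: algebra_simps)
  qed (use assms linear_gen in auto)
  then show ?thesis by simp
qed

section \<open>Flags, and symmetries of the bases\<close>

lemma flag0_iff: "u \<in> flag q scale x d j 0 \<longleftrightarrow> x j (j + 1) u = q powi int d *s u"
proof -
  have s: "std_gen j (j + 1)" by (simp add: std_gen_def)
  have "subspace (eigenspace scale (x j (j + 1)) (q powi int d))"
    by (rule subspaceI) (auto simp: eigenspace_def gen_hom[OF s] scale_right_distrib scale_left_commute)
  then have "span (eigenspace scale (x j (j + 1)) (q powi int d))
      = eigenspace scale (x j (j + 1)) (q powi int d)"
    by (simp add: span_eq_iff)
  moreover have "flag q scale x d j 0 = span (eigenspace scale (x j (j + 1)) (q powi int d))"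
    using s by (simp add: flag_def decomposition_def)
  ultimately have "flag q scale x d j 0 = eigenspace scale (x j (j + 1)) (q powi int d)" by simp
  then show ?thesis by (simp only: eigenspace_def mem_Collect_eq)
qed

text \<open>
  On an eigenvector of one generator for the extreme exponent, the defect of the other generator would
  be an eigenvector with exponent \<open>d + 2\<close> or \<open>- d - 2\<close>, which is outside the spectrum. So the defect
  vanishes, and a vector in component 0 of the flag \<open>[j]\<close> is an eigenvector of every generator that
  starts or ends at \<open>j\<close>.
\<close>

lemma flag0_iff_pred: "u \<in> flag q scale x d j 0 \<longleftrightarrow> x (j + 3) j u = q powi (- int d) *s u"
proof -
  have s: "std_gen j (j + 1)" "std_gen (j + 3) j" by (simp_all add: std_gen_def)
  have r: "(j - (j + 3), j + 1 - j) \<in> {(1, 1), (1, 2), (2, 1)}" by simp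
  show ?thesis unfolding flag0_iff
  proof
    assume "x j (j + 1) u = q powi int d *s u"
    from weyl_eigen_right[OF s(2,1) r this]
    show "x (j + 3) j u = q powi (- int d) *s u" using gen_no_eigenvector[OF s(1)] by force
  next
    assume "x (j + 3) j u = q powi (- int d) *s u"
    from weyl_eigen_left[OF s(2,1) r this]
    show "x j (j + 1) u = q powi int d *s u" using gen_no_eigenvector[OF s(2)] by force
  qed
qed

lemma flag0_diagonal:
  assumes "u \<in> flag q scale x d j 0"
  shows "x (j + 2) j u = q powi (- int d) *s u" "x j (j + 2) u = q powi int d *s u"
proof -
  have s: "std_gen j (j + 1)" "std_gen (j + 2) j" "std_gen j (j + 2)" by (simp_all add: std_gen_def)
  have r: "(j - (j + 2), j + 1 - j) \<in> {(1, 1), (1, 2), (2, 1)}" by simp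
  have "x j (j + 1) u = q powi int d *s u" using assms flag0_iff by blast
  from weyl_eigen_right[OF s(2,1) r this]
  show *: "x (j + 2) j u = q powi (- int d) *s u" using gen_no_eigenvector[OF s(1)] by force
  have "u = x j (j + 2) (x (j + 2) j u)" by (simp add: gen_inverse)
  also have "\<dots> = q powi (- int d) *s x j (j + 2) u" by (simp add: * gen_hom s)
  finally have "q powi int d *s u = (q powi int d * q powi (- int d)) *s x j (j + 2) u"
    by (metis scale_scale)
  moreover have "q powi int d * q powi (- int d) = 1"
    using q_nonzero by (simp add: power_int_minus)
  ultimately show "x j (j + 2) u = q powi int d *s u" by simp
qed

lemma eigenspace_inverse:
  assumes "j - i = 2"
  shows "eigenspace scale (x i j) (q powi m) = eigenspace scale (x j i) (q powi (- m))"
proof -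
  have ij: "std_gen i j" using assms by (simp add: std_gen_def)
  have "i - j = - (j - i)" by simp
  then have ji: "i - j = 2" "std_gen j i" using assms by (simp_all add: std_gen_def)
  have one: "q powi m * q powi (- m) = 1" by (rule powi_mult_eq_1) simp
  have *: "x b a v = q powi (- n) *s v" if "x a b v = q powi n *s v" "x b a (x a b v) = v" "std_gen b a"
    for a b n v
  proof -
    have "v = q powi n *s x b a v" using that by (simp add: gen_hom)
    then have "q powi (- n) *s v = (q powi (- n) * q powi n) *s x b a v" by (metis scale_scale)
    then show ?thesis using powi_mult_eq_1[of "- n" n] by simp
  qed
  have "x i j v = q powi m *s v \<longleftrightarrow> x j i v = q powi (- m) *s v" for v
    using *[OF _ gen_inverse[OF ji(1)] ji(2), of v m] *[OF _ gen_inverse[OF assms] ij, of v "- m"]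
    by auto
  then show ?thesis by (simp add: eigenspace_def)
qed

lemma decomposition_reverse:
  assumes "k \<noteq> l" "n \<le> d"
  shows "decomposition q scale x d l k (d - n) = decomposition q scale x d k l n"
proof -
  have kl: "k - l = - (l - k)" by simp
  consider "l - k = 0" | "l - k = 1" | "l - k = 2" | "l - k = 3" by (rule four_cases)
  then show ?thesis
  proof cases
    case 3
    then have "k - l = 2" unfolding kl by simp
    then show ?thesis using 3 eigenspace_inverse[OF 3, of "int d - 2 * int n"] assms
      by (simp add: decomposition_def std_gen_def of_nat_diff algebra_simps)
  next
    case 2
    then have "k - l = 3" unfolding kl by simp
    then show ?thesis using 2 assms by (simp add: decomposition_def std_gen_def)
  next
    case 4
    then have "k - l = 1" unfolding kl by simp
    then show ?thesis using 4 assms by (simp add: decomposition_def std_gen_def)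
  qed (use assms in simp)
qed

lemma ijkl_basis_indexed: "ijkl_basis q scale x d b v \<Longrightarrow> indexed_basis scale d v"
  by (auto simp: ijkl_basis_def split: prod.splits)

lemma ijkl_basis_eigen:
  assumes "ijkl_basis q scale x d (i, j, k, l) v" "std_gen k l" "n \<le> d"
  shows "x k l (v n) = q powi (int d - 2 * int n) *s v n"
  using assms by (auto simp: ijkl_basis_def decomposition_def eigenspace_def)

lemma ijkl_basis_reverse:
  assumes "ijkl_basis q scale x d (i, j, k, l) v"
  shows "ijkl_basis q scale x d (i, j, l, k) (\<lambda>n. v (d - n))"
proof -
  have kl: "l \<noteq> k" using assms by (auto simp: ijkl_basis_def)
  have "v (d - n) \<in> decomposition q scale x d l k n" if "n \<le> d" for n
  proof -
    have "v (d - n) \<in> decomposition q scale x d k l (d - n)"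
      using assms by (simp add: ijkl_basis_def)
    then show ?thesis using decomposition_reverse[OF kl that] by simp
  qed
  then show ?thesis
    using assms indexed_basis_reverse[of d v] by (auto simp: ijkl_basis_def sum_reverse)
qed

lemma decomposition_reflect:
  assumes "k \<noteq> l" "n \<le> d"
  shows "decomposition (inverse q) scale (\<lambda>i j. x (1 - j) (1 - i)) d k l n
    = decomposition q scale x d (1 - k) (1 - l) n"
proof -
  have e: "int d - 2 * int (d - n) = - (int d - 2 * int n)" using assms by (simp add: of_nat_diff)
  have "decomposition (inverse q) scale (\<lambda>i j. x (1 - j) (1 - i)) d k l n
    = decomposition q scale x d (1 - l) (1 - k) (d - n)"
    unfolding decomposition_def e powi_inverse std_gen_reflect using assms by simp
  also have "\<dots> = decomposition q scale x d (1 - k) (1 - l) n"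
    by (rule decomposition_reverse) (use assms in auto)
  finally show ?thesis .
qed

text \<open>
  The reflected module has the reflected decompositions with \<open>q\<close> inverted, hence the same components.
  Its flags are defined by the generator that arrives at \<open>1 - j\<close> instead of the one that leaves it.
\<close>

lemma ijkl_basis_reflect:
  assumes "ijkl_basis q scale x d (1 - i, 1 - j, 1 - k, 1 - l) v"
  shows "ijkl_basis (inverse q) scale (\<lambda>i j. x (1 - j) (1 - i)) d (i, j, k, l) v"
proof -
  interpret r: boxq_evaluation scale "inverse q" t "\<lambda>i j. x (1 - j) (1 - i)" d
    by (rule boxq_evaluation_reflect)
  have kl: "k \<noteq> l" using assms by (auto simp: ijkl_basis_def)
  have "1 - (j + 1) = (1 - j) + 3" by (rule four_reflect)
  then have "flag (inverse q) scale (\<lambda>i j. x (1 - j) (1 - i)) d j 0 = flag q scale x d (1 - j) 0"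
    using r.flag0_iff[of _ j] flag0_iff_pred[of _ "1 - j"] by (auto simp: powi_inverse)
  then show ?thesis
    using assms decomposition_reflect[OF kl] by (auto simp: ijkl_basis_def)
qed

end

lemma ijkl_basis_rotate:
  "ijkl_basis q scale (\<lambda>i j. x (i + c) (j + c)) d (i, j, k, l) v
    \<longleftrightarrow> ijkl_basis q scale x d (i + c, j + c, k + c, l + c) v"
proof -
  have "j + 1 + c = j + c + 1" by simp
  then show ?thesis
    by (simp only: ijkl_basis_def prod.case flag_def decomposition_def std_gen_rotate)
      (simp add: std_gen_def)
qed

context boxq_evaluation
begin

lemma ijkl_basis_reflect2:
  assumes "ijkl_basis q scale x d (2 - i, 2 - j, 2 - k, 2 - l) v"
  shows "ijkl_basis (inverse q) scale (\<lambda>i j. x (2 - j) (2 - i)) d (i, j, k, l) v"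
proof -
  interpret r: boxq_evaluation scale q "inverse t" "\<lambda>i j. x (i + 1) (j + 1)" d
    by (rule boxq_evaluation_rotate)
  have e: "1 - i + 1 = 2 - i" for i :: 4 by simp
  show ?thesis
    using r.ijkl_basis_reflect[of i j k l v] assms by (simp add: ijkl_basis_rotate e)
qed

section \<open>Bases that diagonalize a generator with index difference 1\<close>

text \<open>
  In a \<open>[0,1,2,3]\<close>-basis \<open>x\<^sub>2\<^sub>3\<close> is diagonal. The flag \<open>[1]\<close> determines \<open>x\<^sub>1\<^sub>2\<close> and \<open>x\<^sub>3\<^sub>1\<close>, and the
  evaluation relations express \<open>x\<^sub>3\<^sub>0\<close> and \<open>x\<^sub>0\<^sub>1\<close> by these three and determine \<open>x\<^sub>0\<^sub>2\<close>.
\<close>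

context
  fixes v w
  assumes basis: "ijkl_basis q scale x d (0, 1, 2, 3) v"
  defines "w \<equiv> extend_zero d v"
begin

lemma basis_0123_indexed: "indexed_basis scale d v"
  using basis by (simp add: ijkl_basis_def)

lemma basis_0123_flag: "(\<Sum>n\<le>d. v n) \<in> flag q scale x d 1 0"
  using basis by (simp add: ijkl_basis_def)

lemma basis_0123_x23: "x 2 3 (w k) = q powi (int d - 2 * k) *s w k"
  unfolding w_def
  using bidiagonal_extend[OF linear_gen[of 2 3], of 1 d v "\<lambda>k. q powi (int d - 2 * k)" "\<lambda>_. 0" k]
    ijkl_basis_eigen[OF basis] by simp

lemma basis_0123_x12:
  "x 1 2 (w k) = q powi (2 * k - int d) *s w k
     + (q powi int d - q powi (2 * k - 2 - int d)) *s w (k - 1)"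
  unfolding w_def
proof (rule bidiagonal_extend)
  fix n assume n: "n \<le> d"
  have "x 1 2 (\<Sum>n\<le>d. v n) = q powi int d *s (\<Sum>n\<le>d. v n)"
    using basis_0123_flag flag0_iff[of _ 1] by simp
  with weyl_row_sums_right[OF basis_0123_indexed, of 1 2 3 1, OF _ _ _ _ _ this n]
  show "x 1 2 (v n) = q powi (2 * int n - int d) *s v n
     + (q powi int d - q powi (2 * int n - 2 - int d)) *s extend_zero d v (int n - 1)"
    using ijkl_basis_eigen[OF basis] by (simp add: right_diff_distrib)
qed (simp_all add: linear_gen)

lemma basis_0123_x31:
  "x 3 1 (w k) = q powi (2 * k - int d) *s w k
     + (q powi (- int d) - q powi (2 * k + 2 - int d)) *s w (k + 1)"
proof -
  have "x 3 1 (w k) = q powi (2 * k - int d) *s w k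
     + (q powi (- int d) - q powi (2 * k + 2 - int d)) *s w (k - (- 1))"
    unfolding w_def
  proof (rule bidiagonal_extend)
    fix n assume n: "n \<le> d"
    have "x 3 1 (\<Sum>n\<le>d. v n) = q powi (- int d) *s (\<Sum>n\<le>d. v n)"
      using flag0_diagonal(1)[OF basis_0123_flag] by simp
    with weyl_row_sums_left[OF basis_0123_indexed, of 2 3 1 1, OF _ _ _ _ _ this n]
    show "x 3 1 (v n) = q powi (2 * int n - int d) *s v n
       + (q powi (- int d) - q powi (2 * int n + 2 - int d)) *s extend_zero d v (int n - (- 1))"
      using ijkl_basis_eigen[OF basis] by (simp add: distrib_left)
  qed (simp_all add: linear_gen)
  then show ?thesis by simp
qed

lemma basis_0123_x30:
  "x 3 0 (w k) = q powi (2 * k - int d) *s w k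
     + ((q powi (- int d) - q powi (2 * k + 2 - int d)) * (1 - t * q powi (int d - 2 * k - 1))) *s w (k + 1)"
  unfolding evaluation_30
  by (rule evaluation_lower_action[where w = w and B = "x 2 3" and C = "x 3 1"])
    (simp_all only: q_nonzero linear_gen std_gens basis_0123_x23 basis_0123_x31 not_False_eq_True)

lemma basis_0123_x01:
  "x 0 1 (w k) = (- inverse (t * q) * q powi (2 * k - int d)
        * (q powi int d - q powi (2 * k - 2 - int d))) *s w (k - 1)
    + (q powi (2 * k - int d) + inverse (t * q) * (1 - q powi (2 * k - int d) * q powi (2 * k - int d)
        - (q powi (- int d) - q powi (2 * k + 2 - int d)) * (q powi int d - q powi (2 * k - int d)))) *s w k
    + ((q powi (- int d) - q powi (2 * k + 2 - int d))
        * (1 - inverse (t * q) * q powi (2 * k + 2 - int d))) *s w (k + 1)"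
  unfolding evaluation_01
  by (rule evaluation_tridiagonal_action[where w = w and A = "x 1 2" and C = "x 3 1"])
    (simp_all only: linear_gen std_gens basis_0123_x12 basis_0123_x31)

text \<open>
  As a q-Weyl partner of \<open>x\<^sub>2\<^sub>3\<close>, the operator \<open>x\<^sub>0\<^sub>2\<close> is bidiagonal; the evaluation relation then gives its
  coefficient above the diagonal in terms of that of \<open>x\<^sub>1\<^sub>2\<close>.
\<close>

lemma basis_0123_x02:
  assumes n: "n \<le> d"
  shows "x 0 2 (v n) = q powi (2 * int n - int d) *s w (int n)
     + ((q powi int d - q powi (2 * int n - 2 - int d))
        * inverse (1 - t * q powi (int d - 2 * int n + 1))) *s w (int n - 1)"
proof -
  define E where "E = q powi int d - q powi (2 * int n - 2 - int d)"
  obtain a where a: "x 0 2 (v n) = q powi (2 * int n - int d) *s w (int n) + a *s w (int n - 1)"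
    using weyl_bidiagonal_right[OF basis_0123_indexed, of 0 2 3 1, OF _ _ _ _ _ n] ijkl_basis_eigen[OF basis] n
    by (auto simp: w_def extend_zero_of_nat)
  show ?thesis
  proof (cases "n = 0")
    case True
    then have "w (int n - 1) = 0" by (simp add: w_def extend_zero_def)
    then show ?thesis using a by simp
  next
    case False
    then have m: "n - 1 \<le> d" "int n - 1 = int (n - 1)" using n by auto
    have p: "q powi (2 * int n - int d) * q powi (int d - 2 * int n) = 1"
      by (rule powi_mult_eq_1) simp
    have vw: "v n = w (int n)" using n by (simp add: w_def extend_zero_of_nat)
    have "x 2 3 (x 0 2 (v n)) - v n
        = (a * q powi (int d - 2 * (int n - 1))) *s w (int n - 1)"
      unfolding a unfolding vw by (simp add: gen_hom basis_0123_x23 p)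
    moreover have "x 0 2 (v n) - x 1 2 (v n) = (a - E) *s w (int n - 1)"
      unfolding a unfolding vw basis_0123_x12 E_def by (simp add: algebra_simps)
    ultimately have scaled:
      "(a * q powi (int d - 2 * (int n - 1))) *s w (int n - 1) = (inverse t * q * (a - E)) *s w (int n - 1)"
      using evaluation_02[of "v n"] by (simp only: scale_scale)
    have "w (int n - 1) \<noteq> 0"
      unfolding w_def m(2) extend_zero_of_nat[OF m(1)]
      by (rule indexed_basis_nonzero[OF basis_0123_indexed m(1)])
    from scale_right_imp_eq[OF this scaled]
    have eq: "a * q powi (int d - 2 * (int n - 1)) = inverse t * q * (a - E)" .
    have "q powi (int d - 2 * (int n - 1)) = q * q powi (int d - 2 * int n + 1)"
      using q_nonzero power_int_add[of q 1 "int d - 2 * int n + 1"] by (simp add: algebra_simps)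
    with eq have "t * (a * (q * q powi (int d - 2 * int n + 1))) = t * (inverse t * q * (a - E))"
      by simp
    also have "\<dots> = q * (a - E)" using t_nonzero by simp
    finally have "q * (a * (1 - t * q powi (int d - 2 * int n + 1))) = q * E"
      by (simp add: algebra_simps)
    then have "a * (1 - t * q powi (int d - 2 * int n + 1)) = E" using q_nonzero by simp
    moreover have "1 - t * q powi (int d - 2 * int n + 1) \<noteq> 0"
      using False n by (intro t_factor_nonzero(2)) auto
    ultimately have "a = E * inverse (1 - t * q powi (int d - 2 * int n + 1))"
      by (simp add: field_simps)
    then show ?thesis using a by (simp add: E_def)
  qed
qed

lemma represents_0123:
  "represents scale d v (x 0 1) (Zmat d * Smat d (inverse q) (inverse t) * Zmat d)"
  "represents scale d v (x 1 2) (Emat d q)"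
  "represents scale d v (x 2 3) (Kmat d q)"
  "represents scale d v (x 3 0) (Zmat d * Gmat d (inverse q) t * Zmat d)"
  "represents scale d v (x 0 2) (Lmat d q t)"
  "represents scale d v (x 3 1) (Zmat d * Emat d (inverse q) * Zmat d)"
proof -
  have vw: "v n = w (int n)" if "n \<le> d" for n using that by (simp add: w_def extend_zero_of_nat)
  show "represents scale d v (x 0 1) (Zmat d * Smat d (inverse q) (inverse t) * Zmat d)"
    unfolding represents_Zmat_Smat_iff[OF q_nonzero t_nonzero] w_def[symmetric]
    by (simp add: vw basis_0123_x01)
  show "represents scale d v (x 1 2) (Emat d q)"
    unfolding represents_Emat_iff w_def[symmetric] by (simp add: vw basis_0123_x12)
  show "represents scale d v (x 2 3) (Kmat d q)"
    unfolding represents_Kmat_iff w_def[symmetric] by (simp add: vw basis_0123_x23)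
  show "represents scale d v (x 3 0) (Zmat d * Gmat d (inverse q) t * Zmat d)"
    unfolding represents_Zmat_Gmat_iff w_def[symmetric] by (simp add: vw basis_0123_x30)
  show "represents scale d v (x 3 1) (Zmat d * Emat d (inverse q) * Zmat d)"
    unfolding represents_Zmat_Emat_iff w_def[symmetric] by (simp add: vw basis_0123_x31)
  show "represents scale d v (x 0 2) (Lmat d q t)"
    unfolding represents_Lmat_iff w_def[symmetric] using basis_0123_x02 by simp
qed

end

end

section \<open>The entries of the Hessenberg matrix\<close>

text \<open>
  On and above the diagonal, the entry \<open>(i, j)\<close> of \<open>M\<close> is the product of a factor of the row, a factor of
  the column, the steps from \<open>i\<close> to \<open>j - 1\<close>, and a power of \<open>q\<close>. The four cases in the definition
  of \<open>M\<close> differ only in that the row factor is 1 for the first row and the column factor is 1 for the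
  last column.
\<close>

definition hess_row :: "nat \<Rightarrow> 'a::field \<Rightarrow> 'a \<Rightarrow> nat \<Rightarrow> 'a" where
  "hess_row d q t i =
     (if i = 0 then 1 else (1 - t * q powi (- int d - 1)) / (1 - t * q powi (2 * int i - int d - 1)))"

definition hess_col :: "nat \<Rightarrow> 'a::field \<Rightarrow> 'a \<Rightarrow> nat \<Rightarrow> 'a" where
  "hess_col d q t j =
     (if j = d then 1 else (1 - t * q powi (int d + 1)) / (1 - t * q powi (2 * int j - int d + 1)))"

definition hess_step :: "nat \<Rightarrow> 'a::field \<Rightarrow> 'a \<Rightarrow> nat \<Rightarrow> 'a" where
  "hess_step d q t k = (1 - q powi (2 * int k - 2 * int d)) / (1 - t * q powi (2 * int k - int d + 1))"

lemma qpoch_as_interval_prod: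
  assumes "q \<noteq> 0" "i \<le> j"
  shows "qpoch (a * q powi m) (q ^ 2) (j - i) = (\<Prod>k\<in>{i..<j}. 1 - a * q powi (m + 2 * (int k - int i)))"
  unfolding qpoch_def
proof (rule prod.reindex_bij_witness[of _ "\<lambda>k. k - i" "\<lambda>k. k + i"])
  fix k assume "k \<in> {..<j - i}"
  have "q powi (m + 2 * int k) = q powi m * (q ^ 2) ^ k"
    using power_int_add[of q m "2 * int k"] assms(1)
    by (simp add: power_mult[symmetric] power_int_def nat_mult_distrib)
  then show "1 - a * q powi (m + 2 * (int (k + i) - int i)) = 1 - a * q powi m * (q ^ 2) ^ k" by simp
qed (use assms in auto)

lemma Mmat_upper_entry:
  assumes "q \<noteq> 0" "i \<le> j" "j \<le> d"
  shows "Mmat d q t $$ (i, j)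
    = hess_row d q t i * hess_col d q t j * (\<Prod>k\<in>{i..<j}. hess_step d q t k) * q powi (2 * int j - int d)"
proof -
  have "(\<Prod>k\<in>{i..<j}. hess_step d q t k)
      = qpoch (q powi (2 * int i - 2 * int d)) (q ^ 2) (j - i)
        / qpoch (t * q powi (2 * int i - int d + 1)) (q ^ 2) (j - i)"
    using qpoch_as_interval_prod[OF assms(1,2), of 1 "2 * int i - 2 * int d"]
      qpoch_as_interval_prod[OF assms(1,2), of t "2 * int i - int d + 1"]
    by (simp add: hess_step_def prod_dividef algebra_simps)
  moreover have "1 / q powi (int d - 2 * int j) = q powi (2 * int j - int d)"
    using power_int_minus[of q "int d - 2 * int j"] by (simp add: field_simps)
  ultimately show ?thesis
    using assms(2,3)
    by (cases "i = 0"; cases "j = d") (simp_all add: Mmat_def hess_row_def hess_col_def algebra_simps)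
qed

context boxq_evaluation
begin

lemma hess_row_step:
  assumes "i < d"
  shows "hess_row d q t i * (1 - t * q powi (2 * int i - int d - 1))
    = (1 - t * q powi (2 * int i - int d + 1)) * hess_row d q t (Suc i)"
proof -
  have e: "2 * int (Suc i) - int d - 1 = 2 * int i - int d + 1" by simp
  have l: "hess_row d q t i * (1 - t * q powi (2 * int i - int d - 1)) = 1 - t * q powi (- int d - 1)"
    using t_factor_nonzero(1)[of "int i"] assms by (cases "i = 0") (auto simp: hess_row_def)
  have "(1 - t * q powi (2 * int i - int d + 1)) * hess_row d q t (Suc i) = 1 - t * q powi (- int d - 1)"
    unfolding hess_row_def e using t_factor_below[OF assms] by simp
  then show ?thesis using l by simp
qed

lemma hess_col_step:
  assumes "j < d"
  shows "hess_col d q t (Suc j) * (1 - t * q powi (2 * int j - int d + 3))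
    = hess_col d q t j * (1 - t * q powi (2 * int j - int d + 1))"
proof -
  have e: "2 * int (Suc j) - int d + 1 = 2 * int j - int d + 3" by simp
  have l: "hess_col d q t j * (1 - t * q powi (2 * int j - int d + 1)) = 1 - t * q powi (int d + 1)"
    using t_factor_below[OF assms] assms by (simp add: hess_col_def)
  have "hess_col d q t (Suc j) * (1 - t * q powi (2 * int j - int d + 3)) = 1 - t * q powi (int d + 1)"
  proof (cases "Suc j = d")
    case True
    then have e3: "2 * int j - int d + 3 = int d + 1" by auto
    show ?thesis unfolding e3 using True by (simp add: hess_col_def)
  next
    case False
    then have "1 - t * q powi (2 * int j - int d + 3) \<noteq> 0"
      using t_factor_below[of "Suc j"] assms by (simp only: e) simp
    then show ?thesis using False unfolding hess_col_def e by simp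
  qed
  then show ?thesis using l by simp
qed

text \<open>
  Neighbouring entries in a column, and in a row, have a simple ratio, because the quotient of the
  row or column factors cancels the denominator of one step. Both statements are kept free of
  divisions, as \<open>1 - t q\<^sup>d\<^sup>+\<^sup>1\<close> and \<open>1 - t q\<^sup>-\<^sup>d\<^sup>-\<^sup>1\<close> may vanish.
\<close>

lemma Mmat_row_step:
  assumes "i < j" "j \<le> d"
  shows "Mmat d q t $$ (i, j) * (1 - t * q powi (2 * int i - int d - 1))
    = (1 - q powi (2 * int i - 2 * int d)) * Mmat d q t $$ (Suc i, j)"
proof -
  have step: "(1 - t * q powi (2 * int i - int d + 1)) * hess_step d q t i = 1 - q powi (2 * int i - 2 * int d)"
    using t_factor_below[of i] assms by (simp add: hess_step_def)
  have pr: "(\<Prod>k\<in>{i..<j}. hess_step d q t k) = hess_step d q t i * (\<Prod>k\<in>{Suc i..<j}. hess_step d q t k)"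
    using assms(1) by (rule prod.atLeast_Suc_lessThan)
  have "Mmat d q t $$ (i, j) * (1 - t * q powi (2 * int i - int d - 1))
     = (hess_row d q t i * (1 - t * q powi (2 * int i - int d - 1))) * hess_step d q t i
       * (hess_col d q t j * (\<Prod>k\<in>{Suc i..<j}. hess_step d q t k) * q powi (2 * int j - int d))"
    using assms by (subst Mmat_upper_entry[OF q_nonzero]) (simp_all add: pr mult_ac)
  also have "\<dots> = ((1 - t * q powi (2 * int i - int d + 1)) * hess_step d q t i) * hess_row d q t (Suc i)
       * (hess_col d q t j * (\<Prod>k\<in>{Suc i..<j}. hess_step d q t k) * q powi (2 * int j - int d))"
    using assms by (subst hess_row_step) (simp_all add: mult_ac)
  also have "\<dots> = (1 - q powi (2 * int i - 2 * int d)) * Mmat d q t $$ (Suc i, j)"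
    using assms by (subst step, subst Mmat_upper_entry[OF q_nonzero]) (simp_all add: mult_ac)
  finally show ?thesis .
qed

lemma Mmat_col_step:
  assumes "i \<le> j" "j < d"
  shows "Mmat d q t $$ (i, Suc j) * (1 - t * q powi (2 * int j - int d + 3))
    = q\<^sup>2 * (1 - q powi (2 * int j - 2 * int d)) * Mmat d q t $$ (i, j)"
proof -
  have step: "(1 - t * q powi (2 * int j - int d + 1)) * hess_step d q t j = 1 - q powi (2 * int j - 2 * int d)"
    using t_factor_below[of j] assms by (simp add: hess_step_def)
  have pr: "(\<Prod>k\<in>{i..<Suc j}. hess_step d q t k) = (\<Prod>k\<in>{i..<j}. hess_step d q t k) * hess_step d q t j"
    using assms(1) by (rule prod.atLeastLessThan_Suc)
  have pw: "q powi (2 * int (Suc j) - int d) = q\<^sup>2 * q powi (2 * int j - int d)"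
    using powi_plus[of 2 "2 * int j - int d"] by (simp add: algebra_simps)
  have "Mmat d q t $$ (i, Suc j) * (1 - t * q powi (2 * int j - int d + 3))
     = (hess_col d q t (Suc j) * (1 - t * q powi (2 * int j - int d + 3))) * hess_step d q t j
       * (hess_row d q t i * (\<Prod>k\<in>{i..<j}. hess_step d q t k) * (q\<^sup>2 * q powi (2 * int j - int d)))"
    using assms unfolding pw[symmetric]
    by (subst Mmat_upper_entry[OF q_nonzero]) (simp_all only: pr mult_ac le_SucI Suc_leI)
  also have "\<dots> = ((1 - t * q powi (2 * int j - int d + 1)) * hess_step d q t j) * hess_col d q t j
       * (hess_row d q t i * (\<Prod>k\<in>{i..<j}. hess_step d q t k) * (q\<^sup>2 * q powi (2 * int j - int d)))"
    using assms by (subst hess_col_step) (simp_all only: mult_ac)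
  also have "\<dots> = q\<^sup>2 * (1 - q powi (2 * int j - 2 * int d)) * Mmat d q t $$ (i, j)"
    using assms by (subst step, subst Mmat_upper_entry[OF q_nonzero]) (simp_all add: mult_ac)
  finally show ?thesis .
qed

lemma Mmat_diag:
  "j \<le> d \<Longrightarrow> Mmat d q t $$ (j, j) = hess_row d q t j * hess_col d q t j * q powi (2 * int j - int d)"
  by (subst Mmat_upper_entry[OF q_nonzero]) auto

lemma Mmat_subdiag:
  assumes "1 \<le> i" "i \<le> d"
  shows "Mmat d q t $$ (i, i - 1) * (1 - t * q powi (2 * int i - int d - 1))
    = t * (inverse q - q powi (2 * int i - 1))"
proof -
  have nz: "1 - t * q powi (2 * int i - int d - 1) \<noteq> 0" using t_factor_nonzero(1)[of "int i"] assms by simp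
  have "inverse t - q powi (2 * int i - int d - 1) = (1 - t * q powi (2 * int i - int d - 1)) / t"
    using t_nonzero by (simp add: field_simps)
  then show ?thesis using assms nz t_nonzero by (simp add: Mmat_def)
qed

text \<open>
  Below the top row, \<open>M\<close> solves the linear recursion that expresses each row by the next one; it is
  the recursion that the evaluation relation imposes on the matrix of \<open>x\<^sub>2\<^sub>0\<close>.
\<close>

lemma Mmat_row_recursion:
  assumes "1 \<le> i" "i \<le> d" "j \<le> d"
  shows "Mmat d q t $$ (i, j) * (1 - t * q powi (2 * int i - int d - 1))
    = (if i = j then q powi (2 * int i - int d) - t * inverse q else 0)
      + (if i = j + 1 then t * (inverse q - q powi (2 * int i - 1)) else 0)
      + (if i < d then (1 - q powi (2 * int i - 2 * int d)) * Mmat d q t $$ (Suc i, j) else 0)"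
proof -
  consider "i < j" | "i = j" "i < d" | "i = j" "i = d" | "i = j + 1" | "i > j + 1"
    using assms by linarith
  then show ?thesis
  proof cases
    case 1
    then show ?thesis using Mmat_row_step[of i j] assms by simp
  next
    case 2
    define y D where "y = q powi (2 * int i - int d)" and "D = q powi int d"
    have D: "D \<noteq> 0" by (simp add: D_def q_nonzero)
    have p1: "q powi (- int d - 1) = inverse (D * q)"
      using powi_plus[of "- int d" "- 1"] by (simp add: D_def power_int_minus)
    have p: "q powi (int d + 1) = D * q" "q powi (- int d - 1) = inverse (D * q)"
      "q powi (2 * int i - int d + 1) = y * q" "q powi (2 * int i - int d - 1) = y * inverse q"
      "q powi (2 * int i - 2 * int d) = y * inverse D" "q powi (2 * int (Suc i) - 1) = y * D * q"
      "q powi (2 * int (Suc i) - int d - 1) = y * q"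
      using powi_plus[of "2 * int i - int d" 1] powi_plus[of "2 * int i - int d" "- 1"]
        powi_plus[of "2 * int i - int d" "- int d"]
        powi_plus[of "2 * int i - int d" "int d + 1"] powi_plus[of "int d" 1]
      by (simp_all only: p1) (simp_all add: y_def D_def power_int_minus algebra_simps)
    have "1 - t * q powi (2 * int i - int d - 1) \<noteq> 0"
      by (rule t_factor_nonzero(1)) (use assms in simp_all)
    moreover have "1 - t * q powi (2 * int i - int d + 1) \<noteq> 0"
      by (rule t_factor_below) (use 2 in simp)
    ultimately have nz: "1 - t * (y * inverse q) \<noteq> 0" "1 - t * (y * q) \<noteq> 0" unfolding p .
    have diag: "Mmat d q t $$ (i, i) * (1 - t * (y * inverse q))
        = (1 - t * inverse (D * q)) * (1 - t * (D * q)) / (1 - t * (y * q)) * y"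
      using 2(2) assms Mmat_diag[of i] nz(1) by (simp add: hess_row_def hess_col_def p y_def[symmetric])
    have sub: "Mmat d q t $$ (Suc i, i) = t * (inverse q - y * D * q) / (1 - t * (y * q))"
      using Mmat_subdiag[of "Suc i"] 2(2) nz(2) unfolding p by (simp add: field_simps)
    have "(1 - t * inverse (D * q)) * (1 - t * (D * q)) * y
        = (y - t * inverse q) * (1 - t * (y * q)) + (1 - y * inverse D) * (t * (inverse q - y * D * q))"
      using D q_nonzero by (simp add: field_simps)
    then have "(1 - t * inverse (D * q)) * (1 - t * (D * q)) / (1 - t * (y * q)) * y
        = y - t * inverse q + (1 - y * inverse D) * (t * (inverse q - y * D * q) / (1 - t * (y * q)))"
      using nz(2) by (simp add: divide_simps)
    then show ?thesis
      unfolding 2(1)[symmetric] p y_def[symmetric] using diag sub 2(2) by simp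
  next
    case 3
    have "1 - t * q powi (int d - 1) \<noteq> 0"
      using t_factor_nonzero(1)[of "int d"] 3 assms by simp
    moreover have "Mmat d q t $$ (d, d)
        = (1 - t * q powi (- int d - 1)) / (1 - t * q powi (int d - 1)) * q powi int d"
      using 3 assms Mmat_diag[of d] by (simp add: hess_row_def hess_col_def)
    ultimately have "Mmat d q t $$ (d, d) * (1 - t * q powi (int d - 1))
        = (1 - t * q powi (- int d - 1)) * q powi int d" by simp
    also have "\<dots> = q powi int d - t * inverse q"
      using powi_plus[of "- int d - 1" "int d"] by (simp add: left_diff_distrib power_int_minus)
    finally show ?thesis using 3 by simp
  next
    case 4
    then show ?thesis using Mmat_subdiag[of i] assms by (simp add: Mmat_def)
  next
    case 5
    then show ?thesis using assms by (simp add: Mmat_def)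
  qed
qed

lemma Mmat_top_left:
  assumes "d \<ge> 1"
  shows "Mmat d q t $$ (0, 0) * (1 - t * q powi (1 - int d)) = q powi (- int d) - t * q"
proof -
  have "1 - t * q powi (1 - int d) \<noteq> 0" using t_factor_below[of 0] assms by (simp add: algebra_simps)
  moreover have "Mmat d q t $$ (0, 0)
      = (1 - t * q powi (int d + 1)) / (1 - t * q powi (1 - int d)) * q powi (- int d)"
    using assms Mmat_diag[of 0] by (simp add: hess_row_def hess_col_def add.commute)
  ultimately have "Mmat d q t $$ (0, 0) * (1 - t * q powi (1 - int d))
      = (1 - t * q powi (int d + 1)) * q powi (- int d)" by simp
  also have "\<dots> = q powi (- int d) - t * q"
    using powi_plus[of "int d + 1" "- int d"] by (simp add: algebra_simps)
  finally show ?thesis .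
qed

text \<open>
  Inverting both parameters conjugates \<open>M\<close> by a diagonal matrix. This mirrors the fact that the
  reversed and rescaled \<open>[0,2,1,3]\<close>-basis is a \<open>[2,0,3,1]\<close>-basis.
\<close>

lemma Mmat_inverse_params:
  assumes "i \<le> d" "j \<le> d"
  shows "Mmat d (inverse q) (inverse t) $$ (i, j)
    = (t * q powi (int d - 1)) powi (int j - int i) * Mmat d q t $$ (i, j)"
proof -
  define c where "c = t * q powi (int d - 1)"
  have c0: "c \<noteq> 0" using t_nonzero q_nonzero by (simp add: c_def)
  have flip: "1 - inverse t * q powi (- m) = - (1 - t * q powi m) * (inverse t * q powi (- m))" for m
    using t_nonzero powi_mult_eq_1[of m "- m"] by (simp add: algebra_simps)
  have neg: "(- A * X) / (- B * Y) = (X / Y) * (A / B)" for A B X Y :: 'a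
    by (simp add: mult.commute)
  have flip_quot: "(1 - inverse t * q powi (- m)) / (1 - inverse t * q powi (- n))
      = q powi (n - m) * ((1 - t * q powi m) / (1 - t * q powi n))" for m n
  proof -
    have "q powi (- m) / q powi (- n) = q powi (n - m)"
      using power_int_diff[of q "- m" "- n"] q_nonzero by simp
    then have "(inverse t * q powi (- m)) / (inverse t * q powi (- n)) = q powi (n - m)"
      using t_nonzero by simp
    then show ?thesis unfolding flip neg by (simp only:)
  qed
  consider "i > j + 1" | "i = j + 1" | "i \<le> j" by linarith
  then show ?thesis
  proof cases
    case 1
    then show ?thesis using assms by (simp add: Mmat_def)
  next
    case 2
    define y E where "y = q powi (2 * int i - int d - 1)" and "E = q powi (int d - 1)"
    have nz: "y \<noteq> 0" "E \<noteq> 0" "1 - t * y \<noteq> 0" "t * y - 1 \<noteq> 0"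
      using q_nonzero t_factor_nonzero(1)[of "int i"] 2 assms by (auto simp: y_def E_def)
    have p: "q powi (2 * int i - 1) = y * q * E" "q powi (- (2 * int i - 1)) = inverse (y * q * E)"
      "q powi (- (2 * int i - int d - 1)) = inverse y"
      using powi_plus[of "2 * int i - int d - 1" "int d - 1 + 1"] powi_plus[of "int d - 1" 1]
      unfolding power_int_minus by (simp_all add: y_def E_def mult_ac)
    have pi: "c powi (int j - int i) = inverse (t * E)"
      using 2 by (simp add: c_def E_def power_int_minus)
    have "Mmat d (inverse q) (inverse t) $$ (i, j)
        = (q - q powi (- (2 * int i - 1))) / (t - q powi (- (2 * int i - int d - 1)))"
      using 2 assms by (simp add: Mmat_def powi_inverse)
    also have "\<dots> = inverse (t * E) * ((inverse q - y * q * E) / (inverse t - y))"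
      unfolding p using nz q_nonzero t_nonzero by (simp add: divide_simps) (simp add: algebra_simps)
    also have "(inverse q - y * q * E) / (inverse t - y) = Mmat d q t $$ (i, j)"
      unfolding p(1)[symmetric] unfolding y_def using 2 assms by (simp add: Mmat_def)
    finally show ?thesis unfolding c_def[symmetric] pi .
  next
    case 3
    have row: "hess_row d (inverse q) (inverse t) i = q powi (2 * int i) * hess_row d q t i"
      using flip_quot[of "- int d - 1" "2 * int i - int d - 1"] by (simp add: hess_row_def powi_inverse)
    have col: "hess_col d (inverse q) (inverse t) j = q powi (2 * int j - 2 * int d) * hess_col d q t j"
      using flip_quot[of "int d + 1" "2 * int j - int d + 1"] by (simp add: hess_col_def powi_inverse)
    have step: "hess_step d (inverse q) (inverse t) k = (c * q\<^sup>2) * hess_step d q t k" for k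
    proof -
      have n: "1 - q powi (- (2 * int k - 2 * int d))
          = - (1 - q powi (2 * int k - 2 * int d)) * q powi (- (2 * int k - 2 * int d))"
        using powi_mult_eq_1[of "2 * int k - 2 * int d" "- (2 * int k - 2 * int d)"]
        by (simp add: algebra_simps)
      have e: "q powi (- (2 * int k - 2 * int d)) = q powi (int d - 1) * q\<^sup>2 * q powi (- (2 * int k - int d + 1))"
        using powi_plus[of "int d - 1" 2] powi_plus[of "int d + 1" "- (2 * int k - int d + 1)"]
        by (simp add: algebra_simps)
      have "hess_step d (inverse q) (inverse t) k
          = (1 - q powi (- (2 * int k - 2 * int d))) / (1 - inverse t * q powi (- (2 * int k - int d + 1)))"
        by (simp only: hess_step_def powi_inverse)
      also have "\<dots> = (c * q\<^sup>2) * hess_step d q t k"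
        unfolding n flip neg unfolding e hess_step_def c_def using t_nonzero q_nonzero by (simp add: divide_inverse mult_ac)
      finally show ?thesis .
    qed
    have pr: "(\<Prod>k\<in>{i..<j}. hess_step d (inverse q) (inverse t) k)
        = c powi (int j - int i) * q powi (2 * int j - 2 * int i) * (\<Prod>k\<in>{i..<j}. hess_step d q t k)"
    proof -
      have ji: "int j - int i = int (j - i)" "2 * int j - 2 * int i = int (2 * (j - i))"
        using 3 by auto
      show ?thesis unfolding step prod.distrib ji power_int_of_nat
        by (simp add: power_mult_distrib power_mult)
    qed
    have "q powi (2 * int i) * q powi (2 * int j - 2 * int d) * q powi (2 * int j - 2 * int i)
        * q powi (- (2 * int j - int d)) = q powi (2 * int j - int d)"
      unfolding powi_plus[symmetric] by (simp add: algebra_simps)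
    then show ?thesis
      unfolding c_def[symmetric] Mmat_upper_entry[OF q_nonzero 3 assms(2)]
        Mmat_upper_entry[OF inverse_nonzero_q 3 assms(2)] row col pr powi_inverse
      by (metis (no_types, opaque_lifting) mult.assoc mult.commute mult.left_commute)
  qed
qed

section \<open>Bases that diagonalize a generator with index difference 2\<close>

text \<open>
  In a \<open>[0,2,1,3]\<close>-basis \<open>x\<^sub>1\<^sub>3\<close> is diagonal and \<open>x\<^sub>3\<^sub>1\<close> is its inverse. The flag \<open>[2]\<close> determines \<open>x\<^sub>1\<^sub>2\<close>
  and \<open>x\<^sub>2\<^sub>3\<close>, and from these the evaluation relations give \<open>x\<^sub>0\<^sub>1\<close>, \<open>x\<^sub>3\<^sub>0\<close> and \<open>x\<^sub>2\<^sub>0\<close>.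
\<close>

context
  fixes v w
  assumes basis: "ijkl_basis q scale x d (0, 2, 1, 3) v"
  defines "w \<equiv> extend_zero d v"
begin

lemma basis_0213_indexed: "indexed_basis scale d v"
  using basis by (simp add: ijkl_basis_def)

lemma basis_0213_flag: "(\<Sum>n\<le>d. v n) \<in> flag q scale x d 2 0"
  using basis by (simp add: ijkl_basis_def)

lemma basis_0213_x13: "x 1 3 (w k) = q powi (int d - 2 * k) *s w k"
  unfolding w_def
  using bidiagonal_extend[OF linear_gen[of 1 3], of 1 d v "\<lambda>k. q powi (int d - 2 * k)" "\<lambda>_. 0" k]
    ijkl_basis_eigen[OF basis] by simp

lemma basis_0213_x31: "x 3 1 (w k) = q powi (2 * k - int d) *s w k"
proof -
  have "x 3 1 (x 1 3 (w k)) = w k" by (rule gen_inverse) simp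
  then have "q powi (2 * k - int d) *s q powi (int d - 2 * k) *s x 3 1 (w k) = q powi (2 * k - int d) *s w k"
    by (simp only: basis_0213_x13 gen_hom std_gens)
  then show ?thesis using powi_mult_eq_1[of "2 * k - int d" "int d - 2 * k"] by simp
qed

lemma basis_0213_x31_eigen: "n \<le> d \<Longrightarrow> x 3 1 (v n) = q powi (- 1 * (int d - 2 * int n)) *s v n"
  using basis_0213_x31[of "int n"] by (simp add: w_def extend_zero_of_nat)

lemma basis_0213_x12:
  "x 1 2 (w k) = q powi (int d - 2 * k) *s w k
     + (q powi (- int d) - q powi (int d - 2 * k + 2)) *s w (k - 1)"
  unfolding w_def
proof (rule bidiagonal_extend)
  fix n assume n: "n \<le> d"
  have "x 1 2 (\<Sum>n\<le>d. v n) = q powi (- int d) *s (\<Sum>n\<le>d. v n)"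
    using basis_0213_flag flag0_iff_pred[of _ 2] by simp
  with weyl_row_sums_left[OF basis_0213_indexed, of 3 1 2 "- 1", OF _ _ _ _ basis_0213_x31_eigen this n]
  show "x 1 2 (v n) = q powi (int d - 2 * int n) *s v n
     + (q powi (- int d) - q powi (int d - 2 * int n + 2)) *s extend_zero d v (int n - 1)"
    by (simp add: algebra_simps)
qed (simp_all add: linear_gen)

lemma basis_0213_x23:
  "x 2 3 (w k) = q powi (int d - 2 * k) *s w k
     + (q powi int d - q powi (int d - 2 * k - 2)) *s w (k + 1)"
proof -
  have "x 2 3 (w k) = q powi (int d - 2 * k) *s w k
     + (q powi int d - q powi (int d - 2 * k - 2)) *s w (k - (- 1))"
    unfolding w_def
  proof (rule bidiagonal_extend)
    fix n assume n: "n \<le> d"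
    have "x 2 3 (\<Sum>n\<le>d. v n) = q powi int d *s (\<Sum>n\<le>d. v n)"
      using basis_0213_flag flag0_iff[of _ 2] by simp
    with weyl_row_sums_right[OF basis_0213_indexed, of 2 3 1 "- 1", OF _ _ _ _ basis_0213_x31_eigen this n]
    show "x 2 3 (v n) = q powi (int d - 2 * int n) *s v n
       + (q powi int d - q powi (int d - 2 * int n - 2)) *s extend_zero d v (int n - (- 1))"
      by (simp add: algebra_simps)
  qed (simp_all add: linear_gen)
  then show ?thesis by simp
qed

lemma basis_0213_x01:
  "x 0 1 (w k) = q powi (2 * k - int d) *s w k
     + ((q powi int d - q powi (2 * k - 2 - int d)) * q powi (1 - int d) * inverse t) *s w (k - 1)"
proof -
  define y where "y = q powi (2 * k - int d)"
  define u where "u = q powi (- int d) - q powi (int d - 2 * k + 2)"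
  have y: "y * q powi (int d - 2 * k) = 1" unfolding y_def by (rule powi_mult_eq_1) simp
  have "(t * q) *s (w k - q powi (int d - 2 * k) *s x 0 1 (w k)) = u *s w (k - 1)"
    using evaluation_12[of "w k"] by (simp add: basis_0213_x12 basis_0213_x13 gen_hom u_def)
  then have "inverse (t * q) *s (t * q) *s (w k - q powi (int d - 2 * k) *s x 0 1 (w k))
      = inverse (t * q) *s u *s w (k - 1)" by (rule arg_cong)
  moreover have "inverse (t * q) * (t * q) = 1"
    using q_nonzero t_nonzero by (intro left_inverse) simp
  ultimately have "w k - q powi (int d - 2 * k) *s x 0 1 (w k) = (inverse (t * q) * u) *s w (k - 1)"
    by (simp only: scale_scale scale_one)
  then have "q powi (int d - 2 * k) *s x 0 1 (w k) = w k - (inverse (t * q) * u) *s w (k - 1)"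
    by (metis add_diff_cancel_left' diff_add_cancel)
  then have "y *s q powi (int d - 2 * k) *s x 0 1 (w k) = y *s (w k - (inverse (t * q) * u) *s w (k - 1))"
    by (rule arg_cong)
  then have *: "x 0 1 (w k) = y *s w k + (- (y * inverse (t * q) * u)) *s w (k - 1)"
    unfolding scale_scale y scale_one scale_right_diff_distrib by (simp add: mult.assoc)
  have "y * u = q powi (2 * k - 2 * int d) - q * q"
    using powi_plus[of "2 * k - int d" "- int d"] powi_plus[of "2 * k - int d" "int d - 2 * k + 2"]
    by (simp add: y_def u_def right_diff_distrib power2_eq_square)
  moreover have "(q powi int d - q powi (2 * k - 2 - int d)) * q powi (1 - int d)
      = q - inverse q * q powi (2 * k - 2 * int d)"
    using powi_plus[of "int d" "1 - int d"] powi_plus[of "2 * k - 2 - int d" "1 - int d"]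
      powi_plus[of "- 1" "2 * k - 2 * int d"]
    by (simp add: left_diff_distrib power_int_minus)
  moreover have "- (y * inverse (t * q) * u) = - (y * u) * inverse q * inverse t" by simp
  moreover have "- (X - q * q) * inverse q = q - inverse q * X" for X
    using q_nonzero by (simp add: field_simps)
  ultimately have "- (y * inverse (t * q) * u)
      = (q powi int d - q powi (2 * k - 2 - int d)) * q powi (1 - int d) * inverse t"
    by simp
  then show ?thesis unfolding * y_def by simp
qed

lemma basis_0213_x30:
  "x 3 0 (w k) = q powi (2 * k - int d) *s w k
     + ((q powi (- int d) - q powi (2 * k + 2 - int d)) * q powi (int d - 1) * t) *s w (k + 1)"
proof -
  have p: "q powi (2 * k - int d) * q powi (int d - 2 * k) = 1"
    by (rule powi_mult_eq_1) simp
  have e: "q * q powi (2 * k - int d) * q powi int d = q powi (2 * k + 1)"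
    "q * q powi (2 * k - int d) * q powi (int d - 2 * k - 2) = inverse q"
    "q powi (- int d) * q powi (int d - 1) = inverse q"
    "q powi (2 * k + 2 - int d) * q powi (int d - 1) = q powi (2 * k + 1)"
    using powi_plus[of "2 * k - int d" "int d"] powi_plus[of 1 "2 * k"]
      powi_plus[of "2 * k - int d" "int d - 2 * k - 2"] powi_plus[of 1 "- 2"]
      powi_plus[of "- int d" "int d - 1"] powi_plus[of "2 * k + 2 - int d" "int d - 1"]
    by (simp_all add: mult.assoc power_int_minus add.commute)
  have "(q powi (- int d) - q powi (2 * k + 2 - int d)) * q powi (int d - 1) * t
      = - t * (q * q powi (2 * k - int d) * q powi int d
      - q * q powi (2 * k - int d) * q powi (int d - 2 * k - 2))"
    unfolding left_diff_distrib e by (simp add: algebra_simps)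
  then have coeff: "(q powi (- int d) - q powi (2 * k + 2 - int d)) * q powi (int d - 1) * t
      = - (t * q * q powi (2 * k - int d) * (q powi int d - q powi (int d - 2 * k - 2)))"
    by (simp add: right_diff_distrib mult.assoc)
  show ?thesis
    unfolding evaluation_30[of "w k"] basis_0213_x31 coeff
    by (simp add: gen_hom basis_0213_x23 scale_right_distrib scale_right_diff_distrib p)
qed

lemma represents_0213:
  "represents scale d v (x 0 1) (Fmat d q (inverse t))"
  "represents scale d v (x 1 2) (Emat d (inverse q))"
  "represents scale d v (x 2 3) (Zmat d * Emat d q * Zmat d)"
  "represents scale d v (x 3 0) (Zmat d * Fmat d (inverse q) t * Zmat d)"
  "represents scale d v (x 1 3) (Kmat d q)"
  "represents scale d v (x 3 1) (Kmat d (inverse q))"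
proof -
  have vw: "v n = w (int n)" if "n \<le> d" for n using that by (simp add: w_def extend_zero_of_nat)
  note actions = basis_0213_x01 basis_0213_x12 basis_0213_x13 basis_0213_x31 basis_0213_x30
    basis_0213_x23
  show "represents scale d v (x 0 1) (Fmat d q (inverse t))"
    unfolding represents_Fmat_iff w_def[symmetric] by (simp add: vw actions)
  show "represents scale d v (x 1 2) (Emat d (inverse q))"
    unfolding represents_Emat_iff powi_inverse w_def[symmetric] by (simp add: vw actions algebra_simps)
  show "represents scale d v (x 2 3) (Zmat d * Emat d q * Zmat d)"
    using represents_Zmat_Emat_iff[of d v "x 2 3" "inverse q"]
    unfolding powi_inverse w_def[symmetric] by (simp add: vw actions algebra_simps)
  show "represents scale d v (x 3 0) (Zmat d * Fmat d (inverse q) t * Zmat d)"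
    unfolding represents_Zmat_Fmat_iff w_def[symmetric] by (simp add: vw actions)
  show "represents scale d v (x 1 3) (Kmat d q)"
    unfolding represents_Kmat_iff w_def[symmetric] by (simp add: vw actions)
  show "represents scale d v (x 3 1) (Kmat d (inverse q))"
    unfolding represents_Kmat_iff powi_inverse w_def[symmetric] by (simp add: vw actions)
qed

text \<open>
  The two forms of the evaluation relation between \<open>x\<^sub>2\<^sub>3\<close> and \<open>x\<^sub>2\<^sub>0\<close>, read off entry by entry. The first
  links neighbouring rows and the second neighbouring columns.
\<close>

lemma basis_0213_x20_entries:
  assumes N: "represents scale d v (x 2 0) N" and ij: "i \<le> d" "j \<le> d"
  defines "L \<equiv> (if i = j then q powi (int d - 2 * int j) else 0)
    + (if i = j + 1 then q powi int d - q powi (int d - 2 * int j - 2) else 0)"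
  shows "L - N $$ (i, j) = inverse t * q * ((if i = j then 1 else 0)
      - (q powi (int d - 2 * int i) * N $$ (i, j)
        + (if i < d then (q powi (- int d) - q powi (int d - 2 * int i)) * N $$ (Suc i, j) else 0)))"
    and "L - N $$ (i, j) = inverse t * inverse q * ((if i = j then 1 else 0)
      - (q powi (int d - 2 * int j) * N $$ (i, j)
        + (if 1 \<le> j then (q powi (- int d) - q powi (int d - 2 * int j + 2)) * N $$ (i, j - 1) else 0)))"
proof -
  note b = basis_0213_indexed
  define a where "a i = q powi (int d - 2 * int i)" for i
  define u where "u i = q powi (- int d) - q powi (int d - 2 * int i + 2)" for i
  have vw: "w (int i) = v i" if "i \<le> d" for i using that by (simp add: w_def extend_zero_of_nat)
  have vj: "v j = (\<Sum>i\<le>d. (if i = j then 1 else 0) *s v i)"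
  proof -
    have "(\<Sum>i\<le>d. (if i = j then 1 else 0) *s v i) = (\<Sum>i\<le>d. if i = j then v i else 0)"
      by (rule sum.cong) auto
    then show ?thesis using ij by simp
  qed
  have x20: "x 2 0 (v n) = (\<Sum>i\<le>d. N $$ (i, n) *s v i)" if "n \<le> d" for n
    using N that by (simp add: represents_def)
  have x23: "x 2 3 (v j) = (\<Sum>i\<le>d. ((if i = j then q powi (int d - 2 * int j) else 0)
      + (if i = j + 1 then q powi int d - q powi (int d - 2 * int j - 2) else 0)) *s v i)"
  proof -
    have "(\<Sum>i\<le>d. ((if i = j then q powi (int d - 2 * int j) else 0)
      + (if i = j + 1 then q powi int d - q powi (int d - 2 * int j - 2) else 0)) *s v i)
      = 0 *s w (int j - 1) + q powi (int d - 2 * int j) *s w (int j)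
        + (q powi int d - q powi (int d - 2 * int j - 2)) *s w (int j + 1)"
      unfolding w_def by (rule sum_tridiagonal) (use ij in auto)
    then show ?thesis using basis_0213_x23[of "int j"] ij by (simp add: vw)
  qed
  have "x 1 2 (x 2 0 (v j)) = (\<Sum>i\<le>d. N $$ (i, j) *s x 1 2 (v i))"
    unfolding x20[OF ij(2)] by (rule linear_indexed_sum) (simp add: linear_gen)
  also have "\<dots> = (\<Sum>i\<le>d. (a i * N $$ (i, j)) *s v i + (u i * N $$ (i, j)) *s w (int i - 1))"
    by (rule sum.cong) (use basis_0213_x12 in \<open>simp_all add: vw[symmetric] a_def u_def
      scale_right_distrib mult.commute\<close>)
  also have "\<dots> = (\<Sum>i\<le>d. (a i * N $$ (i, j) + (if i < d then u (Suc i) * N $$ (Suc i, j) else 0)) *s v i)"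
    unfolding w_def scale_left_distrib sum.distrib by (subst sum_shift_down) simp
  finally have x12x20: "x 1 2 (x 2 0 (v j))
      = (\<Sum>i\<le>d. (a i * N $$ (i, j) + (if i < d then u (Suc i) * N $$ (Suc i, j) else 0)) *s v i)" .
  have "x 2 0 (x 1 2 (v j)) = a j *s x 2 0 (v j) + u j *s x 2 0 (w (int j - 1))"
    using basis_0213_x12[of "int j"] ij by (simp add: vw gen_hom a_def u_def)
  also have "x 2 0 (w (int j - 1)) = (\<Sum>i\<le>d. (if 1 \<le> j then N $$ (i, j - 1) else 0) *s v i)"
  proof (cases "1 \<le> j")
    case True
    then have "w (int j - 1) = v (j - 1)" using vw[of "j - 1"] ij by (simp add: of_nat_diff)
    then show ?thesis using x20[of "j - 1"] True ij by simp
  next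
    case False
    then show ?thesis by (simp add: w_def extend_zero_def gen_zero)
  qed
  finally have x20x12: "x 2 0 (x 1 2 (v j))
      = (\<Sum>i\<le>d. (a j * N $$ (i, j) + (if 1 \<le> j then u j * N $$ (i, j - 1) else 0)) *s v i)"
    unfolding x20[OF ij(2)] scale_sum_right
    by (cases "1 \<le> j") (simp_all add: scale_left_distrib sum.distrib)
  define L' where "L' i = (if i = j then q powi (int d - 2 * int j) else 0)
    + (if i = j + 1 then q powi int d - q powi (int d - 2 * int j - 2) else 0)" for i
  have left: "x 2 3 (v j) - x 2 0 (v j) = (\<Sum>i\<le>d. (L' i - N $$ (i, j)) *s v i)"
    unfolding x23 x20[OF ij(2)] L'_def by (simp only: scale_left_diff_distrib sum_subtractf)
  have right: "c *s (v j - (\<Sum>i\<le>d. f i *s v i)) = (\<Sum>i\<le>d. (c * ((if i = j then 1 else 0) - f i)) *s v i)" for c f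
  proof -
    have "v j - (\<Sum>i\<le>d. f i *s v i) = (\<Sum>i\<le>d. ((if i = j then 1 else 0) - f i) *s v i)"
      by (subst vj) (simp only: scale_left_diff_distrib sum_subtractf)
    then show ?thesis by (simp add: scale_sum_right)
  qed
  have e: "u (Suc i) = q powi (- int d) - q powi (int d - 2 * int i)" for i
    by (simp add: u_def algebra_simps)
  show "L - N $$ (i, j) = inverse t * q * ((if i = j then 1 else 0)
      - (q powi (int d - 2 * int i) * N $$ (i, j)
        + (if i < d then (q powi (- int d) - q powi (int d - 2 * int i)) * N $$ (Suc i, j) else 0)))"
    using indexed_basis_unique[OF b evaluation_20[of "v j", unfolded left x12x20 right] ij(1)]
    by (simp only: L_def L'_def a_def e)
  show "L - N $$ (i, j) = inverse t * inverse q * ((if i = j then 1 else 0)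
      - (q powi (int d - 2 * int j) * N $$ (i, j)
        + (if 1 \<le> j then (q powi (- int d) - q powi (int d - 2 * int j + 2)) * N $$ (i, j - 1) else 0)))"
    using indexed_basis_unique[OF b evaluation_20_swapped[of "v j", unfolded left x20x12 right] ij(1)]
    by (simp only: L_def L'_def a_def u_def)
qed

text \<open>
  The row recursion divides by \<open>1 - t q\<^bsup>2i-d-1\<^esup>\<close>, which may vanish in the top row, and the column
  recursion by \<open>1 - t q\<^bsup>2j-d+1\<^esup>\<close>, which may vanish in the last column. So the rows below the top come
  from the first, and the top row up to its last entry from the second. For the corner entry, both
  together leave the factor \<open>q\<^sup>d\<^sup>+\<^sup>1 - q\<^sup>-\<^sup>d\<^sup>-\<^sup>1\<close>, which does not depend on \<open>t\<close> and is nonzero.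
\<close>

lemma represents_0213_x20: "represents scale d v (x 2 0) (Mmat d q t)"
proof -
  obtain N where N: "represents scale d v (x 2 0) N"
    using represents_exists[OF basis_0213_indexed] .
  note entries = basis_0213_x20_entries[OF N]
  have row: "N $$ (i, j) * (1 - t * q powi (2 * int i - int d - 1))
    = (if i = j then q powi (2 * int i - int d) - t * inverse q else 0)
      + (if i = j + 1 then t * (inverse q - q powi (2 * int i - 1)) else 0)
      + (if i < d then (1 - q powi (2 * int i - 2 * int d)) * N $$ (Suc i, j) else 0)"
    if ij: "i \<le> d" "j \<le> d" for i j
  proof -
    define y a R where "y = q powi (2 * int i - int d)" and "a = q powi (int d - 2 * int i)"
      and "R = (if i < d then N $$ (Suc i, j) else 0)"
    define L where "L = (if i = j then a else 0) + (if i = j + 1 then q powi int d - a else 0)"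
    have ya: "y * a = 1" unfolding y_def a_def by (rule powi_mult_eq_1) simp
    have y1: "q powi (2 * int i - int d - 1) = y * inverse q"
      using powi_plus[of "2 * int i - int d" "- 1"] by (simp add: y_def power_int_minus)
    have yd: "y * q powi (- int d) = q powi (2 * int i - 2 * int d)"
      using powi_plus[of "2 * int i - int d" "- int d"] by (simp add: y_def)
    have yD: "y * q powi int d = q * q powi (2 * int i - 1)"
      using powi_plus[of "2 * int i - int d" "int d"] powi_plus[of 1 "2 * int i - 1"] by (simp add: y_def)
    have cancel: "t * inverse q * y * (inverse t * q * X) = y * X" for X
      using t_nonzero q_nonzero by (simp add: field_simps)
    have e: "i = j + 1 \<Longrightarrow> int d - 2 * int j - 2 = int d - 2 * int i" by simp
    have "L - N $$ (i, j) = inverse t * q * ((if i = j then 1 else 0)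
      - (a * N $$ (i, j) + (q powi (- int d) - a) * R))"
      using entries(1)[OF ij] e by (cases "i = j"; cases "i = j + 1") (auto simp: L_def a_def R_def)
    then have "(t * inverse q * y) * (L - N $$ (i, j)) = (t * inverse q * y) * (inverse t * q * ((if i = j then 1 else 0)
      - (a * N $$ (i, j) + (q powi (- int d) - a) * R)))" by (rule arg_cong)
    also have "\<dots> = y * (if i = j then 1 else 0) - (y * a) * N $$ (i, j) - (y * q powi (- int d) - y * a) * R"
      unfolding cancel by (simp add: algebra_simps)
    finally have main: "N $$ (i, j) * (1 - t * (y * inverse q))
        = y * (if i = j then 1 else 0) + (1 - q powi (2 * int i - 2 * int d)) * R - t * inverse q * (y * L)"
      unfolding ya yd by (simp add: algebra_simps)
    have "t * inverse q * (y * L) = (if i = j then t * inverse q else 0)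
        - (if i = j + 1 then t * (inverse q - q powi (2 * int i - 1)) else 0)"
    proof -
      have "y * (q powi int d - a) = q * q powi (2 * int i - 1) - 1"
        using ya yD by (simp only: right_diff_distrib)
      moreover have "t * inverse q * (q * X - 1) = - (t * (inverse q - X))" for X
        using q_nonzero by (simp add: field_simps)
      ultimately show ?thesis using ya by (simp add: L_def)
    qed
    then show ?thesis using main unfolding y1 by (simp add: R_def y_def)
  qed
  have col: "N $$ (0, j) * (1 - t * q powi (2 * int j - int d + 1))
    = (if j = 0 then q powi (- int d) - t * q
       else q\<^sup>2 * (1 - q powi (2 * int j - 2 - 2 * int d)) * N $$ (0, j - 1))"
    if j: "j \<le> d" for j
  proof -
    define y a R where "y = q powi (2 * int j - int d)" and "a = q powi (int d - 2 * int j)"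
      and "R = (if 1 \<le> j then N $$ (0, j - 1) else 0)"
    have ya: "y * a = 1" unfolding y_def a_def by (rule powi_mult_eq_1) simp
    have cancel: "t * q * y * (inverse t * inverse q * X) = y * X" for X
      using t_nonzero q_nonzero by (simp add: field_simps)
    have a2: "q powi (int d - 2 * int j + 2) = q\<^sup>2 * a"
      using powi_plus[of "int d - 2 * int j" 2] by (simp add: a_def)
    have y1: "q powi (2 * int j - int d + 1) = y * q"
      using powi_plus[of "2 * int j - int d" 1] by (simp add: y_def)
    have yd: "y * q powi (- int d) = q\<^sup>2 * q powi (2 * int j - 2 - 2 * int d)"
      using powi_plus[of "2 * int j - int d" "- int d"] powi_plus[of 2 "2 * int j - 2 - 2 * int d"]
      by (simp add: y_def)
    have "(if j = 0 then a else 0) - N $$ (0, j) = inverse t * inverse q * ((if j = 0 then 1 else 0)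
      - (a * N $$ (0, j) + (q powi (- int d) - q\<^sup>2 * a) * R))"
      using entries(2)[of 0 j] j by (auto simp: a_def R_def a2[unfolded a_def])
    then have "(t * q * y) * ((if j = 0 then a else 0) - N $$ (0, j))
      = (t * q * y) * (inverse t * inverse q * ((if j = 0 then 1 else 0)
      - (a * N $$ (0, j) + (q powi (- int d) - q\<^sup>2 * a) * R)))" by (rule arg_cong)
    also have "\<dots> = y * (if j = 0 then 1 else 0) - (y * a) * N $$ (0, j)
        - (y * q powi (- int d) - q\<^sup>2 * (y * a)) * R"
      unfolding cancel by (simp add: algebra_simps)
    finally have main: "(t * q * y) * ((if j = 0 then a else 0) - N $$ (0, j))
      = y * (if j = 0 then 1 else 0) - N $$ (0, j)
        - (q\<^sup>2 * q powi (2 * int j - 2 - 2 * int d) - q\<^sup>2) * R"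
      unfolding ya yd by simp
    have left: "(t * q * y) * ((if j = 0 then a else 0) - N $$ (0, j))
      = (if j = 0 then t * q * (y * a) else 0) - t * q * y * N $$ (0, j)"
      by (simp add: right_diff_distrib mult.assoc)
    have "N $$ (0, j) * (1 - t * (y * q)) = (if j = 0 then y - t * q else 0)
        + q\<^sup>2 * (1 - q powi (2 * int j - 2 - 2 * int d)) * R"
      using main unfolding left ya by (cases "j = 0") (simp_all add: algebra_simps)
    then show ?thesis unfolding y1 by (simp add: R_def y_def)
  qed
  have lower: "N $$ (i, j) = Mmat d q t $$ (i, j)" if "1 \<le> i" "i \<le> d" "j \<le> d" for i j
    using that
  proof (induction "d - i" arbitrary: i)
    case 0
    have nz: "1 - t * q powi (2 * int i - int d - 1) \<noteq> 0"
      by (rule t_factor_nonzero(1)) (use 0 in simp_all)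
    have "N $$ (i, j) * (1 - t * q powi (2 * int i - int d - 1))
        = Mmat d q t $$ (i, j) * (1 - t * q powi (2 * int i - int d - 1))"
      unfolding row[OF 0(3,4)] Mmat_row_recursion[OF 0(2-4)] using 0 by simp
    then show ?case using nz by simp
  next
    case (Suc k)
    have nz: "1 - t * q powi (2 * int i - int d - 1) \<noteq> 0"
      by (rule t_factor_nonzero(1)) (use Suc in simp_all)
    have "N $$ (Suc i, j) = Mmat d q t $$ (Suc i, j)" by (rule Suc(1)) (use Suc in auto)
    then have "N $$ (i, j) * (1 - t * q powi (2 * int i - int d - 1))
        = Mmat d q t $$ (i, j) * (1 - t * q powi (2 * int i - int d - 1))"
      unfolding row[OF Suc(4,5)] Mmat_row_recursion[OF Suc(3-5)] by simp
    then show ?case using nz by simp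
  qed
  have top: "N $$ (0, j) = Mmat d q t $$ (0, j)" if "j < d" for j
    using that
  proof (induction j)
    case 0
    have "1 - t * q powi (1 - int d) \<noteq> 0" using t_factor_below[of 0] 0 by (simp add: add.commute)
    moreover have "N $$ (0, 0) * (1 - t * q powi (1 - int d)) = q powi (- int d) - t * q"
      using col[of 0] by (simp add: add.commute)
    moreover have "Mmat d q t $$ (0, 0) * (1 - t * q powi (1 - int d)) = q powi (- int d) - t * q"
      by (rule Mmat_top_left) (use 0 in simp)
    ultimately show ?case by (metis mult_right_cancel)
  next
    case (Suc j)
    have nz: "1 - t * q powi (2 * int (Suc j) - int d + 1) \<noteq> 0" by (rule t_factor_below[OF Suc(2)])
    have e: "2 * int (Suc j) - int d + 1 = 2 * int j - int d + 3"
      "2 * int (Suc j) - 2 - 2 * int d = 2 * int j - 2 * int d" by simp_all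
    have "N $$ (0, Suc j) * (1 - t * q powi (2 * int j - int d + 3))
        = q\<^sup>2 * (1 - q powi (2 * int j - 2 * int d)) * N $$ (0, j)"
      using col[of "Suc j"] Suc(2) unfolding e by simp
    also have "N $$ (0, j) = Mmat d q t $$ (0, j)" using Suc by simp
    also have "q\<^sup>2 * (1 - q powi (2 * int j - 2 * int d)) * Mmat d q t $$ (0, j)
        = Mmat d q t $$ (0, Suc j) * (1 - t * q powi (2 * int j - int d + 3))"
      using Mmat_col_step[of 0 j] Suc(2) by simp
    finally show ?case using nz unfolding e by simp
  qed
  have corner: "N $$ (0, d) = Mmat d q t $$ (0, d)"
  proof -
    define D where "D = q powi int d"
    have D: "D \<noteq> 0" "q powi (- int d) = inverse D"
      using q_nonzero by (simp_all add: D_def power_int_minus)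
    have "q * D \<noteq> inverse (q * D)"
      using powi_eq_iff[of "int d + 1" "- (int d + 1)"] powi_plus[of "int d" 1]
      unfolding power_int_minus D_def by (simp add: mult.commute)
    then have nz: "q * D - inverse (q * D) \<noteq> 0" by simp
    show ?thesis
    proof (cases "d = 0")
      case True
      have "N $$ (0, 0) = 1"
      proof (rule ccontr)
        assume "N $$ (0, 0) \<noteq> 1"
        then have "inverse t * q = inverse t * inverse q" using entries[of 0 0] True by simp
        then show False using t_nonzero q_diff_inverse_nonzero by simp
      qed
      then show ?thesis using True Mmat_diag[of 0] by (simp add: hess_row_def hess_col_def)
    next
      case False
      then have d1: "1 \<le> d" by simp
      let ?m = "Mmat d q t"
      have clear: "t * n = c * X" if "- n = inverse t * c * - X" for n c X
      proof -
        have "n = inverse t * (c * X)" using that by (simp add: mult.assoc)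
        then show ?thesis using t_nonzero by simp
      qed
      have e1: "q powi (int d - 2 * int d + 2) = q\<^sup>2 * inverse D"
        using powi_plus[of 2 "- int d"] D by simp
      have "- N $$ (0, d) = inverse t * q * (- (D * N $$ (0, d) + (inverse D - D) * ?m $$ (1, d)))"
        using entries(1)[of 0 d] False lower[of 1 d] D by (simp add: D_def[symmetric] power_int_of_nat[symmetric] del: power_int_of_nat)
      then have E1: "t * N $$ (0, d) = q * (D * N $$ (0, d) + (inverse D - D) * ?m $$ (1, d))"
        by (rule clear)
      have "- N $$ (0, d) = inverse t * inverse q
          * (- (inverse D * N $$ (0, d) + (inverse D - q\<^sup>2 * inverse D) * ?m $$ (0, d - 1)))"
        using entries(2)[of 0 d] False top[of "d - 1"] D e1 by simp
      then have E2: "t * N $$ (0, d)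
          = inverse q * (inverse D * N $$ (0, d) + (inverse D - q\<^sup>2 * inverse D) * ?m $$ (0, d - 1))"
        by (rule clear)
      have i1: "inverse (q * D) = q powi (- int d - 1)" "q * D = q powi (int d + 1)"
        using powi_plus[of "- int d" "- 1"] powi_plus[of "int d" 1] D
        by (simp_all add: power_int_minus D_def mult.commute)
      have M1: "?m $$ (0, d) * (1 - t * inverse (q * D)) = (1 - inverse D * inverse D) * ?m $$ (1, d)"
        using Mmat_row_step[of 0 d] False powi_plus[of "- int d" "- int d"] D unfolding i1(1) by simp
      have "?m $$ (0, Suc (d - 1)) * (1 - t * q powi (2 * int (d - 1) - int d + 3))
          = q\<^sup>2 * (1 - q powi (2 * int (d - 1) - 2 * int d)) * ?m $$ (0, d - 1)"
        by (rule Mmat_col_step) (use False in auto)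
      moreover have "2 * int (d - 1) - int d + 3 = int d + 1" "2 * int (d - 1) - 2 * int d = - 2"
        using False by auto
      ultimately have M2: "?m $$ (0, d) * (1 - t * (q * D)) = (q\<^sup>2 - 1) * ?m $$ (0, d - 1)"
        using False q_nonzero unfolding i1(2) by (simp add: power_int_minus right_diff_distrib add.commute)
      have "(q * D - inverse (q * D)) * N $$ (0, d)
          = inverse q * inverse D * ((1 - q\<^sup>2) * ?m $$ (0, d - 1)) - q * (inverse D - D) * ?m $$ (1, d)"
        using E1 E2 by (simp add: algebra_simps)
      also have "(1 - q\<^sup>2) * ?m $$ (0, d - 1) = - (?m $$ (0, d) * (1 - t * (q * D)))"
        unfolding M2 by (simp add: algebra_simps)
      also have "q * (inverse D - D) * ?m $$ (1, d) = - q * D * ((1 - inverse D * inverse D) * ?m $$ (1, d))"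
        using D by (simp add: algebra_simps)
      also have "\<dots> = - q * D * (?m $$ (0, d) * (1 - t * inverse (q * D)))" unfolding M1 ..
      also have "inverse q * inverse D * - (?m $$ (0, d) * (1 - t * (q * D)))
          - - q * D * (?m $$ (0, d) * (1 - t * inverse (q * D))) = (q * D - inverse (q * D)) * ?m $$ (0, d)"
        using D q_nonzero by (simp add: field_simps)
      finally show ?thesis using nz by simp
    qed
  qed
  have "N = Mmat d q t"
  proof (rule eq_matI)
    fix i j assume "i < dim_row (Mmat d q t)" "j < dim_col (Mmat d q t)"
    then have "i \<le> d" "j \<le> d" by (auto simp: Mmat_def)
    then show "N $$ (i, j) = Mmat d q t $$ (i, j)"
      using lower[of i j] top[of j] corner by (cases "i = 0"; cases "j = d") auto
  qed (use represents_carrier[OF N] in \<open>auto simp: Mmat_def\<close>)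
  then show ?thesis using N by simp
qed

end

text \<open>
  Let \<open>c = t q\<^sup>d\<^sup>-\<^sup>1\<close>. The coefficients of \<open>x\<^sub>0\<^sub>1\<close> above the diagonal are \<open>c\<^sup>-\<^sup>1\<close> times those of the matrix
  \<open>E\<close>, whose row sums are \<open>q\<^sup>d\<close>. So \<open>\<Sum> c\<^sup>n v\<^sub>n\<close> is an eigenvector and lies in the flag \<open>[0]\<close>, and the vectors
  \<open>c\<^sup>-\<^sup>n v\<^bsub>d-n\<^esub>\<close> form a \<open>[2,0,3,1]\<close>-basis, which is a \<open>[0,2,1,3]\<close>-basis of the module rotated by two
  steps, where \<open>x\<^sub>0\<^sub>2\<close> plays the part of \<open>x\<^sub>2\<^sub>0\<close>.
\<close>

lemma represents_0213_x02:
  assumes basis: "ijkl_basis q scale x d (0, 2, 1, 3) v"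
  shows "represents scale d v (x 0 2) (Zmat d * Mmat d (inverse q) (inverse t) * Zmat d)"
proof -
  interpret r: boxq_evaluation scale q t "\<lambda>i j. x (i + 2) (j + 2)" d
    by (rule boxq_evaluation_rotate2)
  define c where "c = t * q powi (int d - 1)"
  have c: "c \<noteq> 0" using t_nonzero q_nonzero by (simp add: c_def)
  define u where "u n = v (d - n)" for n
  define v' where "v' n = c powi (- int n) *s u n" for n
  note b = basis_0213_indexed[OF basis]
  have b': "indexed_basis scale d v'"
    unfolding v'_def u_def by (intro indexed_basis_scaled indexed_basis_reverse b) (use c in simp)
  have "ijkl_basis q scale (\<lambda>i j. x (i + 2) (j + 2)) d (0, 2, 1, 3) v'"
  proof -
    have eig: "x 3 1 (v' n) = q powi (int d - 2 * int n) *s v' n" if "n \<le> d" for n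
      using basis_0213_x31_eigen[OF basis, of "d - n"] that
      by (simp add: v'_def u_def gen_hom of_nat_diff scale_left_commute algebra_simps)
    \<comment> \<open>the superdiagonal of \<open>x\<^sub>0\<^sub>1\<close> carries the factor \<open>c\<^sup>-\<^sup>1\<close>\<close>
    have F: "q powi (1 - int d) * inverse t * c = 1"
    proof -
      have "q powi (1 - int d) * inverse t * c = (inverse t * t) * (q powi (1 - int d) * q powi (int d - 1))"
        by (simp add: c_def mult_ac)
      moreover have "inverse t * t = 1" "q powi (1 - int d) * q powi (int d - 1) = 1"
        using t_nonzero powi_mult_eq_1[of "1 - int d" "int d - 1"] by simp_all
      ultimately show ?thesis by (simp only: mult_1_left)
    qed
    have "x 0 1 (\<Sum>m\<le>d. c ^ m *s v m) = (\<Sum>m\<le>d. c ^ m *s x 0 1 (v m))"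
      by (rule linear_indexed_sum) (simp add: linear_gen)
    also have "\<dots> = (\<Sum>m\<le>d. (c ^ m * q powi (2 * int m - int d)) *s v m
        + (c ^ m * ((q powi int d - q powi (2 * int m - 2 - int d)) * q powi (1 - int d) * inverse t))
          *s extend_zero d v (int m - 1))"
    proof (rule sum.cong)
      fix m assume "m \<in> {..d}"
      then show "c ^ m *s x 0 1 (v m) = (c ^ m * q powi (2 * int m - int d)) *s v m
        + (c ^ m * ((q powi int d - q powi (2 * int m - 2 - int d)) * q powi (1 - int d) * inverse t))
          *s extend_zero d v (int m - 1)"
        using basis_0213_x01[OF basis, of "int m"] by (simp add: extend_zero_of_nat scale_right_distrib)
    qed simp
    also have "\<dots> = (\<Sum>m\<le>d. (c ^ m * q powi (2 * int m - int d) + (if m < d then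
        c ^ Suc m * ((q powi int d - q powi (2 * int (Suc m) - 2 - int d)) * q powi (1 - int d) * inverse t) else 0))
          *s v m)"
      unfolding sum.distrib scale_left_distrib by (subst sum_shift_down) simp
    also have "\<dots> = (\<Sum>m\<le>d. (q powi int d * c ^ m) *s v m)"
    proof (rule sum.cong)
      fix m assume m: "m \<in> {..d}"
      have "c ^ m * q powi (2 * int m - int d) + (if m < d then
        c ^ Suc m * ((q powi int d - q powi (2 * int (Suc m) - 2 - int d)) * q powi (1 - int d) * inverse t) else 0)
        = q powi int d * c ^ m"
      proof (cases "m < d")
        case True
        have "c ^ Suc m * ((q powi int d - q powi (2 * int (Suc m) - 2 - int d)) * q powi (1 - int d) * inverse t)
          = c ^ m * (q powi int d - q powi (2 * int m - int d)) * (q powi (1 - int d) * inverse t * c)"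
          by (simp add: mult_ac)
        then have shifted:
          "c ^ Suc m * ((q powi int d - q powi (2 * int (Suc m) - 2 - int d)) * q powi (1 - int d) * inverse t)
          = c ^ m * (q powi int d - q powi (2 * int m - int d))" unfolding F by simp
        show ?thesis unfolding shifted using True by (simp add: algebra_simps)
      next
        case False
        then have "m = d" using m by simp
        then show ?thesis by simp
      qed
      then show "(c ^ m * q powi (2 * int m - int d) + (if m < d then
        c ^ Suc m * ((q powi int d - q powi (2 * int (Suc m) - 2 - int d)) * q powi (1 - int d) * inverse t) else 0))
          *s v m = (q powi int d * c ^ m) *s v m" by simp
    qed simp
    also have "\<dots> = q powi int d *s (\<Sum>m\<le>d. c ^ m *s v m)" by (simp add: scale_sum_right)
    finally have x01: "x 0 1 (\<Sum>m\<le>d. c ^ m *s v m) = q powi int d *s (\<Sum>m\<le>d. c ^ m *s v m)" .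
    have "(\<Sum>n\<le>d. v' n) = (\<Sum>m\<le>d. c powi (- int (d - m)) *s v m)"
      unfolding v'_def u_def
      by (rule sum.reindex_bij_witness[of _ "\<lambda>i. d - i" "\<lambda>i. d - i"]) auto
    also have "\<dots> = (\<Sum>m\<le>d. c powi (- int d) *s c ^ m *s v m)"
    proof (rule sum.cong)
      fix m assume "m \<in> {..d}"
      then have e: "- int (d - m) = - int d + int m" by (simp add: of_nat_diff)
      have "c powi (- int (d - m)) = c powi (- int d) * c ^ m"
        unfolding e using c power_int_add[of c "- int d" "int m"] by simp
      then show "c powi (- int (d - m)) *s v m = c powi (- int d) *s c ^ m *s v m"
        by (simp only: scale_scale)
    qed simp
    also have "\<dots> = c powi (- int d) *s (\<Sum>m\<le>d. c ^ m *s v m)" by (simp only: scale_sum_right)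
    finally have "(\<Sum>n\<le>d. v' n) \<in> flag q scale (\<lambda>i j. x (i + 2) (j + 2)) d 2 0"
      using x01 by (simp add: r.flag0_iff gen_hom scale_left_commute)
    then show ?thesis using b' eig
      by (simp add: ijkl_basis_def decomposition_def std_gen_def eigenspace_def)
  qed
  then have "represents scale d v' (x (2 + 2) (0 + 2)) (Mmat d q t)"
    by (rule r.represents_0213_x20)
  then have *: "represents scale d (\<lambda>n. c powi (- int n) *s u n) (x 0 2) (Mmat d q t)"
    by (simp add: v'_def[abs_def])
  have "represents scale d u (x 0 2) (Mmat d (inverse q) (inverse t))"
  proof (rule represents_scaled[OF * linear_gen])
    fix i n assume "i \<le> d" "n \<le> d"
    moreover have "c powi (- int n) * c powi (int n - int i) = c powi (- int i)"
      using power_int_add[of c "- int n" "int n - int i"] c by simp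
    ultimately show "c powi (- int n) * Mmat d (inverse q) (inverse t) $$ (i, n)
        = c powi (- int i) * Mmat d q t $$ (i, n)"
      using Mmat_inverse_params[of i n] by (simp add: c_def[symmetric] mult.assoc[symmetric])
  qed (rule matrix_carriers | simp add: c)+
  from represents_reverse[OF this]
  have "represents scale d (\<lambda>n. u (d - n)) (x 0 2) (Zmat d * Mmat d (inverse q) (inverse t) * Zmat d)" .
  then show ?thesis by (simp add: u_def represents_def)
qed

section \<open>All rows of the tables\<close>

lemma represents_of_reverse:
  assumes "represents scale d (\<lambda>n. v (d - n)) A M"
  shows "represents scale d v A (Zmat d * M * Zmat d)"
  using represents_reverse[OF assms] by (simp add: represents_def)

lemma represents_x13_inverse:
  assumes "indexed_basis scale d v" "represents scale d v (x 3 1) M"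
  shows "represents scale d v (x 1 3) (matinv M)"
  by (rule represents_inverse[OF assms linear_gen gen_inverse]) simp_all

lemma represents_x20_inverse:
  assumes "indexed_basis scale d v" "represents scale d v (x 0 2) M"
  shows "represents scale d v (x 2 0) (matinv M)"
  by (rule represents_inverse[OF assms linear_gen gen_inverse]) simp_all

text \<open>
  The reflection \<open>i \<mapsto> 1 - i\<close> carries \<open>[1,0,3,2]\<close> to \<open>[0,1,2,3]\<close>.
\<close>

lemma represents_1032:
  assumes "ijkl_basis q scale x d (1, 0, 3, 2) v"
  shows "represents scale d v (x 0 1) (Zmat d * Smat d q (inverse t) * Zmat d)"
    "represents scale d v (x 1 2) (Zmat d * Gmat d q t * Zmat d)"
    "represents scale d v (x 2 3) (Kmat d (inverse q))"
    "represents scale d v (x 3 0) (Emat d (inverse q))"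
    "represents scale d v (x 0 2) (Zmat d * Emat d q * Zmat d)"
    "represents scale d v (x 3 1) (Lmat d (inverse q) t)"
proof -
  interpret r: boxq_evaluation scale "inverse q" t "\<lambda>i j. x (1 - j) (1 - i)" d
    by (rule boxq_evaluation_reflect)
  have "ijkl_basis (inverse q) scale (\<lambda>i j. x (1 - j) (1 - i)) d (0, 1, 2, 3) v"
    by (rule ijkl_basis_reflect) (use assms in simp)
  note rows = r.represents_0123(1)[OF this] r.represents_0123(4)[OF this]
    r.represents_0123(3)[OF this] r.represents_0123(2)[OF this]
    r.represents_0123(6)[OF this] r.represents_0123(5)[OF this]
  show "represents scale d v (x 0 1) (Zmat d * Smat d q (inverse t) * Zmat d)"
    "represents scale d v (x 1 2) (Zmat d * Gmat d q t * Zmat d)"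
    "represents scale d v (x 2 3) (Kmat d (inverse q))"
    "represents scale d v (x 3 0) (Emat d (inverse q))"
    "represents scale d v (x 0 2) (Zmat d * Emat d q * Zmat d)"
    "represents scale d v (x 3 1) (Lmat d (inverse q) t)"
    using rows by simp_all
qed

lemma represents_0132:
  assumes "ijkl_basis q scale x d (0, 1, 3, 2) v"
  shows "represents scale d v (x 0 1) (Smat d (inverse q) (inverse t))"
    "represents scale d v (x 1 2) (Zmat d * Emat d q * Zmat d)"
    "represents scale d v (x 2 3) (Kmat d (inverse q))"
    "represents scale d v (x 3 0) (Gmat d (inverse q) t)"
    "represents scale d v (x 0 2) (Zmat d * Lmat d q t * Zmat d)"
    "represents scale d v (x 3 1) (Emat d (inverse q))"
proof -
  note b = ijkl_basis_reverse[OF assms]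
  note rows = represents_of_reverse[OF represents_0123(1)[OF b]]
    represents_of_reverse[OF represents_0123(2)[OF b]]
    represents_of_reverse[OF represents_0123(3)[OF b]]
    represents_of_reverse[OF represents_0123(4)[OF b]]
    represents_of_reverse[OF represents_0123(5)[OF b]]
    represents_of_reverse[OF represents_0123(6)[OF b]]
  show "represents scale d v (x 0 1) (Smat d (inverse q) (inverse t))"
    "represents scale d v (x 1 2) (Zmat d * Emat d q * Zmat d)"
    "represents scale d v (x 2 3) (Kmat d (inverse q))"
    "represents scale d v (x 3 0) (Gmat d (inverse q) t)"
    "represents scale d v (x 0 2) (Zmat d * Lmat d q t * Zmat d)"
    "represents scale d v (x 3 1) (Emat d (inverse q))"
    using rows unfolding Zmat_conj_conj[OF matrix_carriers(3)] Zmat_conj_conj[OF matrix_carriers(5)]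
      Zmat_conj_conj[OF matrix_carriers(7)] Zmat_conj_Kmat by simp_all
qed

lemma represents_1023:
  assumes "ijkl_basis q scale x d (1, 0, 2, 3) v"
  shows "represents scale d v (x 0 1) (Smat d q (inverse t))"
    "represents scale d v (x 1 2) (Gmat d q t)"
    "represents scale d v (x 2 3) (Kmat d q)"
    "represents scale d v (x 3 0) (Zmat d * Emat d (inverse q) * Zmat d)"
    "represents scale d v (x 0 2) (Emat d q)"
    "represents scale d v (x 3 1) (Zmat d * Lmat d (inverse q) t * Zmat d)"
proof -
  note rows = represents_1032[OF ijkl_basis_reverse[OF assms], THEN represents_of_reverse]
  show "represents scale d v (x 0 1) (Smat d q (inverse t))"
    "represents scale d v (x 1 2) (Gmat d q t)"
    "represents scale d v (x 2 3) (Kmat d q)"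
    "represents scale d v (x 3 0) (Zmat d * Emat d (inverse q) * Zmat d)"
    "represents scale d v (x 0 2) (Emat d q)"
    "represents scale d v (x 3 1) (Zmat d * Lmat d (inverse q) t * Zmat d)"
    using rows unfolding Zmat_conj_conj[OF matrix_carriers(3)] Zmat_conj_conj[OF matrix_carriers(5)]
      Zmat_conj_conj[OF matrix_carriers(7)] Zmat_conj_Kmat by simp_all
qed

text \<open>
  The reflection \<open>i \<mapsto> 2 - i\<close> carries \<open>[2,0,1,3]\<close> to \<open>[0,2,1,3]\<close>.
\<close>

lemma represents_2013:
  assumes "ijkl_basis q scale x d (2, 0, 1, 3) v"
  shows "represents scale d v (x 0 1) (Emat d q)"
    "represents scale d v (x 1 2) (Fmat d (inverse q) t)"
    "represents scale d v (x 2 3) (Zmat d * Fmat d q (inverse t) * Zmat d)"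
    "represents scale d v (x 3 0) (Zmat d * Emat d (inverse q) * Zmat d)"
    "represents scale d v (x 0 2) (Zmat d * Mmat d q t * Zmat d)"
    "represents scale d v (x 1 3) (Kmat d q)"
    "represents scale d v (x 2 0) (Mmat d (inverse q) (inverse t))"
    "represents scale d v (x 3 1) (Kmat d (inverse q))"
proof -
  interpret r: boxq_evaluation scale "inverse q" "inverse t" "\<lambda>i j. x (2 - j) (2 - i)" d
    by (rule boxq_evaluation_reflect2)
  have "ijkl_basis (inverse q) scale (\<lambda>i j. x (2 - j) (2 - i)) d (0, 2, 1, 3) v"
    by (rule ijkl_basis_reflect2) (use assms in simp)
  note rows = r.represents_0213(2)[OF this] r.represents_0213(1)[OF this]
    r.represents_0213(4)[OF this] r.represents_0213(3)[OF this]
    r.represents_0213_x02[OF this] r.represents_0213(6)[OF this]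
    r.represents_0213_x20[OF this] r.represents_0213(5)[OF this]
  show "represents scale d v (x 0 1) (Emat d q)"
    "represents scale d v (x 1 2) (Fmat d (inverse q) t)"
    "represents scale d v (x 2 3) (Zmat d * Fmat d q (inverse t) * Zmat d)"
    "represents scale d v (x 3 0) (Zmat d * Emat d (inverse q) * Zmat d)"
    "represents scale d v (x 0 2) (Zmat d * Mmat d q t * Zmat d)"
    "represents scale d v (x 1 3) (Kmat d q)"
    "represents scale d v (x 2 0) (Mmat d (inverse q) (inverse t))"
    "represents scale d v (x 3 1) (Kmat d (inverse q))"
    using rows by simp_all
qed

lemma table_rows_edges:
  defines "edges \<equiv> table_row q scale x d [(0, 1), (1, 2), (2, 3), (3, 0)]"
  shows "edges (0, 1, 2, 3) [Zmat d * Smat d (inverse q) (inverse t) * Zmat d, Emat d q, Kmat d q,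
      Zmat d * Gmat d (inverse q) t * Zmat d]"
    "edges (1, 0, 2, 3) [Smat d q (inverse t), Gmat d q t, Kmat d q, Zmat d * Emat d (inverse q) * Zmat d]"
    "edges (0, 1, 3, 2) [Smat d (inverse q) (inverse t), Zmat d * Emat d q * Zmat d, Kmat d (inverse q),
      Gmat d (inverse q) t]"
    "edges (1, 0, 3, 2) [Zmat d * Smat d q (inverse t) * Zmat d, Zmat d * Gmat d q t * Zmat d,
      Kmat d (inverse q), Emat d (inverse q)]"
    "edges (0, 2, 1, 3) [Fmat d q (inverse t), Emat d (inverse q), Zmat d * Emat d q * Zmat d,
      Zmat d * Fmat d (inverse q) t * Zmat d]"
    "edges (2, 0, 1, 3) [Emat d q, Fmat d (inverse q) t, Zmat d * Fmat d q (inverse t) * Zmat d,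
      Zmat d * Emat d (inverse q) * Zmat d]"
  unfolding edges_def table_row_def
  by (simp_all add: represents_0123
      represents_1023 represents_0132 represents_1032 represents_0213 represents_2013)

lemma table_rows_diagonals:
  defines "diagonals \<equiv> table_row q scale x d [(0, 2), (1, 3), (2, 0), (3, 1)]"
  shows "diagonals (0, 1, 2, 3) [Lmat d q t, matinv (Zmat d * Emat d (inverse q) * Zmat d), matinv (Lmat d q t),
      Zmat d * Emat d (inverse q) * Zmat d]"
    "diagonals (1, 0, 2, 3) [Emat d q, matinv (Zmat d * Lmat d (inverse q) t * Zmat d), matinv (Emat d q),
      Zmat d * Lmat d (inverse q) t * Zmat d]"
    "diagonals (0, 1, 3, 2) [Zmat d * Lmat d q t * Zmat d, matinv (Emat d (inverse q)),
      matinv (Zmat d * Lmat d q t * Zmat d), Emat d (inverse q)]"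
    "diagonals (1, 0, 3, 2) [Zmat d * Emat d q * Zmat d, matinv (Lmat d (inverse q) t),
      matinv (Zmat d * Emat d q * Zmat d), Lmat d (inverse q) t]"
    "diagonals (0, 2, 1, 3) [Zmat d * Mmat d (inverse q) (inverse t) * Zmat d, Kmat d q, Mmat d q t, Kmat d (inverse q)]"
    "diagonals (2, 0, 1, 3) [Zmat d * Mmat d q t * Zmat d, Kmat d q, Mmat d (inverse q) (inverse t), Kmat d (inverse q)]"
  unfolding diagonals_def table_row_def
  by (simp_all add: represents_0123 represents_1023 represents_0132 represents_1032
      represents_0213 represents_0213_x02 represents_0213_x20 represents_2013
      represents_x13_inverse represents_x20_inverse ijkl_basis_indexed)

end

lemma table_row_rotate:
  "table_row q scale (\<lambda>i j. x (i + c) (j + c)) d gens (i, j, k, l) Ms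
    \<longleftrightarrow> table_row q scale x d (map (\<lambda>(i, j). (i + c, j + c)) gens) (i + c, j + c, k + c, l + c) Ms"
  unfolding table_row_def ijkl_basis_rotate
  by (simp add: list_all2_map1 split_def)

lemma boxq_evaluation_rotate_by:
  assumes "boxq_evaluation scale q t x d"
  shows "boxq_evaluation scale q (twist t r) (\<lambda>i j. x (i + r) (j + r)) d"
proof -
  interpret a: boxq_evaluation scale q t x d by fact
  interpret b: boxq_evaluation scale q "inverse t" "\<lambda>i j. x (i + 1) (j + 1)" d
    by (rule a.boxq_evaluation_rotate)
  interpret c: boxq_evaluation scale q t "\<lambda>i j. x (i + 2) (j + 2)" d
    by (rule a.boxq_evaluation_rotate2)
  show ?thesis
    using assms a.boxq_evaluation_rotate a.boxq_evaluation_rotate2 c.boxq_evaluation_rotate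
    by (cases r rule: four_cases) (simp_all add: twist_def four_shift)
qed

section \<open>Evaluation modules satisfy the evaluation relations\<close>

context vector_space
begin

text \<open>
  The basis consists of the preimages of the unit vectors. The argument runs through the coordinate functionals of the
  isomorphism, since vectors of variable length do not form an additive group in which sums could be
  compared directly.
\<close>

lemma isomorphic_to_Vdt_basis:
  assumes "isomorphic_to_Vdt q scale x d t"
  obtains u where "indexed_basis scale d u"
    and "\<And>i j M. ((i, j), M) \<in> set (Vdt_action q d t) \<Longrightarrow> M \<in> carrier_mat (d + 1) (d + 1)
      \<Longrightarrow> represents scale d u (x i j) M"
proof -
  obtain \<phi> :: "'b \<Rightarrow> 'a vec" where bij: "bij_betw \<phi> UNIV (carrier_vec (d + 1))"
    and add: "\<And>u v. \<phi> (u + v) = \<phi> u + \<phi> v" and scale: "\<And>c v. \<phi> (c *s v) = c \<cdot>\<^sub>v \<phi> v"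
    and act: "\<And>i j M v. ((i, j), M) \<in> set (Vdt_action q d t) \<Longrightarrow> \<phi> (x i j v) = M *\<^sub>v \<phi> v"
    using assms by (fastforce simp: isomorphic_to_Vdt_def)
  have carrier: "\<phi> v \<in> carrier_vec (d + 1)" for v using bij by (auto simp: bij_betw_def)
  have inj: "\<phi> v = \<phi> w \<Longrightarrow> v = w" for v w using bij by (auto simp: bij_betw_def dest: injD)
  define u where "u n = inv_into UNIV \<phi> (unit_vec (d + 1) n)" for n
  have u: "\<phi> (u n) = unit_vec (d + 1) n" if "n \<le> d" for n
    unfolding u_def using that bij by (intro f_inv_into_f) (auto simp: bij_betw_def)
  define \<kappa> where "\<kappa> i v = \<phi> v $ i" for i v
  have \<kappa>_add: "\<kappa> i (v + w) = \<kappa> i v + \<kappa> i w" if "i \<le> d" for i v w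
    using that carrier[of w] by (simp add: \<kappa>_def add)
  have \<kappa>_scale: "\<kappa> i (c *s v) = c * \<kappa> i v" if "i \<le> d" for i c v
    using that carrier[of v] by (simp add: \<kappa>_def scale)
  have \<kappa>_zero: "\<kappa> i 0 = 0" if "i \<le> d" for i using \<kappa>_scale[OF that, of 0 0] by simp
  have \<kappa>_sum: "\<kappa> i (\<Sum>j\<in>S. f j) = (\<Sum>j\<in>S. \<kappa> i (f j))" if "i \<le> d" "finite S" for i S f
    using that(2) by (induction S rule: finite_induct) (simp_all add: \<kappa>_zero \<kappa>_add that(1))
  have ext: "v = w" if "\<And>i. i \<le> d \<Longrightarrow> \<kappa> i v = \<kappa> i w" for v w
    by (rule inj, rule eq_vecI) (use that carrier[of v] carrier[of w] in \<open>auto simp: \<kappa>_def\<close>)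
  have \<kappa>_u: "\<kappa> i (u n) = (if i = n then 1 else 0)" if "i \<le> d" "n \<le> d" for i n
    using that by (simp add: \<kappa>_def u)
  have \<kappa>_comb: "\<kappa> i (\<Sum>j\<le>d. c j *s u j) = c i" if "i \<le> d" for i c
  proof -
    have "\<kappa> i (\<Sum>j\<le>d. c j *s u j) = (\<Sum>j\<le>d. if i = j then c j else 0)"
      unfolding \<kappa>_sum[OF that finite_atMost] by (rule sum.cong) (use that in \<open>auto simp: \<kappa>_scale \<kappa>_u\<close>)
    then show ?thesis using that by simp
  qed
  show ?thesis
  proof (rule that)
    show "indexed_basis scale d u"
    proof (rule indexed_basisI)
      fix c i assume "(\<Sum>i\<le>d. c i *s u i) = 0" "i \<le> d"
      then show "c i = 0" using \<kappa>_comb[of i c] \<kappa>_zero[of i] by simp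
    next
      fix v have "v = (\<Sum>i\<le>d. \<kappa> i v *s u i)" by (rule ext) (simp add: \<kappa>_comb)
      then show "\<exists>c. v = (\<Sum>i\<le>d. c i *s u i)" by (rule exI[of _ "\<lambda>i. \<kappa> i v"])
    qed
    fix i j M assume M: "((i, j), M) \<in> set (Vdt_action q d t)" "M \<in> carrier_mat (d + 1) (d + 1)"
    show "represents scale d u (x i j) M"
      unfolding represents_def
    proof (intro conjI allI impI ext)
      fix n k assume n: "n \<le> d" and k: "k \<le> d"
      have "\<kappa> k (x i j (u n)) = M $$ (k, n)"
        using M n k by (simp add: \<kappa>_def act[OF M(1)] u)
      then show "\<kappa> k (x i j (u n)) = \<kappa> k (\<Sum>i\<le>d. M $$ (i, n) *s u i)"
        using k by (simp add: \<kappa>_comb)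
    qed (rule M(2))
  qed
qed

end

text \<open>
  Three relations are checked on the basis of \<open>V\<^sub>d(t)\<close>: the evaluation relation at 0, its dual form at 0,
  and the one at 3. The relation at 2 is the dual form at 0 multiplied by \<open>x\<^sub>1\<^sub>3\<close>. The relation at 1
  follows from all three: expand \<open>x\<^sub>3\<^sub>0 x\<^sub>0\<^sub>2\<close> by the relation at 0, exchange \<open>x\<^sub>2\<^sub>3\<close> and \<open>x\<^sub>3\<^sub>1\<close> by their q-Weyl
  relation, and replace \<open>x\<^sub>2\<^sub>3 x\<^sub>0\<^sub>2\<close> by the relation at 3.
\<close>

lemma evaluation_parameter_imp_boxq_evaluation:
  fixes q t :: "'a::field"
  assumes q: "q \<noteq> 0" and root: "\<And>n::nat. n \<ge> 1 \<Longrightarrow> q ^ n \<noteq> 1"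
    and ev: "evaluation_module q scale x d" and param: "evaluation_parameter q scale x d t"
  shows "boxq_evaluation scale q t x d"
proof -
  have box: "boxq_module q scale x" using ev by (simp add: evaluation_module_def)
  interpret vector_space scale using box by (simp add: boxq_module_def)
  note inj = powi_eq_iff_not_root[OF q root]
  have qq: "q - inverse q \<noteq> 0" using inj[of 1 "- 1"] by (simp add: power_int_minus)
  have t: "t \<noteq> 0" and t_generic: "\<And>n. 1 \<le> n \<Longrightarrow> n \<le> d \<Longrightarrow> t \<noteq> q powi (int d - 2 * int n + 1)"
    using param by (auto simp: evaluation_parameter_def)
  have lin: "Vector_Spaces.linear scale scale (x i j)" if "std_gen i j" for i j
    using box that by (simp add: boxq_module_def)
  have gens: "std_gen 0 1" "std_gen 1 2" "std_gen 2 3" "std_gen 3 0" "std_gen 0 2" "std_gen 1 3"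
    "std_gen 2 0" "std_gen 3 1"
    by (simp_all add: std_gen_def)
  have hom: "x i j (a + b) = x i j a + x i j b" "x i j (a - b) = x i j a - x i j b"
    "x i j (scale c a) = scale c (x i j a)" if "std_gen i j" for i j a b c
    using Vector_Spaces.linear.axioms(3)[OF lin[OF that]]
    by (auto intro: module_hom.add module_hom.diff module_hom.scale)
  have inv: "x i j (x j i v) = v" if "j - i = 2" for i j v
    using box that by (simp add: boxq_module_def)
  have weyl: "scale q (x i j (x j k v)) - scale (inverse q) (x j k (x i j v)) = scale (q - inverse q) v"
    if "(j - i, k - j) \<in> {(1, 1), (1, 2), (2, 1)}" for i j k v
  proof -
    have "scale (1 / (q - inverse q))
        (scale q (x i j (x j k v)) - scale (inverse q) (x j k (x i j v))) = v"
      using box that unfolding boxq_module_def by blast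
    then have "scale (q - inverse q) (scale (1 / (q - inverse q))
        (scale q (x i j (x j k v)) - scale (inverse q) (x j k (x i j v)))) = scale (q - inverse q) v"
      by (rule arg_cong)
    moreover have "(q - inverse q) * (1 / (q - inverse q)) = 1" using qq by simp
    ultimately show ?thesis by (simp only: scale_scale scale_one)
  qed
  have swap: "scale q (v - x i j (x j k v)) = scale (inverse q) (v - x j k (x i j v))"
    if "(j - i, k - j) \<in> {(1, 1), (1, 2), (2, 1)}" for i j k v
    using weyl[OF that, of v] by (simp add: algebra_simps)
  have eig: "\<bar>m\<bar> \<le> int d" if "std_gen i j" "v \<noteq> 0" "x i j v = scale (q powi m) v" for i j v m
  proof -
    have "q powi m \<in> eigenvalues scale (x i j)" using that by (auto simp: eigenvalues_def)
    moreover have "eigenvalues scale (x i j) = {1 * q powi (int d - 2 * int n) | n. n \<le> d}"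
      using ev that(1) by (simp only: evaluation_module_def has_diameter_type_def)
    ultimately obtain n where "n \<le> d" "q powi m = q powi (int d - 2 * int n)" by auto
    then show ?thesis by (simp add: inj)
  qed

  have iso: "isomorphic_to_Vdt q scale x d t" using param by (simp add: evaluation_parameter_def)
  \<comment> \<open>the actions on the defining basis of \<open>V\<^sub>d(t)\<close>\<close>
  obtain u where basis: "indexed_basis scale d u"
    and rep: "\<And>i j M. ((i, j), M) \<in> set (Vdt_action q d t) \<Longrightarrow> M \<in> carrier_mat (d + 1) (d + 1)
      \<Longrightarrow> represents scale d u (x i j) M"
    using isomorphic_to_Vdt_basis[OF iso] by blast
  have x01: "represents scale d u (x 0 1) (Zmat d * Smat d (inverse q) (inverse t) * Zmat d)"
    and x12: "represents scale d u (x 1 2) (Emat d q)"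
    and x23: "represents scale d u (x 2 3) (Kmat d q)"
    and x30: "represents scale d u (x 3 0) (Zmat d * Gmat d (inverse q) t * Zmat d)"
    and x02: "represents scale d u (x 0 2) (Lmat d q t)"
    and x31: "represents scale d u (x 3 1) (Zmat d * Emat d (inverse q) * Zmat d)"
    by (rule rep; simp only: Vdt_action_def list.set matrix_carriers Zmat_conj_carrier; blast)+

  define w where "w = extend_zero d u"
  have wu: "w (int n) = u n" if "n \<le> d" for n using that by (simp add: w_def extend_zero_of_nat)
  have act23: "x 2 3 (w k) = scale (q powi (int d - 2 * k)) (w k)" for k
    using bidiagonal_extend[OF lin[OF gens(3)], of 1 d u "\<lambda>k. q powi (int d - 2 * k)" "\<lambda>_. 0" k] x23
    by (simp add: represents_Kmat_iff w_def extend_zero_of_nat)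
  have act12: "x 1 2 (w k) = scale (q powi (2 * k - int d)) (w k)
      + scale (q powi int d - q powi (2 * k - 2 - int d)) (w (k - 1))" for k
    unfolding w_def
    by (rule bidiagonal_extend) (use lin gens x12 in \<open>simp_all add: represents_Emat_iff extend_zero_of_nat\<close>)
  have act31: "x 3 1 (w k) = scale (q powi (2 * k - int d)) (w k)
      + scale (q powi (- int d) - q powi (2 * k + 2 - int d)) (w (k + 1))" for k
  proof -
    have "x 3 1 (w k) = scale (q powi (2 * k - int d)) (w k)
      + scale (q powi (- int d) - q powi (2 * k + 2 - int d)) (w (k - (- 1)))"
      unfolding w_def
      by (rule bidiagonal_extend) (use lin gens x31 in \<open>simp_all add: represents_Zmat_Emat_iff extend_zero_of_nat\<close>)
    then show ?thesis by simp
  qed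

  have lin30: "Vector_Spaces.linear scale scale (\<lambda>v. x 3 1 v + scale (t * q) (v - x 2 3 (x 3 1 v)))"
    by unfold_locales (simp_all add: hom gens algebra_simps)
  have lin01: "Vector_Spaces.linear scale scale (\<lambda>v. x 3 1 v + scale (inverse (t * q)) (v - x 1 2 (x 3 1 v)))"
    by unfold_locales (simp_all add: hom gens algebra_simps)
  \<comment> \<open>both sides have the same matrix in that basis\<close>
  have ev30: "x 3 0 v = x 3 1 v + scale (t * q) (v - x 2 3 (x 3 1 v))" for v
  proof (rule represents_unique[OF basis x30 _ lin[OF gens(4)] lin30])
    show "represents scale d u (\<lambda>v. x 3 1 v + scale (t * q) (v - x 2 3 (x 3 1 v)))
        (Zmat d * Gmat d (inverse q) t * Zmat d)"
      unfolding represents_Zmat_Gmat_iff w_def[symmetric]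
      using evaluation_lower_action[where w = w and B = "x 2 3" and C = "x 3 1", OF q lin[OF gens(3)] act23 act31] by (simp add: wu[symmetric])
  qed
  have ev01: "x 0 1 v = x 3 1 v + scale (inverse (t * q)) (v - x 1 2 (x 3 1 v))" for v
  proof (rule represents_unique[OF basis x01 _ lin[OF gens(1)] lin01])
    show "represents scale d u (\<lambda>v. x 3 1 v + scale (inverse (t * q)) (v - x 1 2 (x 3 1 v)))
        (Zmat d * Smat d (inverse q) (inverse t) * Zmat d)"
      unfolding represents_Zmat_Smat_iff[OF q t] w_def[symmetric]
      using evaluation_tridiagonal_action[where w = w and A = "x 1 2" and C = "x 3 1", OF lin[OF gens(2)] act12 act31] by (simp add: wu[symmetric])
  qed
  have ev02: "x 2 3 (x 0 2 v) - v = scale (inverse t * q) (x 0 2 v - x 1 2 v)" for v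
  proof (rule linear_eq_on_indexed_basis[OF basis, where A = "\<lambda>v. x 2 3 (x 0 2 v) - v"
        and B = "\<lambda>v. scale (inverse t * q) (x 0 2 v - x 1 2 v)"])
    show "Vector_Spaces.linear scale scale (\<lambda>v. x 2 3 (x 0 2 v) - v)"
      "Vector_Spaces.linear scale scale (\<lambda>v. scale (inverse t * q) (x 0 2 v - x 1 2 v))"
      by unfold_locales (simp_all add: hom gens algebra_simps)
    fix n assume n: "n \<le> d"
    define P E where "P = q powi (int d - 2 * int n + 1)" and "E = q powi int d - q powi (2 * int n - 2 - int d)"
    define g where "g = E * inverse (1 - t * P)"
    have x02n: "x 0 2 (u n) = scale (q powi (2 * int n - int d)) (w (int n)) + scale g (w (int n - 1))"
      using x02 n by (simp add: represents_Lmat_iff w_def g_def E_def P_def)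
    have "q powi (2 * int n - int d) * q powi (int d - 2 * int n) = 1"
      using q power_int_add[of q "2 * int n - int d" "int d - 2 * int n"] by simp
    moreover have "q powi (int d - 2 * (int n - 1)) = q * P"
      using q power_int_add[of q 1 "int d - 2 * int n + 1"] by (simp add: P_def algebra_simps)
    ultimately have left: "x 2 3 (x 0 2 (u n)) - u n = scale (g * (q * P)) (w (int n - 1))"
      unfolding x02n by (simp only: hom gens act23 scale_scale) (simp add: wu[OF n])
    have right: "x 0 2 (u n) - x 1 2 (u n) = scale (g - E) (w (int n - 1))"
      unfolding x02n unfolding wu[OF n, symmetric] act12 E_def by (simp add: algebra_simps)
    show "x 2 3 (x 0 2 (u n)) - u n = scale (inverse t * q) (x 0 2 (u n) - x 1 2 (u n))"
    proof (cases "n = 0")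
      case True
      then have "w (int n - 1) = 0" by (simp add: w_def extend_zero_def)
      then show ?thesis unfolding left right by simp
    next
      case False
      have "t \<noteq> q powi (int d - 2 * int (d + 1 - n) + 1)"
        by (rule t_generic) (use False n in auto)
      moreover have "int d - 2 * int (d + 1 - n) + 1 = - (int d - 2 * int n + 1)"
        using n by (simp add: of_nat_diff)
      ultimately have "t \<noteq> inverse P" by (metis P_def power_int_minus)
      then have "1 - t * P \<noteq> 0" using inverse_unique[of P t] by (auto simp: mult.commute)
      then have "g - E = g * (t * P)" by (simp add: g_def field_simps)
      then have "inverse t * q * (g - E) = inverse t * q * (g * (t * P))" by (rule arg_cong)
      also have "\<dots> = g * (q * P)" using t by (simp add: field_simps)
      finally have "inverse t * q * (g - E) = g * (q * P)" .
      then show ?thesis unfolding left right by (simp only: scale_scale)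
    qed
  qed

  have "x (r + 3) r v - x (r + 3) (r + 1) v
      = scale (twist t r * q) (v - x (r + 2) (r + 3) (x (r + 3) (r + 1) v))" for r v
  proof (cases r rule: four_cases)
    case 1
    then show ?thesis using ev30[of v] by (simp add: twist_def)
  next
    case 2
    have expand: "scale a (scale b (e - (f + scale c (g - h)))) = scale (a * b) (e - f) - scale (a * b * c) (g - h)"
      for a b c e f g h by (simp add: algebra_simps)
    have "x 2 3 (x 0 2 v) = v + scale (inverse t * q) (x 0 2 v - x 1 2 v)" using ev02[of v]
      by (metis add.commute diff_add_cancel)
    then have "x 3 1 (x 2 3 (x 0 2 v))
        = x 3 1 v + scale (inverse t * q) (x 3 1 (x 0 2 v) - x 3 1 (x 1 2 v))"
      by (simp add: hom gens)
    moreover have "scale q (x 0 2 v - x 2 3 (x 3 1 (x 0 2 v)))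
        = scale (inverse q) (x 0 2 v - x 3 1 (x 2 3 (x 0 2 v)))"
      by (rule swap) simp
    ultimately have "scale t (scale q (x 0 2 v - x 2 3 (x 3 1 (x 0 2 v))))
        = scale t (scale (inverse q) (x 0 2 v
          - (x 3 1 v + scale (inverse t * q) (x 3 1 (x 0 2 v) - x 3 1 (x 1 2 v)))))" by simp
    also have "\<dots> = scale (t * inverse q) (x 0 2 v - x 3 1 v)
        - scale (t * inverse q * (inverse t * q)) (x 3 1 (x 0 2 v) - x 3 1 (x 1 2 v))"
      by (rule expand)
    also have "t * inverse q * (inverse t * q) = 1" using q t by (simp add: field_simps)
    finally have "x 3 0 (x 0 2 v) = x 3 1 (x 1 2 v) + scale (t * inverse q) (x 0 2 v - x 3 1 v)"
      using ev30[of "x 0 2 v"] by simp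
    then have "scale (inverse t) (scale q (v - x 3 0 (x 0 2 v)))
        = scale (inverse t) (scale q (v - (x 3 1 (x 1 2 v) + scale (t * inverse q) (x 0 2 v - x 3 1 v))))"
      by simp
    also have "\<dots> = scale (inverse t * q) (v - x 3 1 (x 1 2 v))
          - scale (inverse t * q * (t * inverse q)) (x 0 2 v - x 3 1 v)"
      by (rule expand)
    also have "inverse t * q * (t * inverse q) = 1" using q t by (simp add: field_simps)
    also have "scale (inverse t * q) (v - x 3 1 (x 1 2 v)) = scale (inverse t) (scale q (v - x 3 1 (x 1 2 v)))"
      by simp
    also have "scale q (v - x 3 1 (x 1 2 v)) = scale (inverse q) (v - x 1 2 (x 3 1 v))"
      by (rule swap) simp
    also have "scale (inverse t) (scale (inverse q) (v - x 1 2 (x 3 1 v))) = x 0 1 v - x 3 1 v"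
      using ev01[of v] by (simp add: mult.commute)
    finally show ?thesis using 2 by (simp add: twist_def)
  next
    case 3
    have "x 3 1 (x 1 3 v) = v" by (rule inv) simp
    then have x01_x13: "x 0 1 (x 1 3 v) = v + scale (inverse (t * q)) (x 1 3 v - x 1 2 v)"
      using ev01[of "x 1 3 v"] by simp
    have "v - x 0 1 (x 1 3 v) = scale (inverse (t * q)) (x 1 2 v - x 1 3 v)"
      unfolding x01_x13 by (simp add: algebra_simps)
    then have "scale (t * q) (v - x 0 1 (x 1 3 v)) = scale (t * q) (scale (inverse (t * q)) (x 1 2 v - x 1 3 v))"
      by (rule arg_cong)
    also have "\<dots> = scale ((t * q) * inverse (t * q)) (x 1 2 v - x 1 3 v)" by (simp only: scale_scale)
    also have "(t * q) * inverse (t * q) = 1" using q t by (intro right_inverse) simp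
    finally show ?thesis using 3 by (simp add: twist_def)
  next
    case 4
    have "x 0 2 (x 2 0 v) = v" by (rule inv) simp
    then show ?thesis using ev02[of "x 2 0 v"] 4 by (simp add: twist_def)
  qed
  then show ?thesis
    by (intro boxq_evaluation.intro boxq_evaluation_axioms.intro vector_space_axioms)
      (use q root lin inv weyl eig t t_generic in \<open>simp_all\<close>)
qed

section \<open>The matrices of the standard generators\<close>

theorem theorem11p1:
  fixes q t :: "'a::alg_closed_field"
    and scale :: "'a \<Rightarrow> 'v::ab_group_add \<Rightarrow> 'v"
    and x :: "4 \<Rightarrow> 4 \<Rightarrow> 'v \<Rightarrow> 'v"
    and d :: nat
    and r :: 4
  assumes "q \<noteq> 0"
    and "\<And>n::nat. n \<ge> 1 \<Longrightarrow> q ^ n \<noteq> 1"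
    and "evaluation_module q scale x d"
    and "evaluation_parameter q scale x d t"
  shows
    "let s = (if r \<in> {0, 2} then t else inverse t);
         s' = inverse s; p = inverse q;
         Z = Zmat d; K = Kmat d; E = Emat d; F = Fmat d; G = Gmat d;
         L = Lmat d; S = Smat d; M = Mmat d;
         row1 = table_row q scale x d [(r, r+1), (r+1, r+2), (r+2, r+3), (r+3, r)];
         row2 = table_row q scale x d [(r, r+2), (r+1, r+3), (r+2, r), (r+3, r+1)]
     in
       row1 (r, r+1, r+2, r+3) [Z * S p s' * Z, E q, K q, Z * G p s * Z] \<and>
       row1 (r+1, r, r+2, r+3) [S q s', G q s, K q, Z * E p * Z] \<and>
       row1 (r, r+1, r+3, r+2) [S p s', Z * E q * Z, K p, G p s] \<and>
       row1 (r+1, r, r+3, r+2) [Z * S q s' * Z, Z * G q s * Z, K p, E p] \<and>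
       row1 (r, r+2, r+1, r+3) [F q s', E p, Z * E q * Z, Z * F p s * Z] \<and>
       row1 (r+2, r, r+1, r+3) [E q, F p s, Z * F q s' * Z, Z * E p * Z] \<and>
       row2 (r, r+1, r+2, r+3) [L q s, matinv (Z * E p * Z), matinv (L q s), Z * E p * Z] \<and>
       row2 (r+1, r, r+2, r+3) [E q, matinv (Z * L p s * Z), matinv (E q), Z * L p s * Z] \<and>
       row2 (r, r+1, r+3, r+2) [Z * L q s * Z, matinv (E p), matinv (Z * L q s * Z), E p] \<and>
       row2 (r+1, r, r+3, r+2) [Z * E q * Z, matinv (L p s), matinv (Z * E q * Z), L p s] \<and>
       row2 (r, r+2, r+1, r+3) [Z * M p s' * Z, K q, M q s, K p] \<and>
       row2 (r+2, r, r+1, r+3) [Z * M q s * Z, K q, M p s', K p]"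
proof -
  interpret boxq_evaluation scale q "twist t r" "\<lambda>i j. x (i + r) (j + r)" d
    by (rule boxq_evaluation_rotate_by)
      (rule evaluation_parameter_imp_boxq_evaluation[OF assms])
  have gens: "map (\<lambda>(i, j). (i + r, j + r)) [(0, 1), (1, 2), (2, 3), (3, 0)]
      = [(r, r + 1), (r + 1, r + 2), (r + 2, r + 3), (r + 3, r)]"
    "map (\<lambda>(i, j). (i + r, j + r)) [(0, 2), (1, 3), (2, 0), (3, 1)]
      = [(r, r + 2), (r + 1, r + 3), (r + 2, r), (r + 3, r + 1)]"
    by (simp_all add: add.commute)
  have shift: "0 + r = r" "1 + r = r + 1" "2 + r = r + 2" "3 + r = r + 3"
    by (simp_all add: add.commute)
  show ?thesis
    unfolding Let_def twist_def[symmetric]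
    using table_rows_edges[unfolded table_row_rotate gens shift]
      table_rows_diagonals[unfolded table_row_rotate gens shift]
    by (intro conjI)
qed

end
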